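(* Let $M$ be a connected one-corner gridding matrix with dimensions $(r+1)\times(c+1)$, with corner type $\tau$, and with $p$ non-corner peaks. Then $$|\mathrm{Grid}_n(M)|\sim 2^{-p}\,\kappa(\tau)\,\theta^\#\,g^n\qquad(n\to\infty),$$ where $$\theta^\#=\frac{r+c+q+1}{2q},\qquad g=\frac{r+c+q+1}{2},\qquad q=\sqrt{(r+c+1)^2-4cr},$$ and $\kappa(\tau)$ is the correction factor $$\kappa(\tau)=\lim_{n\to\infty}\frac{|\mathrm{Grid}_n(M')|}{|\mathrm{Grid}^\#_n(M')|}$$ for a connected one-corner gridding matrix $M'$ with the same corner type and dimensions as $M$ but with no non-corner peaks.
   Context: A permutation of length $n$ is identified with its plot $\{(i,\sigma_i)\}$. A gridding matrix $M$ is a matrix each of whose entries (cells) is "increasing", "decreasing" or "blank". If $M$ has $t$ columns (numbered left to right) and $u$ rows (numbered bottom to top), an $M$-gridding of a permutation $\sigma$ of length $n$ is a pair of integer sequences $0=c_0\leq\dots\leq c_t=n$ (column dividers) and $0=r_0\leq\dots\leq r_u=n$ (row dividers) such that for every column $i$ and row $j$ the subsequence of $\sigma$ with indices in $(c_{i-1},c_i]$ and values in $(r_{j-1},r_j]$ is increasing, decreasing or empty according to whether the entry of $M$ in column $i$, row $j$ is increasing, decreasing or blank. $\mathrm{Grid}_n(M)$ is the set of permutations of length $n$ having at least one $M$-gridding; $\mathrm{Grid}^\#_n(M)$ is the set of $M$-gridded permutations of length $n$ (pairs consisting of a permutation and one of its $M$-griddings). A corner of $M$ is a non-blank cell $C$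 such that there is another non-blank cell in the row of $C$ and another non-blank cell in the column of $C$. A connected one-corner gridding matrix of dimensions $(r+1)\times(c+1)$ (that is, $r+1$ rows and $c+1$ columns, $r,c\geq1$) consists of a corner cell, $r$ other non-blank cells making up the rest of the column of the corner, and $c$ other non-blank cells making up the rest of the row of the corner, all other cells being blank; thus it is L-shaped, T-shaped or X-shaped (up to orientation). The corner type of $M$ is the configuration consisting of the corner cell together with its immediately adjacent non-blank cells (which of the left, right, upper and lower neighbours are present) and the orientation (increasing or decreasing) of each of these cells. A peak is a pair of horizontally or vertically adjacent non-blank cells, one of which is increasing and the other decreasing; it is a non-corner peak if neither of its two cells is the corner. Here $f(n)\sim g(n)$ means $\lim_{n\to\infty}f(n)/g(n)=1$. *)

theory Defs
  imports Complex_Main "HOL-Combinatorics.Permutations" "Jordan_Normal_Form.Matrix"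
begin

text \<open>
  A gridding matrix is a matrix of cells. The entry in column \<open>i\<close> and row \<open>j\<close> is
  \<open>M $$ (j, i)\<close>: columns are numbered from left to right and rows from bottom to top, both
  starting from 0. In particular row \<open>j + 1\<close> lies directly above row \<open>j\<close>.
\<close>

datatype cell = Increasing | Decreasing | Blank

type_synonym gridding_matrix = "cell mat"

text \<open>
  A permutation of length \<open>n\<close> is a function \<open>\<sigma>\<close> with \<open>\<sigma> permutes {1..n}\<close>.
  Column dividers are given as a list \<open>[c\<^sub>0, \<dots>, c\<^sub>t]\<close>, and row dividers
  as a list \<open>[r\<^sub>0, \<dots>, r\<^sub>u]\<close>; the 0-based column \<open>i\<close> thus occupies the
  indices in \<open>{cs ! i <.. cs ! Suc i}\<close>.
\<close>

definition dividers :: "nat \<Rightarrow> nat \<Rightarrow> nat list \<Rightarrow> bool" where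
  "dividers n t cs \<longleftrightarrow> length cs = t + 1 \<and> sorted cs \<and> cs ! 0 = 0 \<and> cs ! t = n"

definition cell_indices ::
    "(nat \<Rightarrow> nat) \<Rightarrow> nat list \<Rightarrow> nat list \<Rightarrow> nat \<Rightarrow> nat \<Rightarrow> nat set" where
  "cell_indices \<sigma> cs rs j i =
     {k \<in> {cs ! i <.. cs ! Suc i}. \<sigma> k \<in> {rs ! j <.. rs ! Suc j}}"

fun fits_cell :: "cell \<Rightarrow> (nat \<Rightarrow> nat) \<Rightarrow> nat set \<Rightarrow> bool" where
  "fits_cell Increasing \<sigma> K \<longleftrightarrow> strict_mono_on K \<sigma>"
| "fits_cell Decreasing \<sigma> K \<longleftrightarrow> strict_antimono_on K \<sigma>"
| "fits_cell Blank \<sigma> K \<longleftrightarrow> K = {}"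

definition is_gridding ::
    "nat \<Rightarrow> gridding_matrix \<Rightarrow> (nat \<Rightarrow> nat) \<Rightarrow> nat list \<Rightarrow> nat list \<Rightarrow> bool" where
  "is_gridding n M \<sigma> cs rs \<longleftrightarrow>
     dividers n (dim_col M) cs \<and> dividers n (dim_row M) rs \<and>
     (\<forall>i < dim_col M. \<forall>j < dim_row M.
        fits_cell (M $$ (j, i)) \<sigma> (cell_indices \<sigma> cs rs j i))"

definition Gridded :: "nat \<Rightarrow> gridding_matrix \<Rightarrow> ((nat \<Rightarrow> nat) \<times> nat list \<times> nat list) set" where
  "Gridded n M = {(\<sigma>, cs, rs). \<sigma> permutes {1..n} \<and> is_gridding n M \<sigma> cs rs}"

definition Grid :: "nat \<Rightarrow> gridding_matrix \<Rightarrow> (nat \<Rightarrow> nat) set" where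
  "Grid n M = {\<sigma>. \<sigma> permutes {1..n} \<and> (\<exists>cs rs. is_gridding n M \<sigma> cs rs)}"

text \<open>Cells are addressed by pairs (row, column).\<close>

definition nonblank_cells :: "gridding_matrix \<Rightarrow> (nat \<times> nat) set" where
  "nonblank_cells M = {(j, i). j < dim_row M \<and> i < dim_col M \<and> M $$ (j, i) \<noteq> Blank}"

definition is_corner :: "gridding_matrix \<Rightarrow> nat \<times> nat \<Rightarrow> bool" where
  "is_corner M = (\<lambda>(j, i). (j, i) \<in> nonblank_cells M \<and>
     (\<exists>i'. i' \<noteq> i \<and> (j, i') \<in> nonblank_cells M) \<and>
     (\<exists>j'. j' \<noteq> j \<and> (j', i) \<in> nonblank_cells M))"

definition connected_one_corner :: "nat \<Rightarrow> nat \<Rightarrow> gridding_matrix \<Rightarrow> bool" where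
  "connected_one_corner r c M \<longleftrightarrow>
     r \<ge> 1 \<and> c \<ge> 1 \<and> dim_row M = r + 1 \<and> dim_col M = c + 1 \<and>
     (\<exists>j0 i0. is_corner M (j0, i0) \<and>
        nonblank_cells M = {(j, i). j \<le> r \<and> i \<le> c \<and> (j = j0 \<or> i = i0)})"

definition corner :: "gridding_matrix \<Rightarrow> nat \<times> nat" where
  "corner M = (THE C. is_corner M C)"

text \<open>
  In a corner type, \<open>Blank\<close> records that the neighbour in that direction is absent. In a
  connected one-corner matrix this happens exactly when it would lie outside the matrix.
\<close>

record corner_config =
  corner_cell :: cell
  left_cell :: cell
  right_cell :: cell
  lower_cell :: cell
  upper_cell :: cell

definition corner_type :: "gridding_matrix \<Rightarrow> corner_config" where
  "corner_type M = (case corner M of (j, i) \<Rightarrow>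
     \<lparr> corner_cell = M $$ (j, i),
       left_cell = (if i = 0 then Blank else M $$ (j, i - 1)),
       right_cell = (if i + 1 < dim_col M then M $$ (j, i + 1) else Blank),
       lower_cell = (if j = 0 then Blank else M $$ (j - 1, i)),
       upper_cell = (if j + 1 < dim_row M then M $$ (j + 1, i) else Blank) \<rparr>)"

fun adjacent_cells :: "nat \<times> nat \<Rightarrow> nat \<times> nat \<Rightarrow> bool" where
  "adjacent_cells (j, i) (j', i') \<longleftrightarrow>
     j = j' \<and> (i' = i + 1 \<or> i = i' + 1) \<or> i = i' \<and> (j' = j + 1 \<or> j = j' + 1)"

text \<open>Peaks are unordered pairs, so that each is counted once.\<close>

definition peaks :: "gridding_matrix \<Rightarrow> (nat \<times> nat) set set" where
  "peaks M = {{C, D} | C D. C \<in> nonblank_cells M \<and> D \<in> nonblank_cells M \<and>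
     adjacent_cells C D \<and> M $$ C = Increasing \<and> M $$ D = Decreasing}"

definition noncorner_peaks :: "gridding_matrix \<Rightarrow> (nat \<times> nat) set set" where
  "noncorner_peaks M = {P \<in> peaks M. corner M \<notin> P}"

text \<open>
  \<open>\<kappa>\<close> is the correction factor of the corner type \<open>\<tau>\<close> if the ratio of griddable to
  gridded permutations converges to it for every matrix of type \<open>\<tau>\<close>
  without non-corner peaks. Hence it does not depend on the choice of that matrix. The matrix dimensions are part of the data, as the
  value also depends on them.
\<close>

definition is_correction_factor :: "corner_config \<Rightarrow> nat \<Rightarrow> nat \<Rightarrow> real \<Rightarrow> bool" where
  "is_correction_factor \<tau> r c \<kappa> \<longleftrightarrow>
     (\<forall>M'. connected_one_corner r c M' \<and> corner_type M' = \<tau> \<and> noncorner_peaks M' = {} \<longrightarrow>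
        (\<lambda>n. real (card (Grid n M')) / real (card (Gridded n M'))) \<longlonglongrightarrow> \<kappa>)"

lemma corner_eqI:
  assumes r: "r \<ge> 1" and c: "c \<ge> 1" and j0: "j0 \<le> r" and i0: "i0 \<le> c"
    and nb: "nonblank_cells M = {(j, i). j \<le> r \<and> i \<le> c \<and> (j = j0 \<or> i = i0)}"
  shows "is_corner M (j0, i0)" and "corner M = (j0, i0)"
proof -
  have "\<exists>i'. i' \<noteq> i0 \<and> i' \<le> c" "\<exists>j'. j' \<noteq> j0 \<and> j' \<le> r"
    using r c by (metis le0 not_one_le_zero)+
  then show *: "is_corner M (j0, i0)"
    using j0 i0 by (auto simp: is_corner_def nb)
  have uniq: "C = (j0, i0)" if "is_corner M C" for C
    using that by (cases C) (auto simp: is_corner_def nb)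
  show "corner M = (j0, i0)"
    unfolding corner_def using * uniq by (rule the_equality)
qed

text \<open>
  Every corner type that occurs has a representative of the same dimensions without
  non-corner peaks, so
  the predicate \<open>is_correction_factor\<close> determines \<open>\<kappa>\<close> uniquely.
\<close>

lemma peak_free_representative:
  assumes "connected_one_corner r c M"
  obtains M' where "connected_one_corner r c M'" "corner_type M' = corner_type M"
    "noncorner_peaks M' = {}"
proof -
  from assms obtain j0 i0 where rc: "r \<ge> 1" "c \<ge> 1"
    and dM: "dim_row M = r + 1" "dim_col M = c + 1"
    and cor: "is_corner M (j0, i0)"
    and nb: "nonblank_cells M = {(j, i). j \<le> r \<and> i \<le> c \<and> (j = j0 \<or> i = i0)}"
    unfolding connected_one_corner_def by blast
  have le: "j0 \<le> r" "i0 \<le> c" using cor by (auto simp: is_corner_def nb)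
  have cM: "corner M = (j0, i0)" using corner_eqI[OF rc le nb] by simp
  have nonbl: "M $$ (j, i) \<noteq> Blank" if "j \<le> r" "i \<le> c" "j = j0 \<or> i = i0" for j i
  proof -
    have "(j, i) \<in> nonblank_cells M" using that by (simp add: nb)
    then show ?thesis by (simp add: nonblank_cells_def)
  qed
  define s where "s k a = (if k < a then a - 1 else if k = a then a else a + 1)" for k a :: nat
  define M' where "M' = mat (r + 1) (c + 1) (\<lambda>(j, i).
    if j = j0 \<or> i = i0 then M $$ (s j j0, s i i0) else Blank)"
  have dM': "dim_row M' = r + 1" "dim_col M' = c + 1" by (auto simp: M'_def)
  have ent: "M' $$ (j, i) = (if j = j0 \<or> i = i0 then M $$ (s j j0, s i i0) else Blank)"
    if "j \<le> r" "i \<le> c" for j i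
    using that by (simp add: M'_def)
  have s_le: "s k a \<le> m" if "k \<le> m" "a \<le> m" for k a m using that by (auto simp: s_def)
  have s_self: "s a a = a" for a by (simp add: s_def)
  have ne: "M' $$ (j, i) \<noteq> Blank \<longleftrightarrow> j = j0 \<or> i = i0" if "j \<le> r" "i \<le> c" for j i
  proof -
    have "M $$ (s j j0, s i i0) \<noteq> Blank" if "j = j0 \<or> i = i0"
      using nonbl s_le s_self \<open>j \<le> r\<close> \<open>i \<le> c\<close> le that by metis
    then show ?thesis using ent[OF that] by auto
  qed
  have nb': "nonblank_cells M' = {(j, i). j \<le> r \<and> i \<le> c \<and> (j = j0 \<or> i = i0)}"
    using ne by (auto simp: nonblank_cells_def dM' less_Suc_eq_le)
  have cor': "is_corner M' (j0, i0)" and cM': "corner M' = (j0, i0)"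
    using corner_eqI[OF rc le nb'] by auto
  have 1: "connected_one_corner r c M'"
    unfolding connected_one_corner_def using rc dM' cor' nb' by blast
  have 2: "corner_type M' = corner_type M"
    using le by (auto simp: corner_type_def cM cM' dM dM' ent s_def)
  have same: "M' $$ C = M' $$ D" if "C \<in> nonblank_cells M'" "D \<in> nonblank_cells M'"
    "adjacent_cells C D" "C \<noteq> (j0, i0)" "D \<noteq> (j0, i0)" for C D
  proof -
    obtain j i j' i' where CD: "C = (j, i)" "D = (j', i')" by (cases C, cases D) auto
    have "s j j0 = s j' j0" "s i i0 = s i' i0"
      using that unfolding CD nb' by (auto simp: s_def)
    moreover have "j \<le> r" "i \<le> c" "j' \<le> r" "i' \<le> c" "j = j0 \<or> i = i0" "j' = j0 \<or> i' = i0"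
      using that unfolding CD nb' by auto
    ultimately show ?thesis unfolding CD by (simp add: ent)
  qed
  have 3: "noncorner_peaks M' = {}"
  proof (rule equals0I)
    fix P assume "P \<in> noncorner_peaks M'"
    then have "P \<in> peaks M'" and nP: "(j0, i0) \<notin> P"
      by (simp_all add: noncorner_peaks_def cM')
    then obtain C D where P: "P = {C, D}"
      and CD: "C \<in> nonblank_cells M'" "D \<in> nonblank_cells M'" "adjacent_cells C D"
      and val: "M' $$ C = Increasing" "M' $$ D = Decreasing"
      unfolding peaks_def by blast
    from P nP have "C \<noteq> (j0, i0)" "D \<noteq> (j0, i0)" by blast+
    then have "M' $$ C = M' $$ D" using same[OF CD] by blast
    with val show False by simp
  qed
  from 1 2 3 show ?thesis by (rule that)
qed

lemma correction_factor_unique: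
  assumes "connected_one_corner r c M"
    and "is_correction_factor (corner_type M) r c \<kappa>"
    and "is_correction_factor (corner_type M) r c \<kappa>'"
  shows "\<kappa> = \<kappa>'"
proof -
  obtain M' where M': "connected_one_corner r c M'" "corner_type M' = corner_type M"
    "noncorner_peaks M' = {}"
    by (rule peak_free_representative[OF assms(1)])
  let ?R = "\<lambda>n. real (card (Grid n M')) / real (card (Gridded n M'))"
  have "?R \<longlonglongrightarrow> \<kappa>" "?R \<longlonglongrightarrow> \<kappa>'"
    using assms(2,3) M' by (simp_all add: is_correction_factor_def)
  then show ?thesis by (rule LIMSEQ_unique)
qed

lemma finite_Gridded: "finite (Gridded n M)"
proof (rule finite_subset)
  let ?L = "\<lambda>t. {cs. set cs \<subseteq> {..n} \<and> length cs = t + 1}"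
  have "set cs \<subseteq> {..n}" if "dividers n t cs" for t cs
  proof
    fix x assume "x \<in> set cs"
    then obtain i where "i < length cs" "cs ! i = x" by (auto simp: in_set_conv_nth)
    then show "x \<in> {..n}"
      using that sorted_nth_mono[of cs i t] by (simp add: dividers_def)
  qed
  then show "Gridded n M \<subseteq> {\<sigma>. \<sigma> permutes {1..n}} \<times> ?L (dim_col M) \<times> ?L (dim_row M)"
    by (auto simp: Gridded_def is_gridding_def dividers_def)
  show "finite ({\<sigma>. \<sigma> permutes {1..n}} \<times> ?L (dim_col M) \<times> ?L (dim_row M))"
    by (intro finite_cartesian_product finite_permutations finite_lists_length_eq) auto
qed

end

theory Submission
  imports Defs "HOL-Library.Sublist"
begin

text \<open>
  \<^bold>\<open>Gridded permutations are words.\<close> Label every point of a gridded permutation by its cell.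
  Beyond the labels, a gridding records only how the points of the main column (the column of the
  corner) interleave from left to right and how those of the main row interleave from bottom to top.
  The two orders agree, up to a reversal, on the corner cell, so they merge into one word over the
  \<open>r + c + 1\<close> nonblank cells. The merging is ambiguous only in that cells of the main row
  commute with cells of the main column. The normal form puts no column letter directly before a row
  letter; the number \<open>W n\<close> of normal words of length \<open>n\<close> then satisfies
  \<open>W (n + 2) = (r + c + 1) * W (n + 1) - r * c * W n\<close>, whence \<open>W n \<sim> \<theta> * g ^ n\<close>
  (lemmas \<open>W_rec\<close>, \<open>W_asymp\<close>, \<open>bij_gridded_of\<close>).

  \<^bold>\<open>The limit exists.\<close> The number of underlying permutations is the sum of
  \<open>1 / N w\<close> over normal words \<open>w\<close>, where \<open>N w\<close> counts the griddings of the permutation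
  of \<open>w\<close>. A gridding amounts to a relabelling of the positions of \<open>w\<close>, and its validity is a
  condition on pairs of positions (\<open>compat\<close>). Long repetitions of the whole alphabet are rigid:
  by the pigeonhole principle two copies receive the same labels, and then these labels must be the
  original ones (\<open>rigid\<close>, \<open>repetition_fixes\<close>). If such a \<open>lock\<close> occurs in both \<open>u\<close> and \<open>v\<close>,
  then everything between them is fixed too, so that \<open>N (u @ m @ v) = N (u @ v)\<close>. All but a small
  proportion of the words have a lock near each end. Hence the average of \<open>1 / N w\<close> converges,
  and its limit is positive (\<open>density_convergent\<close>, \<open>density_limit_pos\<close>).

  \<^bold>\<open>What the limit depends on.\<close> In a word with a lock in both halves, a point can change its
  cell only among the corner and its neighbours, or across a non-corner peak. Each
  non-corner peak has exactly one point that may be on either side of the divider, independently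
  of everything else, so \<open>N w\<close> is \<open>2 ^ p\<close> times the number of relabellings near the corner
  (\<open>card_relabelings_far_peaks\<close>). Rotating the rows and the columns identifies the words
  of two matrices of the same corner type and preserves the relabellings near the corner
  (\<open>card_local_relabelings_image\<close>). Therefore \<open>2 ^ p\<close> times the limit is the same for all
  matrices of one corner type; it is the correction factor.
\<close>

section \<open>Words over a partially commuting alphabet\<close>

text \<open>
  The letters of \<open>H\<close> commute with those of \<open>V\<close>, and \<open>k\<close> commutes with
  neither. Each commutation class of words has exactly one member in which no letter of \<open>V\<close>
  is directly followed by a letter of \<open>H\<close>.
\<close>

locale commuting_words =
  fixes H V :: "'a set" and k :: 'a
  assumes finite_H: "finite H" and finite_V: "finite V"
    and H_ne: "H \<noteq> {}" and V_ne: "V \<noteq> {}"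
    and k_H: "k \<notin> H" and k_V: "k \<notin> V" and H_V: "H \<inter> V = {}"
begin

definition letters :: "'a set" where
  "letters = insert k (H \<union> V)"

definition normal :: "'a list \<Rightarrow> bool" where
  "normal w \<longleftrightarrow> set w \<subseteq> letters \<and> successively (\<lambda>a b. \<not> (a \<in> V \<and> b \<in> H)) w"

definition Words :: "nat \<Rightarrow> 'a list set" where
  "Words n = {w. length w = n \<and> normal w}"

definition W :: "nat \<Rightarrow> nat" where
  "W n = card (Words n)"

lemma finite_letters: "finite letters"
  by (simp add: letters_def finite_H finite_V)

lemma finite_Words: "finite (Words n)"
  by (rule finite_subset[OF _ finite_lists_length_eq[OF finite_letters, of n]])
    (auto simp: Words_def normal_def)

lemma normal_Nil [simp]: "normal []"
  by (simp add: normal_def)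

lemma normal_append_iff:
  "normal (u @ v) \<longleftrightarrow> normal u \<and> normal v \<and> (u = [] \<or> v = [] \<or> \<not> (last u \<in> V \<and> hd v \<in> H))"
  by (auto simp: normal_def successively_append_iff)

lemma normal_Cons_iff:
  "normal (a # w) \<longleftrightarrow> a \<in> letters \<and> normal w \<and> (w = [] \<or> \<not> (a \<in> V \<and> hd w \<in> H))"
  by (auto simp: normal_def successively_Cons)

lemma normal_append_k:
  assumes "normal u" "normal v" "u \<noteq> [] \<and> last u = k \<or> v \<noteq> [] \<and> hd v = k"
  shows "normal (u @ v)"
  using assms k_H k_V by (auto simp: normal_append_iff)

lemma W_0: "W 0 = 1"
proof -
  have "Words 0 = {[]}" by (auto simp: Words_def)
  then show ?thesis by (simp add: W_def)
qed

lemma card_letters: "card letters = card V + card H + 1"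
  using finite_H finite_V k_H k_V H_V
  by (simp add: letters_def card_Un_disjoint)

lemma W_1: "W (Suc 0) = card V + card H + 1"
proof -
  have "Words (Suc 0) = (\<lambda>a. [a]) ` letters"
    by (auto simp: Words_def length_Suc_conv normal_Cons_iff)
  then show ?thesis
    by (simp add: W_def card_image inj_on_def card_letters)
qed

text \<open>
  Prepending an arbitrary letter to a normal word fails to be normal only if it creates a
  factor \<open>v h\<close>. The failures are exactly the words \<open>v h w\<close> with \<open>w\<close> normal,
  because a letter of \<open>H\<close> may stand before any normal word.
\<close>

lemma W_rec: "W (Suc (Suc n)) + card V * card H * W n = (card V + card H + 1) * W (Suc n)"
proof -
  let ?all = "(\<lambda>(a, w). a # w) ` (letters \<times> Words (Suc n))"
  let ?bad = "(\<lambda>(a, b, w). a # b # w) ` (V \<times> H \<times> Words n)"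
  have sub: "V \<subseteq> letters" "H \<subseteq> letters" by (auto simp: letters_def)
  have cons_H: "normal (b # w)" if "b \<in> H" "normal w" for b w
    using that H_V sub by (auto simp: normal_Cons_iff)
  have "?all = Words (Suc (Suc n)) \<union> ?bad"
  proof (intro equalityI subsetI)
    fix x assume "x \<in> ?all"
    then obtain a w where x: "x = a # w" "a \<in> letters" "w \<in> Words (Suc n)" by auto
    then obtain b w' where w: "w = b # w'" by (auto simp: Words_def length_Suc_conv)
    then have *: "length w' = n" "normal w'" using x by (auto simp: Words_def normal_Cons_iff)
    show "x \<in> Words (Suc (Suc n)) \<union> ?bad"
    proof (cases "a \<in> V \<and> b \<in> H")
      case True
      then show ?thesis using x w * by (auto simp: Words_def image_iff)
    next
      case False
      then show ?thesis using x w by (auto simp: Words_def normal_Cons_iff)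
    qed
  next
    fix x assume "x \<in> Words (Suc (Suc n)) \<union> ?bad"
    then show "x \<in> ?all"
    proof
      assume "x \<in> Words (Suc (Suc n))"
      then obtain a w where x: "x = a # w" "length w = Suc n" "normal x"
        by (auto simp: Words_def length_Suc_conv)
      then show ?thesis
        by (auto simp: Words_def normal_Cons_iff intro!: image_eqI[of _ _ "(a, w)"])
    next
      assume "x \<in> ?bad"
      then obtain a b w where "x = a # b # w" "a \<in> V" "b \<in> H" "w \<in> Words n" by auto
      then show ?thesis using sub cons_H
        by (auto simp: Words_def intro!: image_eqI[of _ _ "(a, b # w)"])
    qed
  qed
  moreover have "Words (Suc (Suc n)) \<inter> ?bad = {}"
    by (auto simp: Words_def normal_Cons_iff)
  moreover have "finite ?bad" using finite_H finite_V finite_Words by simp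
  ultimately have "card ?all = W (Suc (Suc n)) + card ?bad"
    by (simp add: W_def card_Un_disjoint finite_Words)
  moreover have "card ?all = (card V + card H + 1) * W (Suc n)"
    by (subst card_image) (auto simp: inj_on_def card_cartesian_product card_letters W_def)
  moreover have "card ?bad = card V * card H * W n"
    by (subst card_image) (auto simp: inj_on_def card_cartesian_product W_def)
  ultimately show ?thesis by simp
qed

text \<open>
  The characteristic roots of the recurrence are \<open>growth > small_root > 0\<close>, and
  \<open>root_gap\<close> is their difference.
\<close>

definition root_gap :: real where
  "root_gap = sqrt ((real (card V) + real (card H) + 1)\<^sup>2 - 4 * real (card H) * real (card V))"

definition growth :: real where
  "growth = (real (card V) + real (card H) + root_gap + 1) / 2"

definition small_root :: real where
  "small_root = (real (card V) + real (card H) - root_gap + 1) / 2"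

lemma card_pos: "card V > 0" "card H > 0"
  using finite_H finite_V H_ne V_ne by (auto simp: card_gt_0_iff)

lemma root_gap_square: "root_gap\<^sup>2 = (real (card V) + real (card H) + 1)\<^sup>2 - 4 * real (card H) * real (card V)"
  and root_gap_pos: "root_gap > 0"
proof -
  have "(real (card V) + real (card H) + 1)\<^sup>2 - 4 * real (card H) * real (card V)
      = (real (card V) - real (card H))\<^sup>2 + 2 * (real (card V) + real (card H)) + 1"
    by (simp add: power2_eq_square algebra_simps)
  also have "\<dots> > 0" by (simp add: add_nonneg_pos)
  finally have pos: "(real (card V) + real (card H) + 1)\<^sup>2 - 4 * real (card H) * real (card V) > 0" .
  show "root_gap\<^sup>2 = (real (card V) + real (card H) + 1)\<^sup>2 - 4 * real (card H) * real (card V)"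
    unfolding root_gap_def using pos by (intro real_sqrt_pow2) linarith
  show "root_gap > 0" unfolding root_gap_def using pos by simp
qed

lemma growth_roots: "growth + small_root = real (card V) + real (card H) + 1" "growth - small_root = root_gap"
  "growth * small_root = real (card V) * real (card H)"
proof -
  show "growth + small_root = real (card V) + real (card H) + 1" "growth - small_root = root_gap"
    by (simp_all add: growth_def small_root_def field_simps)
  have "4 * (growth * small_root) = (real (card V) + real (card H) + 1)\<^sup>2 - root_gap\<^sup>2"
    by (simp add: growth_def small_root_def field_simps power2_eq_square)
  then show "growth * small_root = real (card V) * real (card H)"
    using root_gap_square by simp
qed

lemma growth_bounds: "growth > 0" "small_root > 0" "small_root < growth"
proof -
  show "growth > 0" using root_gap_pos by (simp add: growth_def add_pos_pos add_nonneg_pos)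
  moreover have "growth * small_root > 0" using growth_roots(3) card_pos by simp
  ultimately show "small_root > 0" by (simp add: zero_less_mult_iff)
  show "small_root < growth" using growth_roots(2) root_gap_pos by linarith
qed

lemma W_closed: "root_gap * real (W n) = growth ^ Suc n - small_root ^ Suc n"
proof (induction n rule: induct_nat_012)
  case 0
  then show ?case using growth_roots by (simp add: W_0)
next
  case 1
  have "root_gap * (growth + small_root) = growth * growth - small_root * small_root"
    unfolding growth_roots(2)[symmetric] by (simp add: algebra_simps)
  then show ?case by (simp add: W_1 growth_roots(1) algebra_simps)
next
  case (ge2 n)
  have "real (W (Suc (Suc n))) + growth * small_root * W n = (growth + small_root) * W (Suc n)"
    using arg_cong[OF W_rec[of n], of real] by (simp add: growth_roots algebra_simps)
  then have "real (W (Suc (Suc n))) = (growth + small_root) * W (Suc n) - growth * small_root * W n"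
    by linarith
  then have "root_gap * W (Suc (Suc n))
      = (growth + small_root) * (root_gap * W (Suc n)) - growth * small_root * (root_gap * W n)"
    by (simp add: right_diff_distrib mult_ac)
  also have "\<dots> = growth ^ Suc (Suc (Suc n)) - small_root ^ Suc (Suc (Suc n))"
    unfolding ge2 by (simp add: algebra_simps)
  finally show ?case .
qed

lemma W_lower: "growth ^ n \<le> real (W n)"
proof -
  have "small_root * small_root ^ n \<le> small_root * growth ^ n"
    using growth_bounds by (intro mult_left_mono power_mono) auto
  then have "(growth - small_root) * growth ^ n \<le> root_gap * W n"
    unfolding W_closed by (simp add: algebra_simps)
  then have "root_gap * growth ^ n \<le> root_gap * W n" by (simp only: growth_roots(2))
  then show ?thesis using root_gap_pos by simp
qed

lemma W_upper: "real (W n) \<le> growth / root_gap * growth ^ n"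
proof -
  have "root_gap * W n \<le> growth * growth ^ n" unfolding W_closed using growth_bounds by simp
  then show ?thesis using root_gap_pos by (simp add: field_simps)
qed

lemma W_pos: "0 < W n"
  using W_lower[of n] growth_bounds(1) zero_less_power[of growth n]
  by (metis less_le_trans of_nat_0_less_iff)

lemma W_asymp: "(\<lambda>n. real (W n) / growth ^ n) \<longlonglongrightarrow> growth / root_gap"
proof -
  have "norm (small_root / growth) < 1" using growth_bounds by simp
  then have "(\<lambda>n. (small_root / growth) ^ n) \<longlonglongrightarrow> 0"
    by (rule LIMSEQ_power_zero)
  then have "(\<lambda>n. growth / root_gap - small_root / root_gap * (small_root / growth) ^ n) \<longlonglongrightarrow> growth / root_gap - small_root / root_gap * 0"
    by (intro tendsto_diff tendsto_mult tendsto_const)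
  moreover have "real (W n) / growth ^ n = growth / root_gap - small_root / root_gap * (small_root / growth) ^ n" for n
    using W_closed[of n] growth_bounds root_gap_pos by (simp add: field_simps power_divide)
  ultimately show ?thesis by simp
qed

lemma W_shift: "(\<lambda>n. real (W (n - d)) / real (W n)) \<longlonglongrightarrow> 1 / growth ^ d"
proof (rule LIMSEQ_offset[where k = d])
  have pos: "growth / root_gap \<noteq> 0" using growth_bounds root_gap_pos by simp
  have "(\<lambda>n. (real (W n) / growth ^ n) / (real (W (n + d)) / growth ^ (n + d)) / growth ^ d)
      \<longlonglongrightarrow> (growth / root_gap) / (growth / root_gap) / growth ^ d"
    using pos growth_bounds by (intro tendsto_intros W_asymp LIMSEQ_ignore_initial_segment) auto
  moreover have "(real (W n) / growth ^ n) / (real (W (n + d)) / growth ^ (n + d)) / growth ^ d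
      = real (W (n + d - d)) / real (W (n + d))" for n
    using growth_bounds by (simp add: power_add)
  ultimately show "(\<lambda>n. real (W (n + d - d)) / real (W (n + d))) \<longlonglongrightarrow> 1 / growth ^ d"
    using pos by simp
qed

end

text \<open>
  Since \<open>B\<close> begins and ends with \<open>k\<close>, it can be spliced between any two normal
  words.
\<close>

locale commuting_words_block = commuting_words +
  fixes B
  assumes B_normal: "normal B" and B_ne: "B \<noteq> []" and B_hd: "hd B = k" and B_last: "last B = k"
begin

definition avoiding :: "nat \<Rightarrow> 'a list set" where
  "avoiding n = {w \<in> Words n. \<not> sublist B w}"

lemma normal_insert_B: "normal x \<Longrightarrow> normal y \<Longrightarrow> normal (x @ B @ y)"
  using B_normal B_ne B_hd B_last by (intro normal_append_k) auto

text \<open>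
  The words \<open>x @ B @ y\<close> in which \<open>x\<close> avoids \<open>B\<close> and has length
  \<open>t * length B\<close> are different for different \<open>t\<close>: the longer of two prefixes \<open>x\<close> would
  contain the \<open>B\<close> that follows the shorter one.
\<close>

lemma sum_avoiding_le:
  "(\<Sum>t<m. card (avoiding (t * length B)) * W (m * length B - Suc t * length B)) \<le> W (m * length B)"
proof -
  let ?s = "length B" and ?N = "m * length B"
  let ?F = "\<lambda>t. (\<lambda>(x, y). x @ B @ y) ` (avoiding (t * ?s) \<times> Words (?N - Suc t * ?s))"
  have fin: "finite (avoiding l)" for l by (simp add: avoiding_def finite_Words)
  have card_F: "card (?F t) = card (avoiding (t * ?s)) * W (?N - Suc t * ?s)" for t
    by (subst card_image)
      (auto simp: inj_on_def avoiding_def Words_def card_cartesian_product W_def)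
  have le: "Suc t * ?s \<le> ?N" if "t < m" for t using that by (intro mult_le_mono1) simp
  have sub: "?F t \<subseteq> Words ?N" if "t < m" for t
    using le[OF that] normal_insert_B by (auto simp: avoiding_def Words_def)
  have disj: "?F t \<inter> ?F t' = {}" if "t < t'" for t t'
  proof (rule ccontr)
    assume "?F t \<inter> ?F t' \<noteq> {}"
    then obtain x y x' y' where eq: "x @ B @ y = x' @ B @ y'"
      and x: "length x = t * ?s" and x': "length x' = t' * ?s" "\<not> sublist B x'"
      by (auto simp: avoiding_def Words_def)
    have "Suc t * ?s \<le> t' * ?s" using that by (intro mult_le_mono1) simp
    then have "take (t' * ?s) x = x" "Suc t * ?s \<le> t' * ?s" using x that by auto
    then have "x' = x @ B @ take (t' * ?s - Suc t * ?s) y"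
      using arg_cong[OF eq, of "take (t' * ?s)"] x x' by (simp add: add.commute diff_diff_left)
    then show False using x' by (auto simp: sublist_def)
  qed
  have "(\<Sum>t<m. card (avoiding (t * ?s)) * W (?N - Suc t * ?s)) = (\<Sum>t<m. card (?F t))"
    using card_F by simp
  also have "\<dots> = card (\<Union>t<m. ?F t)"
  proof (rule card_UN_disjoint[symmetric])
    show "\<forall>i\<in>{..<m}. finite (?F i)" using fin finite_Words by simp
    show "\<forall>i\<in>{..<m}. \<forall>j\<in>{..<m}. i \<noteq> j \<longrightarrow> ?F i \<inter> ?F j = {}"
      using disj by (metis inf_commute nat_neq_iff)
  qed simp
  also have "\<dots> \<le> W ?N" unfolding W_def
    using sub finite_Words by (intro card_mono) auto
  finally show ?thesis .
qed

text \<open>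
  After division by the power of \<open>growth\<close>, the previous inequality bounds the partial
  sums of a series with nonnegative terms.
\<close>

lemma avoiding_tendsto_0:
  "(\<lambda>t. real (card (avoiding (t * length B))) / growth ^ (t * length B)) \<longlonglongrightarrow> 0"
proof -
  let ?s = "length B"
  let ?a = "\<lambda>t. real (card (avoiding (t * ?s))) / growth ^ (t * ?s)"
  have "sum ?a {..<m} \<le> growth / root_gap * growth ^ ?s" for m
  proof -
    have "sum ?a {..<m} * growth ^ (m * ?s)
        = (\<Sum>t<m. real (card (avoiding (t * ?s))) * growth ^ (m * ?s - Suc t * ?s)) * growth ^ ?s"
    proof -
      have "?a t * growth ^ (m * ?s) = real (card (avoiding (t * ?s))) * growth ^ (m * ?s - Suc t * ?s) * growth ^ ?s"
        if "t < m" for t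
      proof -
        have "Suc t * ?s \<le> m * ?s" using that by (intro mult_le_mono1) simp
        then have "m * ?s = t * ?s + (m * ?s - Suc t * ?s) + ?s" by simp
        then have "growth ^ (m * ?s) = growth ^ (t * ?s) * growth ^ (m * ?s - Suc t * ?s) * growth ^ ?s"
          by (metis power_add)
        then show ?thesis using growth_bounds by simp
      qed
      then show ?thesis unfolding sum_distrib_right by (intro sum.cong) auto
    qed
    also have "\<dots> \<le> (\<Sum>t<m. real (card (avoiding (t * ?s))) * real (W (m * ?s - Suc t * ?s))) * growth ^ ?s"
      using growth_bounds by (intro mult_right_mono sum_mono mult_left_mono W_lower) auto
    also have "\<dots> \<le> real (W (m * ?s)) * growth ^ ?s"
      using of_nat_mono[OF sum_avoiding_le[of m]] growth_bounds
      by (intro mult_right_mono) auto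
    also have "\<dots> \<le> growth / root_gap * growth ^ (m * ?s) * growth ^ ?s"
      using W_upper growth_bounds by (intro mult_right_mono) auto
    finally have "sum ?a {..<m} * growth ^ (m * ?s) \<le> (growth / root_gap * growth ^ ?s) * growth ^ (m * ?s)"
      by (simp add: mult_ac)
    then show ?thesis using growth_bounds by (meson mult_right_le_imp_le zero_less_power)
  qed
  then have "summable ?a"
    using growth_bounds by (intro summableI_nonneg_bounded) auto
  then show ?thesis by (rule summable_LIMSEQ_zero)
qed

text \<open>
  Two functions on words will only be comparable on locked words. The variant with \<open>L\<close> is
  stronger, and its failures are easy to count.
\<close>

definition locked :: "'a list \<Rightarrow> bool" where
  "locked w \<longleftrightarrow> (\<exists>u v. w = u @ v \<and> sublist B u \<and> sublist B v)"

definition locked_within :: "nat \<Rightarrow> 'a list \<Rightarrow> bool" where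
  "locked_within L w \<longleftrightarrow> 2 * L \<le> length w \<and>
     sublist B (take L w) \<and> sublist B (drop (length w - L) w)"

lemma locked_within_imp_locked: "locked_within L w \<Longrightarrow> locked w"
proof -
  assume a: "locked_within L w"
  have "take L w @ drop L w = w" by simp
  moreover have "drop (length w - L) w = drop (length w - 2 * L) (drop L w)"
    using a by (simp add: locked_within_def)
  then have "sublist B (drop L w)"
    using a unfolding locked_within_def
    by (metis sublist_drop sublist_order.order_trans)
  ultimately show "locked w" using a unfolding locked_def locked_within_def by metis
qed

lemma card_not_locked_within_le:
  assumes "2 * L \<le> n"
  shows "card {w \<in> Words n. \<not> locked_within L w} \<le> 2 * card (avoiding L) * W (n - L)"
proof -
  let ?P = "(\<lambda>(x, y). x @ y) ` (avoiding L \<times> Words (n - L))"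
  let ?S = "(\<lambda>(x, y). y @ x) ` (avoiding L \<times> Words (n - L))"
  have fin: "finite (avoiding L \<times> Words (n - L))" by (simp add: avoiding_def finite_Words)
  have parts: "normal (take i w)" "normal (drop i w)" if "normal w" for i w
    using that by (metis append_take_drop_id normal_append_iff)+
  have "{w \<in> Words n. \<not> locked_within L w} \<subseteq> ?P \<union> ?S"
  proof
    fix w assume w: "w \<in> {w \<in> Words n. \<not> locked_within L w}"
    then have "length w = n" "normal w" by (auto simp: Words_def)
    moreover from w assms this have "\<not> sublist B (take L w) \<or> \<not> sublist B (drop (n - L) w)"
      by (auto simp: locked_within_def)
    ultimately show "w \<in> ?P \<union> ?S"
      using assms parts
      by (auto simp: avoiding_def Words_def intro: image_eqI[of _ _ "(take L w, drop L w)"]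
          image_eqI[of _ _ "(drop (n - L) w, take (n - L) w)"])
  qed
  then have "card {w \<in> Words n. \<not> locked_within L w} \<le> card (?P \<union> ?S)"
    using fin by (intro card_mono) auto
  also have "\<dots> \<le> card ?P + card ?S" by (rule card_Un_le)
  also have "\<dots> \<le> card (avoiding L \<times> Words (n - L)) + card (avoiding L \<times> Words (n - L))"
    using fin by (intro add_mono card_image_le)
  finally show ?thesis by (simp add: card_cartesian_product W_def)
qed

lemma not_locked_within_rare:
  assumes "e > 0"
  obtains L where "\<And>n. 2 * L \<le> n \<Longrightarrow>
    real (card {w \<in> Words n. \<not> locked_within L w}) \<le> e * real (W n)"
proof -
  define C where "C = 2 * (growth / root_gap)"
  have C: "C > 0" using growth_bounds root_gap_pos by (simp add: C_def)
  then have "\<forall>\<^sub>F t in sequentially.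
      real (card (avoiding (t * length B))) / growth ^ (t * length B) < e / C"
    using avoiding_tendsto_0 assms by (intro order_tendstoD) auto
  then obtain L where L: "real (card (avoiding L)) / growth ^ L < e / C"
    by (auto simp: eventually_sequentially)
  show thesis
  proof (rule that[of L])
    fix n assume n: "2 * L \<le> n"
    have "real (card {w \<in> Words n. \<not> locked_within L w}) \<le> 2 * real (card (avoiding L)) * real (W (n - L))"
      using of_nat_mono[OF card_not_locked_within_le[OF n], where 'a = real] by simp
    also have "\<dots> \<le> 2 * real (card (avoiding L)) * (growth / root_gap * growth ^ (n - L))"
      by (intro mult_left_mono W_upper) simp
    also have "\<dots> = C * (real (card (avoiding L)) / growth ^ L) * growth ^ n"
      using n growth_bounds by (simp add: C_def power_diff)
    also have "\<dots> \<le> e * growth ^ n"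
      using L C growth_bounds by (intro mult_right_mono) (auto simp: field_simps)
    also have "\<dots> \<le> e * W n" using assms W_lower by simp
    finally show "real (card {w \<in> Words n. \<not> locked_within L w}) \<le> e * real (W n)" .
  qed
qed

text \<open>
  The shortest prefixes that contain \<open>B\<close>. No head is a prefix of another one, and a head
  ends with \<open>B\<close>, hence with \<open>k\<close>, so that every normal word may follow it. Tails are the
  mirror image.
\<close>

definition heads :: "nat \<Rightarrow> 'a list set" where
  "heads L = {u. length u \<le> L \<and> normal u \<and> sublist B u \<and> \<not> sublist B (butlast u)}"

definition tails :: "nat \<Rightarrow> 'a list set" where
  "tails L = {v. length v \<le> L \<and> normal v \<and> sublist B v \<and> \<not> sublist B (tl v)}"

lemma finite_heads: "finite (heads L)" and finite_tails: "finite (tails L)"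
  by (rule finite_subset[OF _ finite_lists_length_le[OF finite_letters, of L]],
      auto simp: heads_def tails_def normal_def)+

lemma heads_last: "u \<in> heads L \<Longrightarrow> u \<noteq> [] \<and> last u = k"
proof -
  assume u: "u \<in> heads L"
  then obtain x y where xy: "u = x @ B @ y" by (auto simp: heads_def sublist_def)
  have "y = []"
  proof (rule ccontr)
    assume "y \<noteq> []"
    then have "butlast u = x @ B @ butlast y" by (simp add: xy butlast_append)
    then show False using u by (auto simp: heads_def sublist_def)
  qed
  then show ?thesis using xy B_ne B_last by simp
qed

lemma tails_hd: "v \<in> tails L \<Longrightarrow> v \<noteq> [] \<and> hd v = k"
proof -
  assume v: "v \<in> tails L"
  then obtain x y where xy: "v = x @ B @ y" by (auto simp: tails_def sublist_def)
  have "x = []"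
  proof (rule ccontr)
    assume "x \<noteq> []"
    then have "tl v = tl x @ B @ y" by (simp add: xy)
    then show False using v by (auto simp: tails_def sublist_def)
  qed
  then show ?thesis using xy B_ne B_hd by simp
qed

lemma heads_prefix_free:
  assumes "u \<in> heads L" "u' \<in> heads L" "u @ x = u' @ x'"
  shows "u = u'"
proof -
  have False if u: "u \<in> heads L" "u' \<in> heads L" "u @ x = u' @ x'" "length u < length u'" for u u' x x'
  proof -
    obtain y where y: "u' = u @ y"
      using append_eq_append_conv2[THEN iffD1, OF u(3)] u(4) by fastforce
    then have "y \<noteq> []" using u(4) by auto
    with y have "sublist u (butlast u')" by (auto simp: butlast_append sublist_def)
    then show False using u(1,2) unfolding heads_def
      by (auto dest: sublist_order.order_trans)
  qed
  from this[OF assms(1,2,3)] this[OF assms(2,1) assms(3)[symmetric]]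
  have "length u = length u'" by (meson linorder_neqE_nat)
  then show ?thesis using assms(3) by simp
qed

lemma tails_suffix_free:
  assumes "v \<in> tails L" "v' \<in> tails L" "x @ v = x' @ v'"
  shows "v = v'"
proof -
  have False if v: "v \<in> tails L" "v' \<in> tails L" "x @ v = x' @ v'" "length v < length v'" for v v' x x'
  proof -
    obtain y where y: "v' = y @ v"
      using append_eq_append_conv2[THEN iffD1, OF v(3)] v(4) by fastforce
    then have "y \<noteq> []" using v(4) by auto
    then have "tl v' = tl y @ v @ []" using y by simp
    then have "sublist v (tl v')" unfolding sublist_def by blast
    then show False using v(1,2) unfolding tails_def
      by (auto dest: sublist_order.order_trans)
  qed
  from this[OF assms(1,2,3)] this[OF assms(2,1) assms(3)[symmetric]]
  have "length v = length v'" by (meson linorder_neqE_nat)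
  then show ?thesis using assms(3) by simp
qed

lemma shortest_head:
  assumes "normal w" "sublist B w" "length w \<le> L"
  obtains u y where "u \<in> heads L" "w = u @ y"
proof -
  define l where "l = (LEAST l. sublist B (take l w))"
  have ex: "sublist B (take (length w) w)" using assms by simp
  have l: "sublist B (take l w)" unfolding l_def by (rule LeastI[of _ "length w"]) fact
  have l_le: "l \<le> length w" unfolding l_def by (rule Least_le) fact
  have "l > 0" using l B_ne by (cases l) auto
  then have "\<not> sublist B (take (l - 1) w)"
    using not_less_Least[of "l - 1" "\<lambda>l. sublist B (take l w)"] by (simp add: l_def)
  then have "take l w \<in> heads L"
    using l l_le assms normal_append_iff[of "take l w" "drop l w"]
    by (auto simp: heads_def butlast_take)
  then show thesis using that[of "take l w" "drop l w"] by simp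
qed

lemma shortest_tail:
  assumes "normal w" "sublist B w" "length w \<le> L"
  obtains v y where "v \<in> tails L" "w = y @ v"
proof -
  define l where "l = (GREATEST l. l \<le> length w \<and> sublist B (drop l w))"
  have ex: "0 \<le> length w \<and> sublist B (drop 0 w)" using assms by simp
  have l: "l \<le> length w \<and> sublist B (drop l w)" unfolding l_def
    by (rule GreatestI_nat[of "\<lambda>l. l \<le> length w \<and> sublist B (drop l w)" 0 "length w"]) (use ex in auto)
  have max: "l' \<le> l" if "l' \<le> length w" "sublist B (drop l' w)" for l'
    unfolding l_def by (rule Greatest_le_nat[where b = "length w"]) (use that in auto)
  have "l < length w" using l B_ne by (cases "l = length w") auto
  then have "\<not> sublist B (drop (Suc l) w)" using max[of "Suc l"] by auto
  then have "drop l w \<in> tails L"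
    using l assms normal_append_iff[of "take l w" "drop l w"]
    by (auto simp: tails_def tl_drop drop_Suc)
  then show thesis using that[of "drop l w" "take l w"] by simp
qed

text \<open>
  A word with \<open>B\<close> near both ends splits uniquely into a head, a middle and a tail, and the
  middle is an arbitrary normal word.
\<close>

lemma bij_betw_locked_within:
  assumes n: "2 * L \<le> n"
  shows "bij_betw (\<lambda>((u, v), m). u @ m @ v)
    (SIGMA (u, v) : heads L \<times> tails L. Words (n - (length u + length v)))
    {w \<in> Words n. locked_within L w}"
  unfolding bij_betw_def
proof (intro conjI inj_onI equalityI subsetI)
  let ?D = "SIGMA (u, v) : heads L \<times> tails L. Words (n - (length u + length v))"
  fix t t' assume "t \<in> ?D" "t' \<in> ?D"
    and eq: "(\<lambda>((u, v), m). u @ m @ v) t = (\<lambda>((u, v), m). u @ m @ v) t'"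
  then obtain u v m u' v' m' where t: "t = ((u, v), m)" "t' = ((u', v'), m')"
    and uv: "u \<in> heads L" "v \<in> tails L" "u' \<in> heads L" "v' \<in> tails L"
    by auto
  have "u = u'" using heads_prefix_free[OF uv(1,3), of "m @ v" "m' @ v'"] eq t by simp
  moreover have "v = v'" using tails_suffix_free[OF uv(2,4), of "u @ m" "u' @ m'"] eq t by simp
  ultimately show "t = t'" using eq t by simp
next
  let ?D = "SIGMA (u, v) : heads L \<times> tails L. Words (n - (length u + length v))"
  fix w assume "w \<in> (\<lambda>((u, v), m). u @ m @ v) ` ?D"
  then obtain u v m where w: "w = u @ m @ v" and u: "u \<in> heads L" and v: "v \<in> tails L"
    and m: "m \<in> Words (n - (length u + length v))" by auto
  have len: "length u \<le> L" "length v \<le> L" using u v by (auto simp: heads_def tails_def)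
  have "normal (m @ v)"
    using m v tails_hd[OF v] normal_append_k[of m v] by (simp add: Words_def tails_def)
  then have "normal w" unfolding w
    using u heads_last[OF u] normal_append_k[of u "m @ v"] by (simp add: heads_def)
  moreover have lw: "length w = n" using m n len by (simp add: w Words_def)
  moreover have "take L w = u @ take (L - length u) (m @ v)" using len by (simp add: w)
  then have "sublist B (take L w)" using u unfolding heads_def
    by (metis (mono_tags, lifting) mem_Collect_eq sublist_append_rightI sublist_order.order_trans)
  moreover have "drop (n - L) w = drop (n - L) (u @ m) @ v"
    using len lw by (simp add: w drop_append)
  then have "sublist B (drop (n - L) w)" using v unfolding tails_def
    by (metis (mono_tags, lifting) mem_Collect_eq sublist_append_leftI sublist_order.order_trans)
  ultimately show "w \<in> {w \<in> Words n. locked_within L w}"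
    using n by (simp add: Words_def locked_within_def)
next
  let ?D = "SIGMA (u, v) : heads L \<times> tails L. Words (n - (length u + length v))"
  fix w assume "w \<in> {w \<in> Words n. locked_within L w}"
  then have w: "length w = n" "normal w" "sublist B (take L w)" "sublist B (drop (n - L) w)"
    by (auto simp: Words_def locked_within_def)
  have split: "w = take L w @ take (n - 2 * L) (drop L w) @ drop (n - L) w"
  proof -
    have "drop (n - L) w = drop (n - 2 * L) (drop L w)" using n by simp
    then show ?thesis by (metis append_take_drop_id)
  qed
  have "normal (take L w)" "normal (take (n - 2 * L) (drop L w) @ drop (n - L) w)"
    using w(2) split normal_append_iff by metis+
  then have parts: "normal (take L w)" "normal (drop (n - L) w)"
    using normal_append_iff by metis+
  obtain u y where u: "u \<in> heads L" "take L w = u @ y"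
    using shortest_head[OF parts(1) w(3), of L] by auto
  obtain v x where v: "v \<in> tails L" "drop (n - L) w = x @ v"
    using shortest_tail[OF parts(2) w(4), of L] w(1) n by auto
  define m where "m = y @ take (n - 2 * L) (drop L w) @ x"
  have w_eq: "w = u @ m @ v" using split u(2) v(2) by (simp add: m_def)
  then have "normal m" using w(2) by (simp add: normal_append_iff)
  moreover have "length m = n - (length u + length v)" using w(1) w_eq by simp
  ultimately have "((u, v), m) \<in> ?D" using u v by (simp add: Words_def)
  then show "w \<in> (\<lambda>((u, v), m). u @ m @ v) ` ?D"
    by (intro image_eqI[of _ _ "((u, v), m)"]) (auto simp: w_eq)
qed

definition density :: "('a list \<Rightarrow> real) \<Rightarrow> nat \<Rightarrow> real" where
  "density f n = (\<Sum>w\<in>Words n. f w) / real (W n)"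

definition head_tail_local :: "('a list \<Rightarrow> real) \<Rightarrow> bool" where
  "head_tail_local f \<longleftrightarrow> (\<forall>u m v. normal (u @ m @ v) \<longrightarrow> sublist B u \<longrightarrow> sublist B v \<longrightarrow>
     f (u @ m @ v) = f (u @ v))"

text \<open>
  For fixed \<open>L\<close> there are finitely many pairs of a head and a tail. Each contributes
  a constant times \<open>W (n - d) / W n\<close>.
\<close>

lemma locked_within_density_convergent:
  assumes loc: "head_tail_local f"
  shows "convergent (\<lambda>n. (\<Sum>w \<in> {w \<in> Words n. locked_within L w}. f w) / real (W n))"
proof -
  let ?G = "\<lambda>n. {w \<in> Words n. locked_within L w}"
  let ?y = "\<lambda>n. \<Sum>(u, v) \<in> heads L \<times> tails L.
    f (u @ v) * (real (W (n - (length u + length v))) / real (W n))"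
  have lim: "?y \<longlonglongrightarrow> (\<Sum>(u, v) \<in> heads L \<times> tails L. f (u @ v) * (1 / growth ^ (length u + length v)))"
    unfolding case_prod_beta by (intro tendsto_intros W_shift)
  have "?y n = sum f (?G n) / real (W n)" if n: "2 * L \<le> n" for n
  proof -
    have "sum f (?G n) = (\<Sum>t \<in> (SIGMA (u, v) : heads L \<times> tails L. Words (n - (length u + length v))).
        f ((\<lambda>((u, v), m). u @ m @ v) t))"
      by (rule sum.reindex_bij_betw[symmetric, OF bij_betw_locked_within[OF n]])
    also have "\<dots> = (\<Sum>p \<in> heads L \<times> tails L.
        \<Sum>m \<in> (case p of (u, v) \<Rightarrow> Words (n - (length u + length v))). f (fst p @ m @ snd p))"
      by (subst sum.Sigma) (auto simp: finite_heads finite_tails finite_Words intro!: sum.cong)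
    also have "\<dots> = (\<Sum>(u, v) \<in> heads L \<times> tails L. f (u @ v) * real (W (n - (length u + length v))))"
    proof (intro sum.cong refl)
      fix p assume "p \<in> heads L \<times> tails L"
      then obtain u v where p: "p = (u, v)" and u: "u \<in> heads L" and v: "v \<in> tails L" by auto
      have "f (u @ m @ v) = f (u @ v)" if "m \<in> Words (n - (length u + length v))" for m
      proof -
        have "normal (m @ v)"
          using that v tails_hd[OF v] normal_append_k[of m v] by (simp add: Words_def tails_def)
        then have "normal (u @ m @ v)"
          using u heads_last[OF u] normal_append_k[of u "m @ v"] by (simp add: heads_def)
        then show ?thesis using loc u v by (simp add: head_tail_local_def heads_def tails_def)
      qed
      then have "(\<Sum>m \<in> Words (n - (length u + length v)). f (u @ m @ v))
          = f (u @ v) * real (W (n - (length u + length v)))"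
        by (simp add: W_def mult.commute)
      then show "(\<Sum>m \<in> (case p of (u, v) \<Rightarrow> Words (n - (length u + length v))). f (fst p @ m @ snd p))
          = (case p of (u, v) \<Rightarrow> f (u @ v) * real (W (n - (length u + length v))))"
        by (simp add: p)
    qed
    finally have eq: "sum f (?G n) = \<dots>" .
    show ?thesis unfolding eq sum_divide_distrib by (intro sum.cong) auto
  qed
  then have "\<forall>\<^sub>F n in sequentially. ?y n = sum f (?G n) / real (W n)"
    by (auto simp: eventually_sequentially)
  from Lim_transform_eventually[OF lim this] show ?thesis by (rule convergentI)
qed

lemma abs_density_le:
  assumes bound: "\<And>w. normal w \<Longrightarrow> \<bar>f w\<bar> \<le> C"
    and zero: "\<And>w. normal w \<Longrightarrow> locked_within L w \<Longrightarrow> f w = 0"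
    and rare: "real (card {w \<in> Words n. \<not> locked_within L w}) \<le> e * real (W n)"
  shows "\<bar>density f n\<bar> \<le> C * e"
proof -
  have C: "C \<ge> 0" using bound[of "[]"] by simp
  have "(\<Sum>w\<in>Words n. f w) = (\<Sum>w \<in> {w \<in> Words n. \<not> locked_within L w}. f w)"
    using zero by (intro sum.mono_neutral_right finite_Words) (auto simp: Words_def)
  then have "\<bar>\<Sum>w\<in>Words n. f w\<bar> \<le> (\<Sum>w \<in> {w \<in> Words n. \<not> locked_within L w}. \<bar>f w\<bar>)"
    by (simp add: sum_abs)
  also have "\<dots> \<le> real (card {w \<in> Words n. \<not> locked_within L w}) * C"
    using bound by (intro sum_bounded_above) (auto simp: Words_def)
  also have "\<dots> \<le> e * real (W n) * C" using rare C by (intro mult_right_mono) auto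
  finally show ?thesis using W_pos[of n] by (simp add: density_def field_simps)
qed

text \<open>
  Words without \<open>B\<close> near both ends change the average by an arbitrarily small amount,
  uniformly in \<open>n\<close>, so the average is a uniform limit of convergent sequences.
\<close>

theorem density_convergent:
  assumes loc: "head_tail_local f" and bound: "\<And>w. normal w \<Longrightarrow> \<bar>f w\<bar> \<le> C"
  shows "convergent (density f)"
proof -
  have "Cauchy (density f)"
  proof (rule metric_CauchyI)
    fix e :: real assume e: "e > 0"
    have C: "C \<ge> 0" using bound[of "[]"] by simp
    define d where "d = e / 4 / (C + 1)"
    have "C + 1 \<noteq> 0" using C by linarith
    then have "(C + 1) * (x / (C + 1)) = x" for x by simp
    then have "(C + 1) * d = e / 4" unfolding d_def .
    moreover have "(C + 1) * d = C * d + d" by (simp add: distrib_right)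
    moreover have "d > 0" using e C by (simp add: d_def)
    ultimately have "d > 0" "C * d + d = e / 4" by simp_all
    then have d: "d > 0" "C * d < e / 3" using e by linarith+
    from not_locked_within_rare[OF d(1)] obtain L where
      L: "\<And>n. 2 * L \<le> n \<Longrightarrow> real (card {w \<in> Words n. \<not> locked_within L w}) \<le> d * real (W n)"
      by blast
    define y where "y n = (\<Sum>w \<in> {w \<in> Words n. locked_within L w}. f w) / real (W n)" for n
    have close: "\<bar>density f n - y n\<bar> < e / 3" if "2 * L \<le> n" for n
    proof -
      have "y n = density (\<lambda>w. if locked_within L w then f w else 0) n"
        unfolding y_def density_def
        by (simp add: sum.inter_filter[symmetric] finite_Words)
      then have "density f n - y n = density (\<lambda>w. if locked_within L w then 0 else f w) n"
        by (simp add: density_def diff_divide_distrib[symmetric] sum_subtractf[symmetric] if_distrib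
            cong: if_cong)
      also have "\<bar>\<dots>\<bar> \<le> C * d"
        using bound C by (intro abs_density_le[OF _ _ L[OF that]]) auto
      finally show ?thesis using d by simp
    qed
    have "Cauchy y"
      unfolding y_def using locked_within_density_convergent[OF loc, of L] convergent_Cauchy by blast
    then obtain N where N: "\<And>m n. m \<ge> N \<Longrightarrow> n \<ge> N \<Longrightarrow> \<bar>y m - y n\<bar> < e / 3"
      using e unfolding Cauchy_def dist_real_def by (metis zero_less_divide_iff zero_less_numeral)
    have "\<bar>density f m - density f n\<bar> < e" if "m \<ge> max N (2 * L)" "n \<ge> max N (2 * L)" for m n
    proof -
      have "\<bar>y m - y n\<bar> < e / 3" "\<bar>density f m - y m\<bar> < e / 3" "\<bar>density f n - y n\<bar> < e / 3"
        using N[of m n] close[of m] close[of n] that by simp_all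
      then show ?thesis by linarith
    qed
    then show "\<exists>M. \<forall>m\<ge>M. \<forall>n\<ge>M. dist (density f m) (density f n) < e"
      unfolding dist_real_def by blast
  qed
  then show ?thesis using Cauchy_convergent by blast
qed

theorem density_limit_eq:
  assumes lim: "density f \<longlonglongrightarrow> x"
    and bound: "\<And>w. normal w \<Longrightarrow> \<bar>f w\<bar> \<le> C" "\<And>w. normal w \<Longrightarrow> \<bar>f' w\<bar> \<le> C"
    and eq: "\<And>w. normal w \<Longrightarrow> locked w \<Longrightarrow> f w = f' w"
  shows "density f' \<longlonglongrightarrow> x"
proof -
  have "(\<lambda>n. density f' n - density f n) \<longlonglongrightarrow> 0"
  proof (rule LIMSEQ_I)
    fix e :: real assume e: "e > 0"
    have C: "C \<ge> 0" using bound(1)[of "[]"] by simp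
    define d where "d = e / 4 / (C + 1)"
    have "C + 1 \<noteq> 0" using C by linarith
    then have "(C + 1) * (x / (C + 1)) = x" for x by simp
    then have "(C + 1) * d = e / 4" unfolding d_def .
    moreover have "(C + 1) * d = C * d + d" by (simp add: distrib_right)
    moreover have "d > 0" using e C by (simp add: d_def)
    ultimately have "d > 0" "C * d + d = e / 4" by simp_all
    then have d: "d > 0" "2 * C * d < e" using e by linarith+
    from not_locked_within_rare[OF d(1)] obtain L where
      L: "\<And>n. 2 * L \<le> n \<Longrightarrow> real (card {w \<in> Words n. \<not> locked_within L w}) \<le> d * real (W n)"
      by blast
    have "norm (density f' n - density f n - 0) < e" if "2 * L \<le> n" for n
    proof -
      have "density f' n - density f n = density (\<lambda>w. f' w - f w) n"
        by (simp add: density_def sum_subtractf diff_divide_distrib)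
      also have "\<bar>\<dots>\<bar> \<le> 2 * C * d"
      proof (intro abs_density_le[OF _ _ L[OF that]])
        fix w assume "normal w"
        then show "\<bar>f' w - f w\<bar> \<le> 2 * C" using bound(1)[of w] bound(2)[of w] by linarith
      next
        fix w assume "normal w" "locked_within L w"
        then show "f' w - f w = 0" using eq locked_within_imp_locked by force
      qed
      finally show ?thesis using d by simp
    qed
    then show "\<exists>no. \<forall>n\<ge>no. norm (density f' n - density f n - 0) < e" by blast
  qed
  from tendsto_add[OF lim this] show ?thesis by simp
qed

text \<open>
  The words of the form \<open>B @ m @ B\<close> alone already contribute a positive amount.
\<close>

theorem density_limit_pos:
  assumes lim: "density f \<longlonglongrightarrow> x" and loc: "head_tail_local f"
    and pos: "\<And>w. normal w \<Longrightarrow> 0 < f w"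
  shows "x > 0"
proof -
  let ?s = "2 * length B"
  have BB: "normal (B @ m @ B)" if "normal m" for m
    using normal_insert_B[of "B @ m" "[]"] normal_insert_B[of "[]" m] that by simp
  have "f (B @ B) * (real (W (n - ?s)) / real (W n)) \<le> density f n" if n: "?s \<le> n" for n
  proof -
    let ?I = "(\<lambda>m. B @ m @ B) ` Words (n - ?s)"
    have sub: "?I \<subseteq> Words n" using n BB by (auto simp: Words_def)
    have "f (B @ B) * real (W (n - ?s)) = (\<Sum>m\<in>Words (n - ?s). f (B @ B))" by (simp add: W_def)
    also have "\<dots> = (\<Sum>m\<in>Words (n - ?s). f (B @ m @ B))"
      using loc BB by (intro sum.cong) (auto simp: head_tail_local_def Words_def)
    also have "\<dots> = sum f ?I" by (subst sum.reindex) (auto simp: inj_on_def)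
    also have "\<dots> \<le> sum f (Words n)"
      using sub pos by (intro sum_mono2 finite_Words) (auto simp: Words_def less_imp_le)
    finally show ?thesis by (simp add: density_def divide_right_mono)
  qed
  then have "f (B @ B) * (1 / growth ^ ?s) \<le> x"
    by (intro LIMSEQ_le[OF tendsto_mult[OF tendsto_const W_shift] lim]) blast
  moreover have "0 < f (B @ B) * (1 / growth ^ ?s)"
    using pos BB[of "[]"] growth_bounds by simp
  ultimately show ?thesis by linarith
qed

end

section \<open>Relabellings of a cross-shaped alphabet\<close>

lemma strict_mono_on_atMost_id:
  fixes h :: "nat \<Rightarrow> nat"
  assumes mono: "\<And>j j'. j < j' \<Longrightarrow> j' \<le> r \<Longrightarrow> h j < h j'" and le: "\<And>j. j \<le> r \<Longrightarrow> h j \<le> r"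
    and j: "j \<le> r"
  shows "h j = j"
proof (rule antisym)
  show "j \<le> h j" using j
  proof (induction j)
    case (Suc j)
    then show ?case using mono[of j "Suc j"] by simp
  qed simp
  have "h (r - d) \<le> r - d" if "d \<le> r" for d using that
  proof (induction d)
    case 0
    then show ?case using le by simp
  next
    case (Suc d)
    then have "h (r - Suc d) < h (r - d)" by (intro mono) auto
    then show ?case using Suc by simp
  qed
  from this[of "r - j"] show "h j \<le> j" using j by simp
qed

lemma sorted_wrt_concatD:
  assumes "sorted_wrt P (concat zs)" "i < j" "j < length zs" "x \<in> set (zs ! i)" "y \<in> set (zs ! j)"
  shows "P x y"
proof -
  have "zs = take j zs @ zs ! j # drop (Suc j) zs" using assms(3) by (rule id_take_nth_drop)
  then have "concat zs = concat (take j zs) @ zs ! j @ concat (drop (Suc j) zs)"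
    by (metis concat.simps(2) concat_append)
  moreover have "zs ! i \<in> set (take j zs)" using assms(2,3) by (auto simp: in_set_conv_nth)
  then have "x \<in> set (concat (take j zs))" using assms(4) by auto
  ultimately show ?thesis using assms(1,5) by (auto simp: sorted_wrt_append)
qed

lemma map_fst_concat_replicate:
  assumes "map fst z = concat (replicate K l)"
  obtains zs where "length zs = K" "z = concat zs" "\<And>b. b \<in> set zs \<Longrightarrow> map fst b = l"
  using assms
proof (induction K arbitrary: z thesis)
  case 0
  then show ?case by (metis concat.simps(1) empty_iff length_0_conv list.set(1) list.map_disc_iff replicate_0)
next
  case (Suc K)
  then obtain b z' where z: "z = b @ z'" "map fst b = l" "map fst z' = concat (replicate K l)"
    by (auto simp: map_eq_append_conv)
  obtain zs where "length zs = K" "z' = concat zs" "\<And>b. b \<in> set zs \<Longrightarrow> map fst b = l"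
    using Suc.IH z(3) by blast
  then show ?case using z by (intro Suc.prems(1)[of "b # zs"]) auto
qed

lemma map_eq_append3:
  assumes "map f z = x @ y @ w"
  obtains z1 z2 z3 where "z = z1 @ z2 @ z3" "map f z1 = x" "map f z2 = y" "map f z3 = w"
  using assms by (metis map_eq_append_conv)

text \<open>
  The nonblank cells form a cross with centre \<open>(j0, i0)\<close>; cells are pairs (row, column).
  The positions of a word over these cells are the points of a permutation. Points in different
  columns are ordered horizontally by column. The sign \<open>sx i\<close> tells whether the points of column
  \<open>i\<close> are ordered from left to right as in the word or in the opposite way; likewise \<open>sy j\<close>
  for row \<open>j\<close> and the vertical order. The points of a cell are increasing exactly if
  the signs of its row and of its column agree.
\<close>

locale cross =
  fixes r c j0 i0 :: nat and sx sy :: "nat \<Rightarrow> bool"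
  assumes r_pos: "1 \<le> r" and c_pos: "1 \<le> c" and j0_le: "j0 \<le> r" and i0_le: "i0 \<le> c"
begin

definition Z :: "(nat \<times> nat) set" where
  "Z = {(j, i). j \<le> r \<and> i \<le> c \<and> (j = j0 \<or> i = i0)}"

definition row_cells :: "(nat \<times> nat) set" where
  "row_cells = (\<lambda>i. (j0, i)) ` ({..c} - {i0})"

definition col_cells :: "(nat \<times> nat) set" where
  "col_cells = (\<lambda>j. (j, i0)) ` ({..r} - {j0})"

lemma card_row_cells: "card row_cells = c"
  unfolding row_cells_def using i0_le by (subst card_image) (auto simp: inj_on_def)

lemma card_col_cells: "card col_cells = r"
  unfolding col_cells_def using j0_le by (subst card_image) (auto simp: inj_on_def)

sublocale commuting_words row_cells col_cells "(j0, i0)"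
proof
  show "finite row_cells" "finite col_cells" by (auto simp: row_cells_def col_cells_def)
  show "row_cells \<noteq> {}" using card_row_cells c_pos by force
  show "col_cells \<noteq> {}" using card_col_cells r_pos by force
qed (auto simp: row_cells_def col_cells_def)

lemma letters_eq: "letters = Z"
  using i0_le j0_le unfolding letters_def by (auto simp: row_cells_def col_cells_def Z_def)

lemma finite_Z: "finite Z"
  using finite_letters letters_eq by simp

text \<open>
  The condition for the point of a letter \<open>a\<close> to lie to the left of the point of a \<^emph>\<open>later\<close>
  letter \<open>b\<close>; the vertical analogue is \<open>y_less\<close>.
\<close>

definition x_less :: "nat \<times> nat \<Rightarrow> nat \<times> nat \<Rightarrow> bool" where
  "x_less a b \<longleftrightarrow> snd a < snd b \<or> (snd a = snd b \<and> sx (snd a))"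

definition y_less :: "nat \<times> nat \<Rightarrow> nat \<times> nat \<Rightarrow> bool" where
  "y_less a b \<longleftrightarrow> fst a < fst b \<or> (fst a = fst b \<and> sy (fst a))"

definition rising :: "nat \<times> nat \<Rightarrow> bool" where
  "rising a \<longleftrightarrow> sx (snd a) = sy (fst a)"

text \<open>
  An earlier point moved from cell \<open>a\<close> to cell \<open>a'\<close> and a later point moved from
  \<open>b\<close> to \<open>b'\<close> do not contradict each other: the new columns and rows are weakly monotone in the horizontal
  and the vertical order, and two points in the same new cell are in the relative position that
  this cell demands. Pairwise compatibility is all that a gridding has to satisfy.
\<close>

fun compat :: "(nat \<times> nat) \<times> (nat \<times> nat) \<Rightarrow> (nat \<times> nat) \<times> (nat \<times> nat) \<Rightarrow> bool" where
  "compat (a, a') (b, b') \<longleftrightarrow>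
     (if x_less a b then snd a' \<le> snd b' else snd b' \<le> snd a') \<and>
     (if y_less a b then fst a' \<le> fst b' else fst b' \<le> fst a') \<and>
     (a' = b' \<longrightarrow> (x_less a b = y_less a b) = rising a')"

declare compat.simps [simp del]

text \<open>
  Relabellings carry the original word along as first components, so that the conditions
  of pairs of positions become \<open>sorted_wrt compat\<close>.
\<close>

definition relabelings :: "(nat \<times> nat) list \<Rightarrow> ((nat \<times> nat) \<times> (nat \<times> nat)) list set" where
  "relabelings w = {z. map fst z = w \<and> snd ` set z \<subseteq> Z \<and> sorted_wrt compat z}"

lemma finite_relabelings: "finite (relabelings w)"
proof (rule finite_subset)
  show "relabelings w \<subseteq> {z. set z \<subseteq> set w \<times> Z \<and> length z = length w}"
    by (auto simp: relabelings_def) (metis fst_conv image_eqI)+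
  show "finite {z. set z \<subseteq> set w \<times> Z \<and> length z = length w}"
    using finite_Z by (intro finite_lists_length_eq) auto
qed

lemma compat_same: "compat (a, a) (b, b)"
  by (auto simp: compat.simps x_less_def y_less_def rising_def)

lemma identity_relabeling: "set w \<subseteq> Z \<Longrightarrow> map (\<lambda>a. (a, a)) w \<in> relabelings w"
  by (auto simp: relabelings_def sorted_wrt_map compat_same o_def
      intro: sorted_wrt_mono_rel[of _ "\<lambda>_ _. True"])

lemma relabelings_appendD:
  assumes "z1 @ z2 \<in> relabelings w"
  shows "z1 \<in> relabelings (map fst z1)" "z2 \<in> relabelings (map fst z2)"
  using assms by (auto simp: relabelings_def sorted_wrt_append)

text \<open>
  Suppose that every cell \<open>a\<close> occurs at least twice, in every relative order with the other cells,
  and always receives the label \<open>f a\<close>. Then \<open>f\<close> maps columns to columns and rows to rows,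
  and it is injective on the main column, because the points of two of its cells interleave
  horizontally and their union is not monotone. An image of the main column with two different
  cells can only be the main column, and a monotone injection of a finite interval into itself
  is the identity. The same holds for the main row.
\<close>

lemma rigid:
  assumes f: "\<And>a. a \<in> Z \<Longrightarrow> f a \<in> Z"
    and compat: "\<And>a b. a \<in> Z \<Longrightarrow> b \<in> Z \<Longrightarrow> compat (a, f a) (b, f b)"
    and a: "a \<in> Z"
  shows "f a = a"
proof -
  have same_col: "snd (f a) = snd (f b)" if "a \<in> Z" "b \<in> Z" "snd a = snd b" for a b
    using compat[OF that(1,2)] compat[OF that(2,1)] that(3)
    by (cases "f a"; cases "f b") (auto simp: compat.simps x_less_def split: if_splits)
  have same_row: "fst (f a) = fst (f b)" if "a \<in> Z" "b \<in> Z" "fst a = fst b" for a b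
    using compat[OF that(1,2)] compat[OF that(2,1)] that(3)
    by (cases "f a"; cases "f b") (auto simp: compat.simps y_less_def split: if_splits)
  have inj_col: "f a \<noteq> f b" if "a \<in> Z" "b \<in> Z" "snd a = snd b" "fst a < fst b" for a b
    using compat[OF that(1,2)] compat[OF that(2,1)] that(3,4)
    by (cases "f a"; cases "f b") (auto simp: compat.simps x_less_def y_less_def)
  have inj_row: "f a \<noteq> f b" if "a \<in> Z" "b \<in> Z" "fst a = fst b" "snd a < snd b" for a b
    using compat[OF that(1,2)] compat[OF that(2,1)] that(3,4)
    by (cases "f a"; cases "f b") (auto simp: compat.simps x_less_def y_less_def)
  have in_Z: "(j, i0) \<in> Z" "(j0, i) \<in> Z" if "j \<le> r" "i \<le> c" for j i
    using that i0_le j0_le by (auto simp: Z_def)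
  have k: "(j0, i0) \<in> Z" using in_Z i0_le j0_le by blast
  have col_k: "snd (f (j0, i0)) = i0"
  proof (rule ccontr)
    assume ne: "snd (f (j0, i0)) \<noteq> i0"
    obtain j where j: "j \<le> r" "j \<noteq> j0" using r_pos by (metis le0 not_one_le_zero)
    have "(j, i0) \<in> Z" using j in_Z i0_le by blast
    moreover from this have "snd (f (j, i0)) = snd (f (j0, i0))" by (intro same_col k) auto
    ultimately have "f (j, i0) = f (j0, i0)"
      using ne f[of "(j, i0)"] f[OF k] by (auto simp: Z_def prod_eq_iff)
    moreover from j have "j < j0 \<or> j0 < j" by auto
    ultimately show False
      using inj_col[of "(j, i0)" "(j0, i0)"] inj_col[of "(j0, i0)" "(j, i0)"] \<open>(j, i0) \<in> Z\<close> k by auto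
  qed
  have row_k: "fst (f (j0, i0)) = j0"
  proof (rule ccontr)
    assume ne: "fst (f (j0, i0)) \<noteq> j0"
    obtain i where i: "i \<le> c" "i \<noteq> i0" using c_pos by (metis le0 not_one_le_zero)
    have "(j0, i) \<in> Z" using i in_Z j0_le by blast
    moreover from this have "fst (f (j0, i)) = fst (f (j0, i0))" by (intro same_row k) auto
    ultimately have "f (j0, i) = f (j0, i0)"
      using ne f[of "(j0, i)"] f[OF k] by (auto simp: Z_def prod_eq_iff)
    moreover from i have "i < i0 \<or> i0 < i" by auto
    ultimately show False
      using inj_row[of "(j0, i)" "(j0, i0)"] inj_row[of "(j0, i0)" "(j0, i)"] \<open>(j0, i) \<in> Z\<close> k by auto
  qed
  have main_col: "f (j, i0) = (j, i0)" if j: "j \<le> r" for j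
  proof -
    have col: "snd (f (j', i0)) = i0" if "j' \<le> r" for j'
      using same_col[of "(j', i0)" "(j0, i0)"] k in_Z[OF that] col_k i0_le by auto
    have "fst (f (j, i0)) = j"
    proof (rule strict_mono_on_atMost_id[of r "\<lambda>j. fst (f (j, i0))"])
      fix j1 j2 assume lt: "j1 < j2" "j2 \<le> r"
      have *: "(j1, i0) \<in> Z" "(j2, i0) \<in> Z" using lt in_Z i0_le by auto
      have "fst (f (j1, i0)) \<le> fst (f (j2, i0))"
        using compat[OF *] lt by (cases "f (j1, i0)"; cases "f (j2, i0)") (auto simp: compat.simps y_less_def)
      moreover have "f (j1, i0) \<noteq> f (j2, i0)" using inj_col[OF *] lt by simp
      ultimately show "fst (f (j1, i0)) < fst (f (j2, i0))"
        using col[of j1] col[of j2] lt by (auto simp: prod_eq_iff)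
    next
      fix j' assume "j' \<le> r"
      then show "fst (f (j', i0)) \<le> r" using f[of "(j', i0)"] in_Z i0_le by (auto simp: Z_def)
    qed (rule j)
    then show ?thesis using col[OF j] by (simp add: prod_eq_iff)
  qed
  have main_row: "f (j0, i) = (j0, i)" if i: "i \<le> c" for i
  proof -
    have row: "fst (f (j0, i')) = j0" if "i' \<le> c" for i'
      using same_row[of "(j0, i')" "(j0, i0)"] k in_Z[OF _ that] row_k j0_le by auto
    have "snd (f (j0, i)) = i"
    proof (rule strict_mono_on_atMost_id[of c "\<lambda>i. snd (f (j0, i))"])
      fix i1 i2 assume lt: "i1 < i2" "i2 \<le> c"
      have *: "(j0, i1) \<in> Z" "(j0, i2) \<in> Z" using lt in_Z j0_le by auto
      have "snd (f (j0, i1)) \<le> snd (f (j0, i2))"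
        using compat[OF *] lt by (cases "f (j0, i1)"; cases "f (j0, i2)") (auto simp: compat.simps x_less_def)
      moreover have "f (j0, i1) \<noteq> f (j0, i2)" using inj_row[OF *] lt by simp
      ultimately show "snd (f (j0, i1)) < snd (f (j0, i2))"
        using row[of i1] row[of i2] lt by (auto simp: prod_eq_iff)
    next
      fix i' assume "i' \<le> c"
      then show "snd (f (j0, i')) \<le> c" using f[of "(j0, i')"] in_Z j0_le by (auto simp: Z_def)
    qed (rule i)
    then show ?thesis using row[OF i] by (simp add: prod_eq_iff)
  qed
  from a show ?thesis using main_col main_row by (cases a) (auto simp: Z_def)
qed

text \<open>
  The row letters come before the column letters to make the repetitions of this list normal.
\<close>

definition alphabet :: "(nat \<times> nat) list" where
  "alphabet = (j0, i0) # map (\<lambda>i. (j0, i)) (filter (\<lambda>i. i \<noteq> i0) [0..<Suc c])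
     @ map (\<lambda>j. (j, i0)) (filter (\<lambda>j. j \<noteq> j0) [0..<Suc r])"

lemma set_alphabet: "set alphabet = Z"
  using i0_le j0_le by (auto simp: alphabet_def Z_def)

lemma distinct_alphabet: "distinct alphabet"
  by (auto simp: alphabet_def distinct_map inj_on_def)

text \<open>
  There are \<open>card Z ^ card Z\<close> ways to label one copy of the alphabet, so one copy more
  forces a coincidence. The additional corner letter makes the word end with the letter that
  commutes with no other.
\<close>

definition lock :: "(nat \<times> nat) list" where
  "lock = concat (replicate (Suc (card Z ^ card Z)) alphabet) @ [(j0, i0)]"

lemma normal_alphabet: "normal alphabet"
proof -
  have "sorted_wrt (\<lambda>a b. \<not> (a \<in> col_cells \<and> b \<in> row_cells)) alphabet"
    unfolding alphabet_def
    by (auto simp: sorted_wrt_append sorted_wrt_map row_cells_def col_cells_def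
        intro: sorted_wrt_mono_rel[of _ "\<lambda>_ _. True"])
  then show ?thesis
    unfolding normal_def letters_eq using set_alphabet
    by (simp add: successively_if_sorted_wrt)
qed

lemma normal_concat_alphabet: "normal (concat (replicate K alphabet))"
proof (induction K)
  case (Suc K)
  have "hd (concat (replicate K alphabet)) = (j0, i0)" if "K > 0"
    using that by (cases K) (auto simp: alphabet_def)
  moreover have "alphabet \<noteq> []" by (simp add: alphabet_def)
  ultimately show ?case
    using Suc normal_alphabet normal_append_k[of alphabet "concat (replicate K alphabet)"]
    by (cases "K = 0") auto
qed simp

sublocale commuting_words_block row_cells col_cells "(j0, i0)" lock
proof
  have "normal [(j0, i0)]" by (simp add: normal_Cons_iff letters_def)
  then show "normal lock"
    unfolding lock_def by (intro normal_append_k normal_concat_alphabet) auto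
qed (auto simp: lock_def alphabet_def)

text \<open>
  Two equally labelled copies of the alphabet satisfy the assumptions of lemma \<open>rigid\<close>.
  The order in which \<open>l\<close> lists the alphabet is left open, because it changes when the letters of one
  cross are translated into those of another.
\<close>

lemma repetition_fixes:
  assumes l: "distinct l" "set l = Z" and z: "z \<in> relabelings w"
    and w: "sublist (concat (replicate (Suc (card Z ^ card Z)) l)) w" and a: "a \<in> Z"
  shows "(a, a) \<in> set z"
proof -
  let ?K = "Suc (card Z ^ card Z)"
  obtain x y where "w = x @ concat (replicate ?K l) @ y" using w by (auto simp: sublist_def)
  then have "map fst z = x @ concat (replicate ?K l) @ y"
    using z by (simp add: relabelings_def)
  then obtain z1 z2 z3 where split: "z = z1 @ z2 @ z3"
    and z2: "map fst z2 = concat (replicate ?K l)"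
    by (rule map_eq_append3)
  obtain zs where zs: "length zs = ?K" "z2 = concat zs" "\<And>b. b \<in> set zs \<Longrightarrow> map fst b = l"
    using map_fst_concat_replicate[OF z2] by blast
  have len: "length l = card Z"
    using distinct_card[OF l(1)] l(2) by simp
  let ?lab = "\<lambda>t. map snd (zs ! t)"
  have "?lab ` {..<?K} \<subseteq> {xs. set xs \<subseteq> Z \<and> length xs = card Z}"
  proof clarify
    fix t assume t: "t < ?K"
    then have b: "zs ! t \<in> set zs" using zs(1) by simp
    then have "set (zs ! t) \<subseteq> set z" using split zs(2) by auto
    then show "set (?lab t) \<subseteq> Z \<and> length (?lab t) = card Z"
      using z zs(3)[OF b] len by (auto simp: relabelings_def dest: arg_cong[of _ _ length])
  qed
  then have "card (?lab ` {..<?K}) \<le> card Z ^ card Z"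
    unfolding card_lists_length_eq[OF finite_Z, symmetric]
    by (rule card_mono[OF finite_lists_length_eq[OF finite_Z]])
  then have "\<not> inj_on ?lab {..<?K}"
    using card_image[of ?lab "{..<?K}"] by (intro notI) simp
  then obtain s t where st: "s < t" "t < ?K" "?lab s = ?lab t"
    unfolding inj_on_def by (metis lessThan_iff linorder_neqE_nat)
  define b where "b = zs ! s"
  have b_in: "zs ! s \<in> set zs" "zs ! t \<in> set zs" using st zs(1) by auto
  have b_t: "zs ! t = b"
    unfolding b_def using st(3) zs(3)[OF b_in(1)] zs(3)[OF b_in(2)]
    by (metis zip_map_fst_snd)
  have fst_b: "map fst b = l" using zs(3)[OF b_in(1)] by (simp add: b_def)
  have sorted: "sorted_wrt compat (concat zs)"
    using z split zs(2) by (auto simp: relabelings_def sorted_wrt_append)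
  have compat_b: "compat p q" if "p \<in> set b" "q \<in> set b" for p q
    using sorted_wrt_concatD[OF sorted st(1)] st(2) zs(1) that b_t unfolding b_def by simp
  have snd_b: "snd p \<in> Z" if "p \<in> set b" for p
  proof -
    have "p \<in> set z" using that b_in(1) split zs(2) unfolding b_def by auto
    then show ?thesis using z by (auto simp: relabelings_def)
  qed
  \<comment> \<open>The common labelling of the two copies, as a function on the alphabet.\<close>
  define f where "f a = the (map_of b a)" for a
  have f: "(a, f a) \<in> set b" if "a \<in> Z" for a
  proof -
    have "a \<in> fst ` set b" using that fst_b l(2) by (metis list.set_map)
    then obtain v where "map_of b a = Some v" by (metis map_of_eq_None_iff option.exhaust)
    then show ?thesis using map_of_SomeD by (simp add: f_def)
  qed
  have "f a = a"
  proof (rule rigid)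
    fix x assume "x \<in> Z"
    then show "f x \<in> Z" using snd_b[OF f] by simp
  next
    fix x y assume "x \<in> Z" "y \<in> Z"
    then show "compat (x, f x) (y, f y)" by (intro compat_b f)
  qed (rule a)
  then have "(a, a) \<in> set b" using f[OF a] by simp
  then show ?thesis using b_in(1) split zs(2) unfolding b_def by auto
qed

lemma lock_fixes:
  assumes "z \<in> relabelings w" "sublist lock w" "a \<in> Z"
  shows "(a, a) \<in> set z"
proof -
  have "sublist (concat (replicate (Suc (card Z ^ card Z)) alphabet)) lock"
    unfolding lock_def by (rule sublist_append_rightI)
  then show ?thesis
    using assms sublist_order.order_trans
    by (intro repetition_fixes[OF distinct_alphabet set_alphabet assms(1) _ assms(3)]) blast
qed

lemma fixed_between:
  assumes "compat (a, a) (a, a')" "compat (a, a') (a, a)"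
  shows "a' = a"
  using assms by (cases a'; cases a) (auto simp: compat.simps x_less_def y_less_def split: if_splits)

text \<open>
  A point between two points of its own cell that keep their labels keeps its label as well.
  Conversely, compatibility of an unmoved point in the middle with any other point follows from the
  compatibility of the unmoved points of the same cell in \<open>u\<close> and in \<open>v\<close>.
\<close>

lemma card_relabelings_middle:
  assumes n: "normal (u @ m @ v)" and u: "sublist lock u" and v: "sublist lock v"
  shows "card (relabelings (u @ m @ v)) = card (relabelings (u @ v))"
proof -
  let ?id = "map (\<lambda>a. (a, a)) m"
  let ?ins = "\<lambda>z. take (length u) z @ ?id @ drop (length u) z"
  have m: "set m \<subseteq> Z" using n by (auto simp: normal_append_iff normal_def letters_eq)
  have inj: "inj_on ?ins (relabelings (u @ v))"
  proof (rule inj_onI)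
    fix z z' assume "z \<in> relabelings (u @ v)" "z' \<in> relabelings (u @ v)" and eq: "?ins z = ?ins z'"
    then have "length z = length u + length v" "length z' = length u + length v"
      by (auto simp: relabelings_def dest: arg_cong[of _ _ length])
    then have "take (length u) z = take (length u) z'" "drop (length u) z = drop (length u) z'"
      using eq by (auto simp: append_eq_append_conv)
    then show "z = z'" by (metis append_take_drop_id)
  qed
  have image: "?ins ` relabelings (u @ v) = relabelings (u @ m @ v)"
  proof (intro equalityI subsetI)
    fix z assume "z \<in> ?ins ` relabelings (u @ v)"
    then obtain y where y: "y \<in> relabelings (u @ v)" and zy: "z = ?ins y" by auto
    define y1 y2 where "y1 = take (length u) y" and "y2 = drop (length u) y"
    have y12: "y = y1 @ y2" by (simp add: y1_def y2_def)
    have fy: "map fst y1 = u" "map fst y2 = v"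
      using y by (auto simp: relabelings_def y1_def y2_def take_map[symmetric] drop_map[symmetric])
    have rel: "y1 \<in> relabelings u" "y2 \<in> relabelings v"
      using relabelings_appendD[of y1 y2] y y12 fy by auto
    have a1: "(a, a) \<in> set y1" and a2: "(a, a) \<in> set y2" if "a \<in> Z" for a
      using lock_fixes rel u v that by auto
    have s: "sorted_wrt compat y1" "sorted_wrt compat y2" "\<And>p q. p \<in> set y1 \<Longrightarrow> q \<in> set y2 \<Longrightarrow> compat p q"
      "snd ` set y1 \<subseteq> Z" "snd ` set y2 \<subseteq> Z"
      using y y12 by (auto simp: relabelings_def sorted_wrt_append)
    have "sorted_wrt compat (y1 @ ?id @ y2)"
      unfolding sorted_wrt_append
      using s a1 a2 m identity_relabeling[OF m] by (auto simp: relabelings_def)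
    then show "z \<in> relabelings (u @ m @ v)"
      unfolding relabelings_def using zy fy s(4,5) m
      by (auto simp: y1_def[symmetric] y2_def[symmetric] o_def)
  next
    fix z assume z: "z \<in> relabelings (u @ m @ v)"
    then obtain z1 z2 z3 where split: "z = z1 @ z2 @ z3" and
      f: "map fst z1 = u" "map fst z2 = m" "map fst z3 = v"
      unfolding relabelings_def by (auto elim: map_eq_append3)
    have rel: "z1 \<in> relabelings u" "z3 \<in> relabelings v"
      using relabelings_appendD[of z1 "z2 @ z3" "u @ m @ v"]
        relabelings_appendD[of "z1 @ z2" z3 "u @ m @ v"] z split f by auto
    have sorted: "sorted_wrt compat z" using z by (simp add: relabelings_def)
    have "fst p = snd p" if p: "p \<in> set z2" for p
    proof -
      obtain a a' where aa: "p = (a, a')" by (cases p)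
      have "a \<in> Z" using p f(2) m aa by (metis fst_conv image_eqI list.set_map subsetD)
      then have "(a, a) \<in> set z1" "(a, a) \<in> set z3" using lock_fixes rel u v by auto
      then have "compat (a, a) (a, a')" "compat (a, a') (a, a)"
        using sorted p unfolding split aa by (auto simp: sorted_wrt_append)
      then have "a' = a" by (rule fixed_between)
      then show ?thesis using aa by simp
    qed
    then have "z2 = map (\<lambda>p. (fst p, fst p)) z2"
      by (intro nth_equalityI) (auto simp: prod_eq_iff)
    then have z2: "z2 = ?id" using f(2) by (metis (no_types, lifting) comp_apply list.map_comp map_cong)
    have "z1 @ z3 \<in> relabelings (u @ v)"
      using z f split by (auto simp: relabelings_def sorted_wrt_append)
    moreover have "length z1 = length u" using f(1) by auto
    ultimately show "z \<in> ?ins ` relabelings (u @ v)"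
      using split z2 by (intro image_eqI[of _ _ "z1 @ z3"]) auto
  qed
  show ?thesis using card_image[OF inj] unfolding image .
qed

end

section \<open>Relabellings near the corner and across peaks\<close>

text \<open>
  An unmoved point exists in every row and column, and the order relative to these points keeps
  any other point from crossing more than one divider. The sign determines in which direction
  a divider can be crossed; it is reversed for points after the unmoved ones.
\<close>

lemma at_most_one_step:
  fixes d d' m :: nat
  assumes e: "\<And>e. e \<le> m \<Longrightarrow> if d < e \<or> d = e \<and> s then d' \<le> e else e \<le> d'"
    and le: "d \<le> m" "d' \<le> m"
  shows "if s then d' \<le> d \<and> d \<le> Suc d' else d \<le> d' \<and> d' \<le> Suc d"
proof -
  have "d' \<le> Suc d" using e[of "Suc d"] le by (cases "Suc d \<le> m") auto
  moreover have "d - 1 \<le> d'" if "0 < d"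
  proof -
    have "d - 1 \<le> m" using le by simp
    from e[OF this] that show ?thesis by (auto split: if_splits)
  qed
  then have "d \<le> Suc d'" by (cases "0 < d") auto
  ultimately show ?thesis using e[OF le(1)] by auto
qed

context cross
begin

definition near_row :: "nat \<Rightarrow> bool" where
  "near_row j \<longleftrightarrow> j \<le> Suc j0 \<and> j0 \<le> Suc j"

definition near_col :: "nat \<Rightarrow> bool" where
  "near_col i \<longleftrightarrow> i \<le> Suc i0 \<and> i0 \<le> Suc i"

definition near :: "(nat \<times> nat) set" where
  "near = {(j, i) \<in> Z. near_row j \<and> near_col i}"

definition local_relabelings :: "(nat \<times> nat) list \<Rightarrow> ((nat \<times> nat) \<times> (nat \<times> nat)) list set" where
  "local_relabelings w = {z \<in> relabelings w. \<forall>(a, a') \<in> set z. a = a' \<or> a \<in> near \<and> a' \<in> near}"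

text \<open>
  The non-corner peaks, in terms of signs.
\<close>

definition far_peaks :: "(nat \<times> nat) set set" where
  "far_peaks = {{a, b} | a b. a \<in> Z \<and> b \<in> Z \<and> adjacent_cells a b \<and> rising a \<and> \<not> rising b \<and>
     (j0, i0) \<notin> {a, b}}"

definition fixing :: "(nat \<times> nat) list \<Rightarrow> bool" where
  "fixing w \<longleftrightarrow> set w \<subseteq> Z \<and> (\<forall>z \<in> relabelings w. \<forall>a \<in> Z. (a, a) \<in> set z)"

lemma compat_cong_right:
  "x_less d a = x_less d b \<Longrightarrow> y_less d a = y_less d b \<Longrightarrow> compat (d, d') (a, x) = compat (d, d') (b, x)"
  by (simp add: compat.simps)

lemma compat_cong_left:
  "x_less a d = x_less b d \<Longrightarrow> y_less a d = y_less b d \<Longrightarrow> compat (a, x) (d, d') = compat (b, x) (d, d')"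
  by (simp add: compat.simps)

lemma fixing_if_lock: "set w \<subseteq> Z \<Longrightarrow> sublist lock w \<Longrightarrow> fixing w"
  using lock_fixes by (auto simp: fixing_def)

lemma fixing_append:
  assumes "fixing u" "fixing v" "z \<in> relabelings (u @ v)" "a \<in> Z"
  shows "q < length u \<Longrightarrow> compat (z ! q) (a, a)"
    and "length u \<le> q \<Longrightarrow> q < length (u @ v) \<Longrightarrow> compat (a, a) (z ! q)"
proof -
  obtain z1 z2 where z: "z = z1 @ z2" and f: "map fst z1 = u" "map fst z2 = v"
    using assms(3) by (auto simp: relabelings_def map_eq_append_conv)
  have len: "length z1 = length u" "length z2 = length v" using f by auto
  have rel: "z1 \<in> relabelings u" "z2 \<in> relabelings v"
    using relabelings_appendD[of z1 z2] assms(3) z f by auto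
  then have a: "(a, a) \<in> set z1" "(a, a) \<in> set z2" using assms(1,2,4) by (auto simp: fixing_def)
  have s: "\<And>p p'. p \<in> set z1 \<Longrightarrow> p' \<in> set z2 \<Longrightarrow> compat p p'"
    using assms(3) z by (auto simp: relabelings_def sorted_wrt_append)
  show "compat (z ! q) (a, a)" if "q < length u"
    using s[OF nth_mem a(2), of q] that len by (simp add: z nth_append)
  show "compat (a, a) (z ! q)" if "length u \<le> q" "q < length (u @ v)"
    using s[OF a(1) nth_mem, of "q - length u"] that len by (simp add: z nth_append)
qed

lemma row_in_Z: "i \<le> c \<Longrightarrow> (j0, i) \<in> Z" and col_in_Z: "j \<le> r \<Longrightarrow> (j, i0) \<in> Z"
  using j0_le i0_le by (auto simp: Z_def)

lemma col_step_head:
  assumes "\<And>e. e \<in> Z \<Longrightarrow> compat (d, d') (e, e)" "d \<in> Z" "d' \<in> Z"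
  shows "if sx (snd d) then snd d' \<le> snd d \<and> snd d \<le> Suc (snd d')
    else snd d \<le> snd d' \<and> snd d' \<le> Suc (snd d)"
proof (rule at_most_one_step[where m = c])
  fix e assume "e \<le> c"
  from assms(1)[OF row_in_Z[OF this]]
  show "if snd d < e \<or> snd d = e \<and> sx (snd d) then snd d' \<le> e else e \<le> snd d'"
    by (auto simp: compat.simps x_less_def split: if_splits)
qed (use assms(2,3) in \<open>auto simp: Z_def\<close>)

lemma col_step_tail:
  assumes "\<And>e. e \<in> Z \<Longrightarrow> compat (e, e) (d, d')" "d \<in> Z" "d' \<in> Z"
  shows "if sx (snd d) then snd d \<le> snd d' \<and> snd d' \<le> Suc (snd d)
    else snd d' \<le> snd d \<and> snd d \<le> Suc (snd d')"
proof -
  have "if \<not> sx (snd d) then snd d' \<le> snd d \<and> snd d \<le> Suc (snd d')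
      else snd d \<le> snd d' \<and> snd d' \<le> Suc (snd d)"
  proof (rule at_most_one_step[where m = c])
    fix e assume "e \<le> c"
    from assms(1)[OF row_in_Z[OF this]]
    show "if snd d < e \<or> snd d = e \<and> \<not> sx (snd d) then snd d' \<le> e else e \<le> snd d'"
      by (auto simp: compat.simps x_less_def split: if_splits)
  qed (use assms(2,3) in \<open>auto simp: Z_def\<close>)
  then show ?thesis by (auto split: if_splits)
qed

lemma row_step_head:
  assumes "\<And>e. e \<in> Z \<Longrightarrow> compat (d, d') (e, e)" "d \<in> Z" "d' \<in> Z"
  shows "if sy (fst d) then fst d' \<le> fst d \<and> fst d \<le> Suc (fst d')
    else fst d \<le> fst d' \<and> fst d' \<le> Suc (fst d)"
proof (rule at_most_one_step[where m = r])
  fix e assume "e \<le> r"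
  from assms(1)[OF col_in_Z[OF this]]
  show "if fst d < e \<or> fst d = e \<and> sy (fst d) then fst d' \<le> e else e \<le> fst d'"
    by (auto simp: compat.simps y_less_def split: if_splits)
qed (use assms(2,3) in \<open>auto simp: Z_def\<close>)

lemma row_step_tail:
  assumes "\<And>e. e \<in> Z \<Longrightarrow> compat (e, e) (d, d')" "d \<in> Z" "d' \<in> Z"
  shows "if sy (fst d) then fst d \<le> fst d' \<and> fst d' \<le> Suc (fst d)
    else fst d' \<le> fst d \<and> fst d \<le> Suc (fst d')"
proof -
  have "if \<not> sy (fst d) then fst d' \<le> fst d \<and> fst d \<le> Suc (fst d')
      else fst d \<le> fst d' \<and> fst d' \<le> Suc (fst d)"
  proof (rule at_most_one_step[where m = r])
    fix e assume "e \<le> r"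
    from assms(1)[OF col_in_Z[OF this]]
    show "if fst d < e \<or> fst d = e \<and> \<not> sy (fst d) then fst d' \<le> e else e \<le> fst d'"
      by (auto simp: compat.simps y_less_def split: if_splits)
  qed (use assms(2,3) in \<open>auto simp: Z_def\<close>)
  then show ?thesis by (auto split: if_splits)
qed

text \<open>
  A point moves by at most one row and one column. Outside the neighbourhood of the corner it
  stays in its arm of the cross, and compatibility with an unmoved point of
  its new cell forces the two cells to have opposite orientations.
\<close>

lemma change_near_or_far_peak:
  assumes fx: "fixing u" "fixing v" and z: "z \<in> relabelings (u @ v)"
    and bb: "(b, b') \<in> set z" "b \<noteq> b'"
  shows "b \<in> near \<and> b' \<in> near \<or> {b, b'} \<in> far_peaks"
proof -
  obtain q where q: "q < length (u @ v)" "z ! q = (b, b')"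
    using bb z by (auto simp: relabelings_def in_set_conv_nth dest: arg_cong[of _ _ length])
  have bZ: "b \<in> Z" "b' \<in> Z"
  proof -
    have "map fst z = u @ v" "snd ` set z \<subseteq> Z" using z by (auto simp: relabelings_def)
    moreover from this have "b \<in> set (u @ v)" using bb by (metis fst_conv image_eqI list.set_map)
    ultimately show "b \<in> Z" "b' \<in> Z" using bb fx by (auto simp: fixing_def)
  qed
  have "(snd b \<le> Suc (snd b') \<and> snd b' \<le> Suc (snd b) \<and> fst b \<le> Suc (fst b') \<and> fst b' \<le> Suc (fst b)) \<and>
      (fst b = fst b' \<longrightarrow> sx (snd b) \<noteq> sx (snd b')) \<and> (snd b = snd b' \<longrightarrow> sy (fst b) \<noteq> sy (fst b'))"
  proof (cases "q < length u")
    case True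
    then have h: "\<And>e. e \<in> Z \<Longrightarrow> compat (b, b') (e, e)" using fixing_append(1)[OF fx z] q(2) by metis
    note s = col_step_head[OF h bZ] row_step_head[OF h bZ]
    have turn: "(x_less b b' = y_less b b') = rising b'" using h[OF bZ(2)] by (simp add: compat.simps)
    have "sx (snd b) \<noteq> sx (snd b')" if "fst b = fst b'"
    proof -
      have "snd b \<noteq> snd b'" using that bb(2) by (simp add: prod_eq_iff)
      then show ?thesis using turn s(1) that
        by (cases "sx (snd b)") (auto simp: x_less_def y_less_def rising_def)
    qed
    moreover have "sy (fst b) \<noteq> sy (fst b')" if "snd b = snd b'"
    proof -
      have "fst b \<noteq> fst b'" using that bb(2) by (simp add: prod_eq_iff)
      then show ?thesis using turn s(2) that
        by (cases "sy (fst b)") (auto simp: x_less_def y_less_def rising_def)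
    qed
    ultimately show ?thesis using s by (simp split: if_splits)
  next
    case False
    then have h: "\<And>e. e \<in> Z \<Longrightarrow> compat (e, e) (b, b')"
      using fixing_append(2)[OF fx z] q by (metis not_less)
    note s = col_step_tail[OF h bZ] row_step_tail[OF h bZ]
    have turn: "(x_less b' b = y_less b' b) = rising b'" using h[OF bZ(2)] by (simp add: compat.simps)
    have "sx (snd b) \<noteq> sx (snd b')" if "fst b = fst b'"
    proof -
      have "snd b \<noteq> snd b'" using that bb(2) by (simp add: prod_eq_iff)
      then show ?thesis using turn s(1) that
        by (cases "sx (snd b)") (auto simp: x_less_def y_less_def rising_def)
    qed
    moreover have "sy (fst b) \<noteq> sy (fst b')" if "snd b = snd b'"
    proof -
      have "fst b \<noteq> fst b'" using that bb(2) by (simp add: prod_eq_iff)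
      then show ?thesis using turn s(2) that
        by (cases "sy (fst b)") (auto simp: x_less_def y_less_def rising_def)
    qed
    ultimately show ?thesis using s by (simp split: if_splits)
  qed
  then have step: "snd b \<le> Suc (snd b')" "snd b' \<le> Suc (snd b)" "fst b \<le> Suc (fst b')" "fst b' \<le> Suc (fst b)"
    and differ: "fst b = fst b' \<Longrightarrow> sx (snd b) \<noteq> sx (snd b')" "snd b = snd b' \<Longrightarrow> sy (fst b) \<noteq> sy (fst b')"
    by auto
  have mem: "{b, b'} \<in> far_peaks"
    if "adjacent_cells b b'" "adjacent_cells b' b" "rising b \<noteq> rising b'" "b \<noteq> (j0, i0)" "b' \<noteq> (j0, i0)"
  proof (cases "rising b")
    case True
    then show ?thesis unfolding far_peaks_def using bZ that by blast
  next
    case False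
    have "{b, b'} = {b', b}" by auto
    then show ?thesis unfolding far_peaks_def using bZ that False by blast
  qed
  obtain j i j' i' where b: "b = (j, i)" "b' = (j', i')" by (cases b, cases b')
  show ?thesis
  proof (cases "b \<in> near \<and> b' \<in> near")
    case False
    then consider (row) "j' = j" "j = j0" "i \<noteq> i0" "i' \<noteq> i0" | (col) "i' = i" "i = i0" "j \<noteq> j0" "j' \<noteq> j0"
      using bZ step unfolding b by (auto simp: near_def near_row_def near_col_def Z_def)
    then have "{b, b'} \<in> far_peaks"
    proof cases
      case row
      then have "i' = Suc i \<or> i = Suc i'" using step bb(2) unfolding b by auto
      moreover have "sx i \<noteq> sx i'" using differ(1) row unfolding b by simp
      ultimately show ?thesis using row by (intro mem) (auto simp: b rising_def)
    next
      case col
      then have "j' = Suc j \<or> j = Suc j'" using step bb(2) unfolding b by auto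
      moreover have "sy j \<noteq> sy j'" using differ(2) col unfolding b by simp
      ultimately show ?thesis using col by (intro mem) (auto simp: b rising_def)
    qed
    then show ?thesis ..
  qed simp
qed

text \<open>
  Position \<open>p\<close> is the only one that can be moved across the peak \<open>P\<close>, and it can
  always be moved, whatever happens elsewhere.
\<close>

definition togglable :: "(nat \<times> nat) list \<Rightarrow> (nat \<times> nat) set \<Rightarrow> nat \<Rightarrow> bool" where
  "togglable w P p \<longleftrightarrow> p < length w \<and> w ! p \<in> P \<and>
     (\<forall>z \<in> relabelings w. snd (z ! p) \<in> P \<and> (\<forall>x \<in> P. z[p := (w ! p, x)] \<in> relabelings w) \<and>
        (\<forall>q < length w. q \<noteq> p \<longrightarrow> {fst (z ! q), snd (z ! q)} \<noteq> P))"

text \<open>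
  The peak of adjacent columns \<open>i\<close> and \<open>Suc i\<close> with these signs consists of
  the points that come first in the word. The first position of a letter of the two cells is the tip of the
  peak, and the tip may belong to either cell. If a later point of \<open>u\<close> changed sides, then it would lie in
  the same new cell as the tip, in the wrong relative position; the points of \<open>v\<close> can only move away from
  the peak.
\<close>

lemma togglable_row_head:
  assumes fx: "fixing u" "fixing v"
    and i: "Suc i \<le> c" "i \<noteq> i0" "Suc i \<noteq> i0" and sx: "\<not> sx i" "sx (Suc i)"
  shows "\<exists>p. togglable (u @ v) {(j0, i), (j0, Suc i)} p"
proof -
  let ?P = "{(j0, i), (j0, Suc i)}" and ?w = "u @ v"
  have P_Z: "?P \<subseteq> Z" using i row_in_Z by auto
  have col_P: "d \<in> ?P \<longleftrightarrow> snd d = i \<or> snd d = Suc i" if "d \<in> Z" for d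
    using that i by (cases d) (auto simp: Z_def)
  have "map (\<lambda>a. (a, a)) u \<in> relabelings u" using fx(1) identity_relabeling by (simp add: fixing_def)
  then have "((j0, i), (j0, i)) \<in> set (map (\<lambda>a. (a, a)) u)"
    using fx(1) P_Z unfolding fixing_def by blast
  then have "(j0, i) \<in> set u" by auto
  then obtain p0 where p0: "p0 < length u" "?w ! p0 \<in> ?P" by (auto simp: in_set_conv_nth nth_append)
  \<comment> \<open>The tip of the peak; it lies in \<open>u\<close>, since \<open>u\<close> contains both letters.\<close>
  define p where "p = (LEAST p. ?w ! p \<in> ?P)"
  have p: "?w ! p \<in> ?P" unfolding p_def using p0(2) by (rule LeastI)
  have p_u: "p < length u" using Least_le[of "\<lambda>p. ?w ! p \<in> ?P", OF p0(2)] p0(1) by (simp add: p_def)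
  have first: "?w ! q \<notin> ?P" if "q < p" for q using that not_less_Least unfolding p_def by blast
  have "snd (z ! p) \<in> ?P \<and> (\<forall>x \<in> ?P. z[p := (?w ! p, x)] \<in> relabelings ?w) \<and>
        (\<forall>q < length ?w. q \<noteq> p \<longrightarrow> {fst (z ! q), snd (z ! q)} \<noteq> ?P)" if z: "z \<in> relabelings ?w" for z
  proof -
    have zw: "map fst z = ?w" "snd ` set z \<subseteq> Z" and sorted: "sorted_wrt compat z"
      using z by (auto simp: relabelings_def)
    have len: "length z = length ?w" using arg_cong[OF zw(1), of length] by simp
    have fst_z: "fst (z ! q) = ?w ! q" if "q < length ?w" for q
      using that zw(1) len by (metis nth_map)
    have in_Z: "fst (z ! q) \<in> Z" "snd (z ! q) \<in> Z" if "q < length ?w" for q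
    proof -
      show "snd (z ! q) \<in> Z" using that len zw(2) by (metis image_subset_iff nth_mem)
      have "?w ! q \<in> set ?w" using that nth_mem by blast
      then show "fst (z ! q) \<in> Z" using fst_z[OF that] fx by (auto simp: fixing_def)
    qed
    have head: "compat (fst (z ! q), snd (z ! q)) (e, e)" if "q < length u" "e \<in> Z" for q e
      using fixing_append(1)[OF fx z that(2,1)] by simp
    have tail: "compat (e, e) (fst (z ! q), snd (z ! q))" if "length u \<le> q" "q < length ?w" "e \<in> Z" for q e
      using fixing_append(2)[OF fx z that(3,1,2)] by simp
    have pairs: "compat (fst (z ! q), snd (z ! q)) (fst (z ! q'), snd (z ! q'))"
      if "q < q'" "q' < length ?w" for q q'
      using sorted that len by (simp add: sorted_wrt_iff_nth_less)
    have step_head: "if sx (snd (fst (z ! q)))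
        then snd (snd (z ! q)) \<le> snd (fst (z ! q)) \<and> snd (fst (z ! q)) \<le> Suc (snd (snd (z ! q)))
        else snd (fst (z ! q)) \<le> snd (snd (z ! q)) \<and> snd (snd (z ! q)) \<le> Suc (snd (fst (z ! q)))"
      if "q < length u" for q
      using that by (intro col_step_head head in_Z) auto
    have step_tail: "if sx (snd (fst (z ! q)))
        then snd (fst (z ! q)) \<le> snd (snd (z ! q)) \<and> snd (snd (z ! q)) \<le> Suc (snd (fst (z ! q)))
        else snd (snd (z ! q)) \<le> snd (fst (z ! q)) \<and> snd (fst (z ! q)) \<le> Suc (snd (snd (z ! q)))"
      if "length u \<le> q" "q < length ?w" for q
      using that by (intro col_step_tail tail in_Z) auto
    have p_w: "p < length ?w" using p_u by simp
    define a a' where "a = ?w ! p" and "a' = snd (z ! p)"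
    have a: "a \<in> ?P" using p by (simp add: a_def)
    have zp: "fst (z ! p) = a" using fst_z[OF p_w] by (simp add: a_def)
    have a': "a' \<in> ?P"
      using step_head[OF p_u] a sx col_P[OF in_Z(2)[OF p_w]] unfolding zp a'_def[symmetric]
      by auto
    have unique: "{fst (z ! q), snd (z ! q)} \<noteq> ?P" if q: "q < length ?w" "q \<noteq> p" for q
    proof
      assume eq: "{fst (z ! q), snd (z ! q)} = ?P"
      then have d: "fst (z ! q) = (j0, i) \<and> snd (z ! q) = (j0, Suc i) \<or>
          fst (z ! q) = (j0, Suc i) \<and> snd (z ! q) = (j0, i)"
        by (auto simp: doubleton_eq_iff)
      show False
      proof (cases "q < length u")
        case True
        have "\<not> q < p" using first[of q] fst_z[OF q(1)] d by auto
        then have "compat (a, a') (fst (z ! q), snd (z ! q))"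
          using pairs[of p q] q zp by (simp add: a'_def)
        then show False using d a a' sx
          by (cases "z ! q") (auto simp: compat.simps x_less_def y_less_def rising_def)
      next
        case False
        then show False using step_tail[of q] q d sx by auto
      qed
    qed
    have "z[p := (a, x)] \<in> relabelings ?w" if x: "x \<in> ?P" for x
    proof -
      have x_Z: "x \<in> Z" using x P_Z by auto
      \<comment> \<open>Earlier points lie in other columns, so they see \<open>a\<close> as they see the unmoved \<open>x\<close> in \<open>v\<close>.\<close>
      have before: "compat (z ! q) (a, x)" if q: "q < p" for q
      proof -
        let ?d = "fst (z ! q)" and ?d' = "snd (z ! q)"
        have "?d \<notin> ?P" using first[OF q] fst_z[of q] q p_w by simp
        then have "snd ?d \<noteq> i \<and> snd ?d \<noteq> Suc i" using col_P[OF in_Z(1)[of q]] q p_w by auto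
        then have "compat (?d, ?d') (a, x) = compat (?d, ?d') (x, x)"
          using a x by (intro compat_cong_right) (auto simp: x_less_def y_less_def)
        then show ?thesis using head[of q x] q p_u x_Z by simp
      qed
      have after: "compat (a, x) (z ! q)" if q: "p < q" "q < length ?w" for q
      proof -
        let ?d = "fst (z ! q)" and ?d' = "snd (z ! q)"
        have pq: "compat (a, a') (?d, ?d')" using pairs[OF q] zp by (simp add: a'_def)
        have "compat (a, x) (?d, ?d')"
        proof (cases "?d \<in> ?P")
          case False
          then have col: "snd ?d \<noteq> i \<and> snd ?d \<noteq> Suc i" using col_P[OF in_Z(1)[OF q(2)]] by auto
          show ?thesis
          proof (cases "q < length u")
            case True
            have less: "x_less a ?d \<longleftrightarrow> \<not> x_less ?d x"
              using a x col by (auto simp: x_less_def)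
            have rows: "fst a = j0" "fst a' = j0" "fst x = j0" using a a' x by auto
            have "(x_less a ?d = y_less a ?d) = rising x" if eq: "?d' = x"
            proof (cases "fst ?d = j0")
              case True
              have turn: "(x_less ?d x = sy j0) = (sx (snd x) = sy j0)"
                using head[OF \<open>q < length u\<close> x_Z] eq rows True
                unfolding compat.simps by (simp add: y_less_def rising_def)
              have "snd ?d < i \<Longrightarrow> x = (j0, i)" "Suc i < snd ?d \<Longrightarrow> x = (j0, Suc i)"
                using step_head[OF \<open>q < length u\<close>] x unfolding eq by (auto split: if_splits)
              then show ?thesis using turn x col sx by (auto simp: x_less_def)
            next
              case False
              then have "y_less a ?d \<longleftrightarrow> \<not> y_less ?d x" using rows by (auto simp: y_less_def)
              then show ?thesis using less eq head[OF \<open>q < length u\<close> x_Z] unfolding compat.simps by auto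
            qed
            moreover have "if x_less a ?d then snd x \<le> snd ?d' else snd ?d' \<le> snd x"
              using less head[OF True x_Z] unfolding compat.simps by (auto split: if_splits)
            moreover have "if y_less a ?d then fst x \<le> fst ?d' else fst ?d' \<le> fst x"
              using pq rows unfolding compat.simps by (auto split: if_splits)
            ultimately show ?thesis unfolding compat.simps by auto
          next
            case False
            have "compat (a, x) (?d, ?d') = compat (x, x) (?d, ?d')"
              using a x col by (intro compat_cong_left) (auto simp: x_less_def y_less_def)
            then show ?thesis using tail[of q x] False q x_Z by simp
          qed
        next
          case True
          have ne: "{?d, ?d'} \<noteq> ?P" using unique q by simp
          have colP': "?d' \<in> ?P \<longleftrightarrow> snd ?d' = i \<or> snd ?d' = Suc i" using col_P[OF in_Z(2)[OF q(2)]] .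
          have "?d' = ?d \<or> ?d' \<notin> ?P \<and> length u \<le> q"
          proof (cases "q < length u")
            case True
            then show ?thesis using step_head[OF True] \<open>?d \<in> ?P\<close> ne colP' sx by (auto simp: doubleton_eq_iff)
          next
            case False
            then show ?thesis using \<open>?d \<in> ?P\<close> ne by (auto simp: doubleton_eq_iff)
          qed
          then show ?thesis
          proof
            assume eq: "?d' = ?d"
            have "compat (a, x) (d, d)" if "d \<in> ?P" for d
              using that a x sx by (auto simp: compat.simps x_less_def y_less_def rising_def)
            then show ?thesis unfolding eq using True .
          next
            assume d': "?d' \<notin> ?P \<and> length u \<le> q"
            then have step: "if snd ?d = Suc i then Suc i \<le> snd ?d' else snd ?d' \<le> i"
              using step_tail[of q] q(2) True sx by (auto split: if_splits)
            have "x_less a ?d \<longleftrightarrow> snd ?d = Suc i"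
              using True a sx by (auto simp: x_less_def)
            then have "if x_less a ?d then snd x \<le> snd ?d' else snd ?d' \<le> snd x"
              using step x by (auto split: if_splits)
            moreover have "fst a' = j0" "fst x = j0" using a' x by auto
            then have "if y_less a ?d then fst x \<le> fst ?d' else fst ?d' \<le> fst x"
              using pq unfolding compat.simps by (auto split: if_splits)
            moreover have "x \<noteq> ?d'" using d' x by auto
            ultimately show ?thesis unfolding compat.simps by blast
          qed
        qed
        then show ?thesis by simp
      qed
      have "sorted_wrt compat (z[p := (a, x)])"
        unfolding sorted_wrt_iff_nth_less
      proof (intro allI impI)
        fix q q' assume qq: "q < q'" "q' < length (z[p := (a, x)])"
        then show "compat (z[p := (a, x)] ! q) (z[p := (a, x)] ! q')"
          using before[of q] after[of q'] pairs[of q q'] len p_w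
          by (cases "q = p"; cases "q' = p") auto
      qed
      moreover have "map fst (z[p := (a, x)]) = ?w"
        using zw(1) zp len p_w by (metis fst_conv list_update_id map_update nth_map)
      moreover have "snd ` set (z[p := (a, x)]) \<subseteq> snd ` insert (a, x) (set z)"
        by (intro image_mono set_update_subset_insert)
      moreover have "snd ` insert (a, x) (set z) \<subseteq> Z" using zw(2) x_Z by simp
      ultimately have "map fst (z[p := (a, x)]) = ?w" "snd ` set (z[p := (a, x)]) \<subseteq> Z"
        "sorted_wrt compat (z[p := (a, x)])" by (simp_all only: order_trans)
      then show ?thesis by (simp add: relabelings_def)
    qed
    then show ?thesis using a' unique by (simp add: a_def a'_def)
  qed
  moreover have "p < length ?w" using p_u by simp
  ultimately show ?thesis using p unfolding togglable_def by blast
qed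


text \<open>
  Exchanging the roles of rows and columns and reversing the word with both kinds of signs negated are symmetries
  of \<open>compat\<close>; they reduce all four kinds of peaks to the one treated above.
\<close>

lemma transpose_cross: "cross c r i0 j0"
  using r_pos c_pos i0_le j0_le by unfold_locales

lemma relabelings_transpose:
  assumes "z \<in> relabelings w"
  shows "map (map_prod prod.swap prod.swap) z \<in> cross.relabelings c r i0 j0 sy sx (map prod.swap w)"
proof -
  interpret T: cross c r i0 j0 sy sx by (rule transpose_cross)
  have "T.compat (prod.swap a, prod.swap a') (prod.swap b, prod.swap b') = compat (a, a') (b, b')"
    for a a' b b'
  proof -
    have "T.x_less (prod.swap a) (prod.swap b) = y_less a b" "T.y_less (prod.swap a) (prod.swap b) = x_less a b"
      by (simp_all add: T.x_less_def T.y_less_def x_less_def y_less_def)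
    moreover have "T.rising (prod.swap a') = rising a'" by (auto simp: T.rising_def rising_def)
    moreover have "prod.swap a' = prod.swap b' \<longleftrightarrow> a' = b'" by (auto simp: prod_eq_iff)
    ultimately show ?thesis by (auto simp: compat.simps T.compat.simps)
  qed
  then have "T.compat (map_prod prod.swap prod.swap p) (map_prod prod.swap prod.swap p') = compat p p'" for p p'
    by (cases p; cases p') (simp only: map_prod_simp)
  moreover have "prod.swap a \<in> T.Z" if "a \<in> Z" for a
    using that by (auto simp: Z_def T.Z_def)
  ultimately show ?thesis
    using assms by (auto simp: relabelings_def T.relabelings_def sorted_wrt_map image_subset_iff)
qed

lemma fixing_transpose:
  assumes "fixing w"
  shows "cross.fixing c r i0 j0 sy sx (map prod.swap w)"
proof -
  interpret T: cross c r i0 j0 sy sx by (rule transpose_cross)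
  have swap_Z: "prod.swap a \<in> T.Z \<longleftrightarrow> a \<in> Z" for a by (cases a) (auto simp: Z_def T.Z_def)
  have "(a, a) \<in> set z" if z: "z \<in> T.relabelings (map prod.swap w)" and a: "a \<in> T.Z" for z a
  proof -
    have "map (map_prod prod.swap prod.swap) z \<in> relabelings w"
      using T.relabelings_transpose[OF z] by (simp add: o_def)
    moreover have "prod.swap a \<in> Z" using a swap_Z[of "prod.swap a"] by simp
    ultimately have "(prod.swap a, prod.swap a) \<in> map_prod prod.swap prod.swap ` set z"
      using assms by (auto simp: fixing_def simp del: set_map simp add: set_map[symmetric])
    then show ?thesis by (cases a) auto
  qed
  then show ?thesis using assms swap_Z by (auto simp: T.fixing_def fixing_def)
qed

lemma togglable_transpose:
  assumes "cross.togglable c r i0 j0 sy sx (map prod.swap w) (prod.swap ` P) p"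
  shows "togglable w P p"
proof -
  interpret T: cross c r i0 j0 sy sx by (rule transpose_cross)
  let ?sw = "map (map_prod prod.swap prod.swap)"
  have swap_P: "prod.swap a \<in> prod.swap ` P \<longleftrightarrow> a \<in> P" for a by (simp add: inj_image_mem_iff)
  have "p < length w" "map prod.swap w ! p \<in> prod.swap ` P"
    using assms unfolding T.togglable_def length_map by blast+
  then have p: "p < length w" "w ! p \<in> P"
    using swap_P[of "w ! p"] by simp_all
  have "snd (z ! p) \<in> P \<and> (\<forall>x \<in> P. z[p := (w ! p, x)] \<in> relabelings w) \<and>
        (\<forall>q < length w. q \<noteq> p \<longrightarrow> {fst (z ! q), snd (z ! q)} \<noteq> P)" if z: "z \<in> relabelings w" for z
  proof -
    have len: "length z = length w" using z by (auto simp: relabelings_def)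
    have t: "snd (?sw z ! p) \<in> prod.swap ` P"
      "\<And>x. x \<in> prod.swap ` P \<Longrightarrow> (?sw z)[p := (map prod.swap w ! p, x)] \<in> T.relabelings (map prod.swap w)"
      "\<And>q. q < length w \<Longrightarrow> q \<noteq> p \<Longrightarrow> {fst (?sw z ! q), snd (?sw z ! q)} \<noteq> prod.swap ` P"
      using assms relabelings_transpose[OF z] unfolding T.togglable_def length_map by blast+
    have "snd (z ! p) \<in> P" using t(1) p len swap_P by (cases "z ! p") auto
    moreover have "z[p := (w ! p, x)] \<in> relabelings w" if "x \<in> P" for x
    proof -
      have "?sw ((?sw z)[p := (map prod.swap w ! p, prod.swap x)]) \<in> relabelings w"
        using T.relabelings_transpose[OF t(2)[of "prod.swap x"]] that by (simp add: o_def)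
      moreover have "map_prod prod.swap prod.swap (map_prod prod.swap prod.swap y) = y"
        for y :: "(nat \<times> nat) \<times> nat \<times> nat" by (cases y) simp
      ultimately show ?thesis using p by (simp add: map_update o_def)
    qed
    moreover have "{fst (z ! q), snd (z ! q)} \<noteq> P" if "q < length w" "q \<noteq> p" for q
      using t(3)[OF that] that len by (cases "z ! q") auto
    ultimately show ?thesis by blast
  qed
  then show ?thesis using p unfolding togglable_def by blast
qed

lemma relabelings_reverse:
  "z \<in> relabelings w \<longleftrightarrow> rev z \<in> cross.relabelings r c j0 i0 (\<lambda>i. \<not> sx i) (\<lambda>j. \<not> sy j) (rev w)"
proof -
  interpret R: cross r c j0 i0 "\<lambda>i. \<not> sx i" "\<lambda>j. \<not> sy j" by (rule cross_axioms)
  have "R.compat (b, b') (a, a') = compat (a, a') (b, b')" for a a' b b'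
  proof -
    have "R.x_less b a \<longleftrightarrow> \<not> x_less a b" "R.y_less b a \<longleftrightarrow> \<not> y_less a b"
      by (auto simp: R.x_less_def R.y_less_def x_less_def y_less_def)
    moreover have "R.rising b' = rising b'" by (auto simp: R.rising_def rising_def)
    ultimately show ?thesis by (auto simp: compat.simps R.compat.simps)
  qed
  then have "R.compat p' p = compat p p'" for p p'
    by (cases p; cases p') (simp only:)
  then show ?thesis
    by (simp add: relabelings_def R.relabelings_def sorted_wrt_rev rev_map[symmetric])
qed

lemma fixing_reverse:
  "fixing w \<Longrightarrow> cross.fixing r c j0 i0 (\<lambda>i. \<not> sx i) (\<lambda>j. \<not> sy j) (rev w)"
proof -
  interpret R: cross r c j0 i0 "\<lambda>i. \<not> sx i" "\<lambda>j. \<not> sy j" by (rule cross_axioms)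
  assume w: "fixing w"
  have "(a, a) \<in> set z" if "z \<in> R.relabelings (rev w)" "a \<in> Z" for z a
  proof -
    have "rev z \<in> relabelings w" using that(1) relabelings_reverse[of "rev z"] by simp
    then have "(a, a) \<in> set (rev z)" using w that(2) unfolding fixing_def by blast
    then show ?thesis by simp
  qed
  then show ?thesis using w by (simp add: R.fixing_def fixing_def)
qed

lemma togglable_reverse:
  assumes "cross.togglable r c j0 i0 (\<lambda>i. \<not> sx i) (\<lambda>j. \<not> sy j) (rev w) P p"
  shows "togglable w P (length w - Suc p)"
proof -
  interpret R: cross r c j0 i0 "\<lambda>i. \<not> sx i" "\<lambda>j. \<not> sy j" by (rule cross_axioms)
  have p: "p < length w" using assms by (simp add: R.togglable_def)
  then have wp: "rev w ! p = w ! (length w - Suc p)" by (simp add: rev_nth)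
  have "snd (z ! (length w - Suc p)) \<in> P \<and>
      (\<forall>x \<in> P. z[length w - Suc p := (w ! (length w - Suc p), x)] \<in> relabelings w) \<and>
      (\<forall>q < length w. q \<noteq> length w - Suc p \<longrightarrow> {fst (z ! q), snd (z ! q)} \<noteq> P)"
    if z: "z \<in> relabelings w" for z
  proof -
    have len: "length z = length w" using z by (auto simp: relabelings_def)
    have t: "snd (rev z ! p) \<in> P" "\<And>x. x \<in> P \<Longrightarrow> (rev z)[p := (rev w ! p, x)] \<in> R.relabelings (rev w)"
      "\<And>q. q < length w \<Longrightarrow> q \<noteq> p \<Longrightarrow> {fst (rev z ! q), snd (rev z ! q)} \<noteq> P"
      using assms z relabelings_reverse[of z w] by (auto simp: R.togglable_def)
    have "snd (z ! (length w - Suc p)) \<in> P" using t(1) p len by (simp add: rev_nth)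
    moreover have "z[length w - Suc p := (w ! (length w - Suc p), x)] \<in> relabelings w" if "x \<in> P" for x
      using t(2)[OF that] relabelings_reverse[of "rev ((rev z)[p := (rev w ! p, x)])" w] p len wp
      by (simp add: rev_update)
    moreover have "{fst (z ! q), snd (z ! q)} \<noteq> P" if "q < length w" "q \<noteq> length w - Suc p" for q
      using t(3)[of "length w - Suc q"] that len p by (simp add: rev_nth)
    ultimately show ?thesis by blast
  qed
  then show ?thesis using assms p wp unfolding togglable_def R.togglable_def by simp
qed

lemma togglable_row:
  assumes fx: "fixing u" "fixing v"
    and i: "Suc i \<le> c" "i \<noteq> i0" "Suc i \<noteq> i0" and sx: "sx i \<noteq> sx (Suc i)"
  shows "\<exists>p. togglable (u @ v) {(j0, i), (j0, Suc i)} p"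
proof (cases "sx i")
  case False
  then show ?thesis using togglable_row_head[OF fx i] sx by simp
next
  case True
  interpret R: cross r c j0 i0 "\<lambda>i. \<not> sx i" "\<lambda>j. \<not> sy j" by (rule cross_axioms)
  obtain p where "R.togglable (rev v @ rev u) {(j0, i), (j0, Suc i)} p"
    using R.togglable_row_head[OF fixing_reverse[OF fx(2)] fixing_reverse[OF fx(1)] i] True sx by auto
  then show ?thesis using togglable_reverse[of "u @ v"] by (metis rev_append)
qed

lemma far_peak_cases:
  assumes "P \<in> far_peaks"
  obtains (row) i where "P = {(j0, i), (j0, Suc i)}" "Suc i \<le> c" "i \<noteq> i0" "Suc i \<noteq> i0" "sx i \<noteq> sx (Suc i)"
  | (col) j where "P = {(j, i0), (Suc j, i0)}" "Suc j \<le> r" "j \<noteq> j0" "Suc j \<noteq> j0" "sy j \<noteq> sy (Suc j)"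
proof -
  obtain a b where P: "P = {a, b}" and ab: "a \<in> Z" "b \<in> Z" "adjacent_cells a b" "rising a" "\<not> rising b"
    "(j0, i0) \<noteq> a" "(j0, i0) \<noteq> b"
    using assms by (auto simp: far_peaks_def)
  obtain j i j' i' where c: "a = (j, i)" "b = (j', i')" by (cases a, cases b)
  from ab consider "j = j0" "j' = j0" "i' = Suc i" | "j = j0" "j' = j0" "i = Suc i'"
    | "i = i0" "i' = i0" "j' = Suc j" | "i = i0" "i' = i0" "j = Suc j'"
    unfolding c by (auto simp: Z_def)
  then show thesis
  proof cases
    case 1
    then show ?thesis using row[of i] P ab unfolding c by (auto simp: Z_def rising_def)
  next
    case 2
    then show ?thesis using row[of i'] P ab unfolding c by (auto simp: Z_def rising_def insert_commute)
  next
    case 3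
    then show ?thesis using col[of j] P ab unfolding c by (auto simp: Z_def rising_def)
  next
    case 4
    then show ?thesis using col[of j'] P ab unfolding c by (auto simp: Z_def rising_def insert_commute)
  qed
qed

lemma togglable_far_peak:
  assumes fx: "fixing u" "fixing v" and P: "P \<in> far_peaks"
  shows "\<exists>p. togglable (u @ v) P p"
  using P
proof (cases rule: far_peak_cases)
  case (row i)
  then show ?thesis using togglable_row[OF fx] by blast
next
  case (col j)
  interpret T: cross c r i0 j0 sy sx by (rule transpose_cross)
  have "\<exists>p. T.togglable (map prod.swap u @ map prod.swap v) {(i0, j), (i0, Suc j)} p"
    using col by (intro T.togglable_row fixing_transpose fx) auto
  then show ?thesis using togglable_transpose[of "u @ v" P] col(1) by auto
qed

lemma finite_far_peaks: "finite far_peaks"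
  by (rule finite_subset[of _ "Pow Z"]) (auto simp: far_peaks_def finite_Z)

lemma far_peak_doubleton:
  assumes "P \<in> far_peaks"
  obtains a b where "P = {a, b}" "a \<noteq> b"
  using assms by (cases rule: far_peak_cases) auto

text \<open>
  The tips of different peaks are different positions. For each peak, toggling its tip is a
  bijection between the relabellings that leave the tip in place and those that move it, which halves
  the count one peak at a time. What remains when all tips are in place are the local relabellings.
\<close>

theorem card_relabelings_far_peaks:
  assumes fx: "fixing u" "fixing v"
  shows "card (relabelings (u @ v)) = 2 ^ card far_peaks * card (local_relabelings (u @ v))"
proof -
  let ?w = "u @ v"
  define pos where "pos P = (SOME p. togglable ?w P p)" for P
  have pos: "togglable ?w P (pos P)" if "P \<in> far_peaks" for P
    unfolding pos_def using togglable_far_peak[OF fx that] by (rule someI_ex)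
  have len: "length z = length ?w" if "z \<in> relabelings ?w" for z
    using that by (auto simp: relabelings_def dest: arg_cong[of _ _ length])
  have fst_z: "fst (z ! p) = ?w ! p" if "z \<in> relabelings ?w" "p < length ?w" for z p
    using that len[OF that(1)] by (auto simp: relabelings_def) (metis nth_map)
  have "set ?w \<subseteq> Z" using fx by (auto simp: fixing_def)
  then have id: "map (\<lambda>a. (a, a)) ?w \<in> relabelings ?w" by (rule identity_relabeling)
  \<comment> \<open>If two peaks shared their tip, then every label allowed for one would be allowed for the other.\<close>
  have pos_inj: "P = Q" if P: "P \<in> far_peaks" and Q: "Q \<in> far_peaks" and eq: "pos P = pos Q" for P Q
  proof -
    have "P \<subseteq> Q" if PQ: "P \<in> far_peaks" "Q \<in> far_peaks" "pos P = pos Q" for P Q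
    proof
      fix x assume "x \<in> P"
      then have "(map (\<lambda>a. (a, a)) ?w)[pos P := (?w ! pos P, x)] \<in> relabelings ?w"
        using pos[OF PQ(1)] id by (auto simp: togglable_def)
      then have "snd ((map (\<lambda>a. (a, a)) ?w)[pos P := (?w ! pos P, x)] ! pos Q) \<in> Q"
        using pos[OF PQ(2)] by (auto simp: togglable_def)
      then show "x \<in> Q" using PQ(3) pos[OF PQ(2)] by (simp add: togglable_def)
    qed
    from this[OF P Q eq] this[OF Q P eq[symmetric]] show ?thesis by blast
  qed
  define E where "E S = {z \<in> relabelings ?w. \<forall>P \<in> S. snd (z ! pos P) = ?w ! pos P}" for S
  have "card (relabelings ?w) = 2 ^ card S * card (E S)" if "finite S" "S \<subseteq> far_peaks" for S
    using that
  proof (induction S rule: finite_induct)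
    case empty
    then show ?case by (simp add: E_def)
  next
    case (insert P S)
    then have P: "P \<in> far_peaks" and S: "S \<subseteq> far_peaks" by auto
    define p where "p = pos P"
    have tog: "p < length ?w" "?w ! p \<in> P" "\<And>z. z \<in> relabelings ?w \<Longrightarrow> snd (z ! p) \<in> P"
      "\<And>z x. z \<in> relabelings ?w \<Longrightarrow> x \<in> P \<Longrightarrow> z[p := (?w ! p, x)] \<in> relabelings ?w"
      using pos[OF P] by (auto simp: togglable_def p_def)
    obtain x where x: "P = {?w ! p, x}" "x \<noteq> ?w ! p"
    proof -
      obtain a b where "P = {a, b}" "a \<noteq> b" using far_peak_doubleton[OF P] .
      then show thesis using tog(2) that[of a] that[of b] by (auto simp: insert_commute)
    qed
    have other: "p \<noteq> pos Q" if "Q \<in> S" for Q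
      using pos_inj[of P Q] that S P insert(2) unfolding p_def by auto
    let ?t = "\<lambda>z. z[p := (?w ! p, x)]"
    have inj: "inj_on ?t (E (insert P S))"
    proof (rule inj_onI)
      fix z z' assume z: "z \<in> E (insert P S)" "z' \<in> E (insert P S)" and eq: "?t z = ?t z'"
      then have rel: "z \<in> relabelings ?w" "z' \<in> relabelings ?w"
        and "snd (z ! p) = ?w ! p" "snd (z' ! p) = ?w ! p" by (auto simp: E_def p_def)
      then have "z ! p = z' ! p" using fst_z[OF rel(1) tog(1)] fst_z[OF rel(2) tog(1)]
        by (simp add: prod_eq_iff)
      then have "(?t z)[p := z ! p] = (?t z')[p := z' ! p]" by (simp only: eq)
      then show "z = z'" by simp
    qed
    have image: "?t ` E (insert P S) = {z \<in> E S. snd (z ! p) \<noteq> ?w ! p}"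
    proof (intro equalityI subsetI)
      fix y assume "y \<in> ?t ` E (insert P S)"
      then obtain z where z: "z \<in> E (insert P S)" "y = ?t z" by auto
      then have "z \<in> relabelings ?w" by (simp add: E_def)
      then show "y \<in> {z \<in> E S. snd (z ! p) \<noteq> ?w ! p}"
        using z tog x other len by (auto simp: E_def)
    next
      fix y assume y: "y \<in> {z \<in> E S. snd (z ! p) \<noteq> ?w ! p}"
      then have rel: "y \<in> relabelings ?w" by (simp add: E_def)
      then have "snd (y ! p) = x" using tog(3) y x by auto
      then have yp: "y ! p = (?w ! p, x)" using fst_z[OF rel tog(1)] by (simp add: prod_eq_iff)
      let ?z = "y[p := (?w ! p, ?w ! p)]"
      have "?z \<in> E (insert P S)"
        using rel y tog other len[OF rel] by (auto simp: E_def p_def[symmetric])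
      moreover have "y = ?t ?z" using yp by (metis list_update_id list_update_overwrite)
      ultimately show "y \<in> ?t ` E (insert P S)" by blast
    qed
    have "E S = E (insert P S) \<union> {z \<in> E S. snd (z ! p) \<noteq> ?w ! p}" by (auto simp: E_def p_def)
    moreover have "E (insert P S) \<inter> {z \<in> E S. snd (z ! p) \<noteq> ?w ! p} = {}" by (auto simp: E_def p_def)
    moreover have "finite (E S)" for S using finite_relabelings by (simp add: E_def)
    ultimately have "card (E S) = card (E (insert P S)) + card {z \<in> E S. snd (z ! p) \<noteq> ?w ! p}"
      by (metis (no_types, lifting) card_Un_disjoint finite_Un)
    also have "card {z \<in> E S. snd (z ! p) \<noteq> ?w ! p} = card (E (insert P S))"
      unfolding image[symmetric] by (rule card_image[OF inj])
    finally have "card (E S) = 2 * card (E (insert P S))" by simp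
    then show ?case using insert S by simp
  qed
  from this[OF finite_far_peaks order_refl]
  have "card (relabelings ?w) = 2 ^ card far_peaks * card (E far_peaks)" .
  moreover have "E far_peaks = local_relabelings ?w"
  proof (intro equalityI subsetI)
    fix z assume z: "z \<in> E far_peaks"
    then have rel: "z \<in> relabelings ?w" by (simp add: E_def)
    have "a = a' \<or> a \<in> near \<and> a' \<in> near" if aa: "(a, a') \<in> set z" for a a'
    proof (rule ccontr)
      assume not: "\<not> (a = a' \<or> a \<in> near \<and> a' \<in> near)"
      then have P: "{a, a'} \<in> far_peaks" using change_near_or_far_peak[OF fx rel aa] by auto
      obtain q where q: "q < length ?w" "z ! q = (a, a')"
        using aa len[OF rel] by (metis in_set_conv_nth)
      have "\<forall>q < length ?w. q \<noteq> pos {a, a'} \<longrightarrow> {fst (z ! q), snd (z ! q)} \<noteq> {a, a'}"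
        using pos[OF P] rel unfolding togglable_def by blast
      then have q_pos: "q = pos {a, a'}" using q by auto
      have "snd (z ! pos {a, a'}) = ?w ! pos {a, a'}" using z P by (simp add: E_def)
      then have "a' = ?w ! q" using q(2) unfolding q_pos[symmetric] by simp
      then show False using fst_z[OF rel q(1)] q(2) not by simp
    qed
    then show "z \<in> local_relabelings ?w" using rel by (auto simp: local_relabelings_def)
  next
    fix z assume z: "z \<in> local_relabelings ?w"
    then have rel: "z \<in> relabelings ?w" by (simp add: local_relabelings_def)
    have "snd (z ! pos P) = ?w ! pos P" if P: "P \<in> far_peaks" for P
    proof (rule ccontr)
      assume ne: "snd (z ! pos P) \<noteq> ?w ! pos P"
      have p: "pos P < length ?w" "?w ! pos P \<in> P" "snd (z ! pos P) \<in> P"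
        using pos[OF P] rel by (auto simp: togglable_def)
      obtain a b where ab: "P = {a, b}" "a \<noteq> b" using far_peak_doubleton[OF P] .
      then have P_eq: "P = {?w ! pos P, snd (z ! pos P)}" using p ne by auto
      have "z ! pos P \<in> set z" using p len[OF rel] by simp
      then have "?w ! pos P \<in> near \<and> snd (z ! pos P) \<in> near"
        using z ne fst_z[OF rel p(1)] unfolding local_relabelings_def by fastforce
      then have "P \<subseteq> near" by (subst P_eq) simp
      with P show False
        by (cases rule: far_peak_cases) (auto simp: near_def near_row_def near_col_def)
    qed
    then show "z \<in> E far_peaks" using rel by (simp add: E_def)
  qed
  ultimately show ?thesis by simp
qed

end

section \<open>Independence of the position of the corner\<close>

definition adjacent_or_equal :: "nat \<Rightarrow> nat \<Rightarrow> bool" where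
  "adjacent_or_equal e i \<longleftrightarrow> i \<le> Suc e \<and> e \<le> Suc i"

text \<open>
  The map \<open>f\<close> is a translation near \<open>e\<close>; elsewhere it is arbitrary, except that distant
  indices remain distant. Distant indices do not move, however, and then the order condition holds on
  both sides for trivial reasons.
\<close>

lemma aligned_compare:
  fixes f :: "nat \<Rightarrow> nat" and e e' m :: nat
  assumes shift: "\<And>i. i \<le> m \<Longrightarrow> adjacent_or_equal e i \<Longrightarrow> f i + e = i + e'"
    and near: "\<And>i. i \<le> m \<Longrightarrow> adjacent_or_equal e' (f i) = adjacent_or_equal e i"
    and s: "\<And>i. i \<le> m \<Longrightarrow> adjacent_or_equal e i \<Longrightarrow> s' (f i) = s i"
    and le: "i \<le> m" "i' \<le> m" "l \<le> m" "l' \<le> m"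
    and i: "i = i' \<or> adjacent_or_equal e i \<and> adjacent_or_equal e i'"
    and l: "l = l' \<or> adjacent_or_equal e l \<and> adjacent_or_equal e l'"
  shows "(if f i < f l \<or> f i = f l \<and> s' (f i) then f i' \<le> f l' else f l' \<le> f i')
    \<longleftrightarrow> (if i < l \<or> i = l \<and> s i then i' \<le> l' else l' \<le> i')"
proof -
  consider "i = i'" "l = l'"
    | "adjacent_or_equal e i" "adjacent_or_equal e i'" "adjacent_or_equal e l" "adjacent_or_equal e l'"
    | "i = i'" "\<not> adjacent_or_equal e i" "adjacent_or_equal e l" "adjacent_or_equal e l'"
    | "l = l'" "\<not> adjacent_or_equal e l" "adjacent_or_equal e i" "adjacent_or_equal e i'"
    using i l by blast
  then show ?thesis
  proof cases
    case 1
    then show ?thesis by auto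
  next
    case 2
    then have "f i + e = i + e'" "f i' + e = i' + e'" "f l + e = l + e'" "f l' + e = l' + e'"
      "s' (f i) = s i" using shift s le by auto
    then have "f i < f l \<longleftrightarrow> i < l" "f i = f l \<longleftrightarrow> i = l" "f i' \<le> f l' \<longleftrightarrow> i' \<le> l'" "f l' \<le> f i' \<longleftrightarrow> l' \<le> i'"
      "s' (f i) = s i" by linarith+
    then show ?thesis by (simp only:)
  next
    case 3
    then have "\<not> adjacent_or_equal e' (f i)" "adjacent_or_equal e' (f l)" "adjacent_or_equal e' (f l')"
      using near le by auto
    then show ?thesis using 3 by (auto simp: adjacent_or_equal_def)
  next
    case 4
    then have "\<not> adjacent_or_equal e' (f l)" "adjacent_or_equal e' (f i)" "adjacent_or_equal e' (f i')"
      using near le by auto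
    then have "if f i < f l \<or> f i = f l \<and> s' (f i) then f i' \<le> f l else f l \<le> f i'"
      unfolding adjacent_or_equal_def by (cases "Suc e' < f l") auto
    moreover have "if i < l \<or> i = l \<and> s i then i' \<le> l else l \<le> i'"
      using 4(2-4) unfolding adjacent_or_equal_def by (cases "Suc e < l") auto
    ultimately show ?thesis unfolding 4(1)[symmetric] by blast
  qed
qed

lemma (in cross) local_relabelings_eq:
  assumes "set w \<subseteq> Z"
  shows "local_relabelings w = {z. set z \<subseteq> {(a, a'). a \<in> Z \<and> a' \<in> Z \<and> (a = a' \<or> a \<in> near \<and> a' \<in> near)} \<and>
    map fst z = w \<and> sorted_wrt compat z}"
proof -
  have "fst p \<in> Z" if "map fst z = w" "p \<in> set z" for z and p :: "(nat \<times> nat) \<times> nat \<times> nat"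
  proof -
    have "fst p \<in> set (map fst z)" using that(2) by simp
    then show ?thesis using that(1) assms by blast
  qed
  note fst_Z = this
  show ?thesis
  proof (intro equalityI subsetI)
    fix z assume "z \<in> local_relabelings w"
    then have z: "map fst z = w" "snd ` set z \<subseteq> Z" "sorted_wrt compat z"
      "\<forall>(a, a') \<in> set z. a = a' \<or> a \<in> near \<and> a' \<in> near"
      by (simp_all add: local_relabelings_def relabelings_def)
    have "(a, a') \<in> {(a, a'). a \<in> Z \<and> a' \<in> Z \<and> (a = a' \<or> a \<in> near \<and> a' \<in> near)}"
      if "(a, a') \<in> set z" for a a'
      using that fst_Z[OF z(1) that] z(2,4) by auto
    then show "z \<in> {z. set z \<subseteq> {(a, a'). a \<in> Z \<and> a' \<in> Z \<and> (a = a' \<or> a \<in> near \<and> a' \<in> near)} \<and>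
      map fst z = w \<and> sorted_wrt compat z}"
      using z(1,3) by (simp add: subrelI)
  next
    fix z assume z: "z \<in> {z. set z \<subseteq> {(a, a'). a \<in> Z \<and> a' \<in> Z \<and> (a = a' \<or> a \<in> near \<and> a' \<in> near)} \<and>
      map fst z = w \<and> sorted_wrt compat z}"
    then have "snd ` set z \<subseteq> Z" "\<forall>(a, a') \<in> set z. a = a' \<or> a \<in> near \<and> a' \<in> near" by auto
    then show "z \<in> local_relabelings w" using z by (simp add: local_relabelings_def relabelings_def)
  qed
qed

text \<open>
  Permutations of the rows and columns that translate the neighbourhood of one corner to that of
  another one, preserving the signs there.
\<close>

locale aligned_crosses =
  A: cross r c j0 i0 sx sy + A': cross r c j0' i0' sx' sy'
  for r c j0 i0 j0' i0' :: nat and sx sy sx' sy' :: "nat \<Rightarrow> bool" +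
  fixes \<rho> \<gamma> :: "nat \<Rightarrow> nat"
  assumes bij_rows: "bij_betw \<rho> {..r} {..r}" and bij_cols: "bij_betw \<gamma> {..c} {..c}"
    and shift_row: "j \<le> r \<Longrightarrow> adjacent_or_equal j0 j \<Longrightarrow> \<rho> j + j0 = j + j0'"
    and shift_col: "i \<le> c \<Longrightarrow> adjacent_or_equal i0 i \<Longrightarrow> \<gamma> i + i0 = i + i0'"
    and near_row: "j \<le> r \<Longrightarrow> adjacent_or_equal j0' (\<rho> j) = adjacent_or_equal j0 j"
    and near_col: "i \<le> c \<Longrightarrow> adjacent_or_equal i0' (\<gamma> i) = adjacent_or_equal i0 i"
    and same_sy: "j \<le> r \<Longrightarrow> adjacent_or_equal j0 j \<Longrightarrow> sy' (\<rho> j) = sy j"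
    and same_sx: "i \<le> c \<Longrightarrow> adjacent_or_equal i0 i \<Longrightarrow> sx' (\<gamma> i) = sx i"
begin

definition \<Phi> :: "nat \<times> nat \<Rightarrow> nat \<times> nat" where
  "\<Phi> = map_prod \<rho> \<gamma>"

lemma corner_image: "\<rho> j0 = j0'" "\<gamma> i0 = i0'"
  using shift_row[OF A.j0_le] shift_col[OF A.i0_le] by (auto simp: adjacent_or_equal_def)

lemma row_eq_iff: "j \<le> r \<Longrightarrow> j' \<le> r \<Longrightarrow> \<rho> j = \<rho> j' \<longleftrightarrow> j = j'"
  and col_eq_iff: "i \<le> c \<Longrightarrow> i' \<le> c \<Longrightarrow> \<gamma> i = \<gamma> i' \<longleftrightarrow> i = i'"
  using bij_rows bij_cols by (auto simp: bij_betw_def inj_on_def)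

lemma row_le: "j \<le> r \<Longrightarrow> \<rho> j \<le> r" and col_le: "i \<le> c \<Longrightarrow> \<gamma> i \<le> c"
  using bij_betwE[OF bij_rows] bij_betwE[OF bij_cols] by auto

lemma \<Phi>_eq_iff: "a \<in> A.Z \<Longrightarrow> b \<in> A.Z \<Longrightarrow> \<Phi> a = \<Phi> b \<longleftrightarrow> a = b"
  by (auto simp: A.Z_def \<Phi>_def row_eq_iff col_eq_iff)

lemma \<Phi>_in_Z: "a \<in> A.Z \<Longrightarrow> \<Phi> a \<in> A'.Z"
  using corner_image by (auto simp: A.Z_def A'.Z_def \<Phi>_def row_le col_le)

lemma bij_\<Phi>: "bij_betw \<Phi> A.Z A'.Z"
  unfolding bij_betw_def
proof
  show inj: "inj_on \<Phi> A.Z" by (auto simp: inj_on_def \<Phi>_eq_iff)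
  have card_Z: "card A.Z = card A'.Z"
    using A.card_letters A'.card_letters A.card_row_cells A'.card_row_cells A.card_col_cells A'.card_col_cells
    by (simp add: A.letters_eq A'.letters_eq)
  show "\<Phi> ` A.Z = A'.Z"
    using \<Phi>_in_Z card_Z card_image[OF inj] by (intro card_subset_eq A'.finite_Z) auto
qed

lemma near_iff: "a \<in> A.Z \<Longrightarrow> \<Phi> a \<in> A'.near \<longleftrightarrow> a \<in> A.near"
  using near_row near_col \<Phi>_in_Z[of a]
  by (cases a) (auto simp: A.near_def A'.near_def \<Phi>_def A.near_row_def A'.near_row_def
      A.near_col_def A'.near_col_def adjacent_or_equal_def A.Z_def)

lemma compat_image:
  assumes Z: "a \<in> A.Z" "a' \<in> A.Z" "b \<in> A.Z" "b' \<in> A.Z"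
    and a: "a = a' \<or> a \<in> A.near \<and> a' \<in> A.near" and b: "b = b' \<or> b \<in> A.near \<and> b' \<in> A.near"
  shows "A'.compat (\<Phi> a, \<Phi> a') (\<Phi> b, \<Phi> b') = A.compat (a, a') (b, b')"
proof -
  have le: "fst x \<le> r \<and> snd x \<le> c" if "x \<in> A.Z" for x using that by (auto simp: A.Z_def)
  have near: "adjacent_or_equal j0 (fst x) \<and> adjacent_or_equal i0 (snd x)" if "x \<in> A.near" for x
    using that by (auto simp: A.near_def A.near_row_def A.near_col_def adjacent_or_equal_def)
  have cols: "snd a = snd a' \<or> adjacent_or_equal i0 (snd a) \<and> adjacent_or_equal i0 (snd a')"
      "snd b = snd b' \<or> adjacent_or_equal i0 (snd b) \<and> adjacent_or_equal i0 (snd b')"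
    and rows: "fst a = fst a' \<or> adjacent_or_equal j0 (fst a) \<and> adjacent_or_equal j0 (fst a')"
      "fst b = fst b' \<or> adjacent_or_equal j0 (fst b) \<and> adjacent_or_equal j0 (fst b')"
    using a b near by blast+
  have bounds: "fst a \<le> r" "fst a' \<le> r" "fst b \<le> r" "fst b' \<le> r"
      "snd a \<le> c" "snd a' \<le> c" "snd b \<le> c" "snd b' \<le> c"
    using Z le by blast+
  have x: "(if A'.x_less (\<Phi> a) (\<Phi> b) then snd (\<Phi> a') \<le> snd (\<Phi> b') else snd (\<Phi> b') \<le> snd (\<Phi> a'))
    \<longleftrightarrow> (if A.x_less a b then snd a' \<le> snd b' else snd b' \<le> snd a')"
    unfolding A.x_less_def A'.x_less_def \<Phi>_def snd_map_prod
    by (rule aligned_compare[of c i0 \<gamma> i0' sx' sx, OF shift_col near_col same_sx bounds(5-8) cols])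
  have y: "(if A'.y_less (\<Phi> a) (\<Phi> b) then fst (\<Phi> a') \<le> fst (\<Phi> b') else fst (\<Phi> b') \<le> fst (\<Phi> a'))
    \<longleftrightarrow> (if A.y_less a b then fst a' \<le> fst b' else fst b' \<le> fst a')"
    unfolding A.y_less_def A'.y_less_def \<Phi>_def fst_map_prod
    by (rule aligned_compare[of r j0 \<rho> j0' sy' sy, OF shift_row near_row same_sy bounds(1-4) rows])
  have turn: "(A'.x_less (\<Phi> a) (\<Phi> b) = A'.y_less (\<Phi> a) (\<Phi> b)) = A'.rising (\<Phi> a')
    \<longleftrightarrow> (A.x_less a b = A.y_less a b) = A.rising a'" if eq: "a' = b'"
  proof (cases "a = b")
    case True
    then show ?thesis using a b eq Z le near
      by (cases "a = a'") (auto simp: A.x_less_def A'.x_less_def A.y_less_def A'.y_less_def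
          A.rising_def A'.rising_def \<Phi>_def same_sx same_sy)
  next
    case False
    then have n: "a \<in> A.near" "a' \<in> A.near" "b \<in> A.near" using a b eq by auto
    then have nn: "adjacent_or_equal j0 (fst x) \<and> adjacent_or_equal i0 (snd x) \<and> fst x \<le> r \<and> snd x \<le> c"
      if "x \<in> {a, a', b}" for x
    proof -
      have "x \<in> A.near" "x \<in> A.Z" using that n Z by auto
      then show ?thesis using near le by blast
    qed
    have "\<rho> (fst x) + j0 = fst x + j0' \<and> \<gamma> (snd x) + i0 = snd x + i0' \<and>
      sx' (\<gamma> (snd x)) = sx (snd x) \<and> sy' (\<rho> (fst x)) = sy (fst x)" if "x \<in> {a, a', b}" for x
      using nn[OF that] shift_row shift_col same_sx same_sy by blast
    note s = this[OF insertI1] this[OF insertI2[OF insertI2[OF insertI1]]] this[OF insertI2[OF insertI1]]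
    have "\<gamma> (snd a) + i0 = snd a + i0'" "\<gamma> (snd b) + i0 = snd b + i0'"
      "\<rho> (fst a) + j0 = fst a + j0'" "\<rho> (fst b) + j0 = fst b + j0'"
      using s by blast+
    then have order: "\<gamma> (snd a) < \<gamma> (snd b) \<longleftrightarrow> snd a < snd b" "\<gamma> (snd a) = \<gamma> (snd b) \<longleftrightarrow> snd a = snd b"
      "\<rho> (fst a) < \<rho> (fst b) \<longleftrightarrow> fst a < fst b" "\<rho> (fst a) = \<rho> (fst b) \<longleftrightarrow> fst a = fst b"
      by linarith+
    have signs: "sx' (\<gamma> (snd a)) = sx (snd a)" "sy' (\<rho> (fst a)) = sy (fst a)"
      "sx' (\<gamma> (snd a')) = sx (snd a')" "sy' (\<rho> (fst a')) = sy (fst a')"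
      using s by blast+
    show ?thesis
      unfolding A.x_less_def A'.x_less_def A.y_less_def A'.y_less_def A.rising_def A'.rising_def
        \<Phi>_def fst_map_prod snd_map_prod order signs ..
  qed
  show ?thesis
    unfolding A.compat.simps A'.compat.simps x y \<Phi>_eq_iff[OF Z(2,4)] using turn by blast
qed

theorem card_local_relabelings_image:
  assumes w: "set w \<subseteq> A.Z"
  shows "card (A'.local_relabelings (map \<Phi> w)) = card (A.local_relabelings w)"
proof -
  let ?P = "{(a, a'). a \<in> A.Z \<and> a' \<in> A.Z \<and> (a = a' \<or> a \<in> A.near \<and> a' \<in> A.near)}"
  let ?P' = "{(a, a'). a \<in> A'.Z \<and> a' \<in> A'.Z \<and> (a = a' \<or> a \<in> A'.near \<and> a' \<in> A'.near)}"
  let ?f = "map_prod \<Phi> \<Phi>"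
  have eq: "A.local_relabelings w = {z. set z \<subseteq> ?P \<and> map fst z = w \<and> sorted_wrt A.compat z}"
    by (rule A.local_relabelings_eq[OF w])
  have w': "set (map \<Phi> w) \<subseteq> A'.Z" using w \<Phi>_in_Z by auto
  have eq': "A'.local_relabelings (map \<Phi> w) = {z. set z \<subseteq> ?P' \<and> map fst z = map \<Phi> w \<and> sorted_wrt A'.compat z}"
    by (rule A'.local_relabelings_eq[OF w'])
  have f_P: "?f p \<in> ?P' \<longleftrightarrow> p \<in> ?P" if "p \<in> A.Z \<times> A.Z" for p
    using that \<Phi>_in_Z \<Phi>_eq_iff near_iff by (cases p) auto
  have f_compat: "A'.compat (?f p) (?f p') = A.compat p p'" if "p \<in> ?P" "p' \<in> ?P" for p p'
    using that compat_image by (cases p; cases p') auto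
  have inj_f: "inj_on ?f (A.Z \<times> A.Z)"
    using bij_\<Phi> map_prod_inj_on[of \<Phi> A.Z \<Phi> A.Z] by (simp add: bij_betw_def)
  have image_P: "?P' \<subseteq> ?f ` ?P"
  proof
    fix p assume p: "p \<in> ?P'"
    obtain b b' where bb: "p = (b, b')" by (cases p)
    with p have "b \<in> \<Phi> ` A.Z" "b' \<in> \<Phi> ` A.Z" using bij_\<Phi> by (auto simp: bij_betw_def)
    then obtain a a' where "p = ?f (a, a')" "a \<in> A.Z" "a' \<in> A.Z" using bb by auto
    then show "p \<in> ?f ` ?P" using f_P[of "(a, a')"] p by (intro image_eqI[of _ _ "(a, a')"]) auto
  qed
  have sorted: "sorted_wrt A'.compat (map ?f z) = sorted_wrt A.compat z" if "set z \<subseteq> ?P" for z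
    using that f_compat by (induction z) (auto simp: subset_iff)
  have "bij_betw (map ?f) (A.local_relabelings w) (A'.local_relabelings (map \<Phi> w))"
    unfolding bij_betw_def
  proof (intro conjI equalityI subsetI)
    show "inj_on (map ?f) (A.local_relabelings w)"
      unfolding eq by (rule inj_on_subset[OF inj_on_map_lists[OF inj_f]]) auto
  next
    fix y assume "y \<in> map ?f ` A.local_relabelings w"
    then obtain z where z: "set z \<subseteq> ?P" "map fst z = w" "sorted_wrt A.compat z" "y = map ?f z"
      unfolding eq by auto
    have "?f p \<in> ?P'" if "p \<in> set z" for p
    proof -
      have p: "p \<in> ?P" using that z(1) by blast
      then have "p \<in> A.Z \<times> A.Z" by auto
      from f_P[OF this] p show ?thesis by (rule iffD2)
    qed
    then have "set y \<subseteq> ?P'" unfolding z(4) set_map by (rule image_subsetI)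
    moreover have "map fst y = map \<Phi> w" using z(2,4) by auto
    ultimately show "y \<in> A'.local_relabelings (map \<Phi> w)"
      unfolding eq' using z sorted by simp
  next
    fix y assume "y \<in> A'.local_relabelings (map \<Phi> w)"
    then have y: "set y \<subseteq> ?P'" "map fst y = map \<Phi> w" "sorted_wrt A'.compat y"
      unfolding eq' by auto
    have "y \<in> lists (?f ` ?P)" using y(1) image_P by auto
    then obtain z where "y = map ?f z" "z \<in> lists ?P" unfolding lists_image by (rule imageE)
    then have z: "set z \<subseteq> ?P" "y = map ?f z" by (simp_all only: lists_eq_set mem_Collect_eq)
    have "map \<Phi> (map fst z) = map \<Phi> w" using y(2) z(2) by (simp add: o_def)
    moreover have "fst p \<in> A.Z" if "p \<in> set z" for p
    proof -
      have "p \<in> ?P" using that z(1) by blast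
      then show ?thesis by auto
    qed
    then have "map fst z \<in> lists A.Z" "w \<in> lists A.Z" using w by auto
    moreover have "inj_on (map \<Phi>) (lists A.Z)"
      using bij_\<Phi> by (intro inj_on_map_lists) (simp add: bij_betw_def)
    ultimately have "map fst z = w" by (meson inj_onD)
    then show "y \<in> map ?f ` A.local_relabelings w"
      unfolding eq using z y(3) sorted[OF z(1)] by (intro image_eqI[of _ _ z]) simp_all
  qed
  then show ?thesis by (rule bij_betw_same_card[symmetric])
qed

end

section \<open>Griddings of the permutation of a word\<close>

definition rank :: "(nat \<Rightarrow> nat) \<Rightarrow> nat \<Rightarrow> nat \<Rightarrow> nat" where
  "rank f n p = card {q. q < n \<and> f q \<le> f p}"

lemma rank_less_iff:
  assumes "p < n" "q < n"
  shows "rank f n p < rank f n q \<longleftrightarrow> f p < f q"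
proof
  assume "f p < f q"
  have "{s. s < n \<and> f s \<le> f p} \<subseteq> {s. s < n \<and> f s \<le> f q}"
    using \<open>f p < f q\<close> by (intro Collect_mono) simp
  moreover have "q \<in> {s. s < n \<and> f s \<le> f q}" "q \<notin> {s. s < n \<and> f s \<le> f p}"
    using assms \<open>f p < f q\<close> by simp_all
  ultimately have "{s. s < n \<and> f s \<le> f p} \<subset> {s. s < n \<and> f s \<le> f q}" by blast
  then show "rank f n p < rank f n q" unfolding rank_def by (intro psubset_card_mono) auto
next
  assume less: "rank f n p < rank f n q"
  show "f p < f q"
  proof (rule ccontr)
    assume "\<not> f p < f q"
    then have "{s. s < n \<and> f s \<le> f q} \<subseteq> {s. s < n \<and> f s \<le> f p}" by auto
    then have "rank f n q \<le> rank f n p" unfolding rank_def by (intro card_mono) auto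
    with less show False by simp
  qed
qed

lemma bij_betw_rank:
  assumes "inj_on f {..<n}"
  shows "bij_betw (rank f n) {..<n} {1..n}"
proof -
  have "rank f n p \<in> {1..n}" if "p < n" for p
  proof -
    have "card {p} \<le> rank f n p" unfolding rank_def using that by (intro card_mono) auto
    moreover have "rank f n p \<le> card {..<n}" unfolding rank_def by (intro card_mono) auto
    ultimately show ?thesis by simp
  qed
  moreover have inj: "inj_on (rank f n) {..<n}"
  proof (rule inj_onI)
    fix p q assume pq: "p \<in> {..<n}" "q \<in> {..<n}" "rank f n p = rank f n q"
    then have "\<not> f p < f q" "\<not> f q < f p" using rank_less_iff[of p n q f] rank_less_iff[of q n p f] by auto
    then show "p = q" using assms pq by (meson inj_onD linorder_neqE_nat)
  qed
  ultimately have "rank f n ` {..<n} = {1..n}"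
    by (intro card_subset_eq) (auto simp: card_image)
  then show ?thesis using inj by (simp add: bij_betw_def)
qed

lemma rank_bij:
  assumes f: "bij_betw f {..<n} {1..n}" and p: "p < n"
  shows "rank f n p = f p"
proof -
  have fp: "f p \<in> {1..n}" using bij_betwE[OF f] p by simp
  have "f ` {q. q < n \<and> f q \<le> f p} = {1..f p}"
  proof (intro equalityI subsetI)
    fix k assume "k \<in> {1..f p}"
    then have "k \<in> f ` {..<n}" "k \<le> f p" using f fp by (auto simp: bij_betw_def)
    then show "k \<in> f ` {q. q < n \<and> f q \<le> f p}" by auto
  next
    fix k assume "k \<in> f ` {q. q < n \<and> f q \<le> f p}"
    then obtain q where "q < n" "k = f q" "f q \<le> f p" by auto
    then show "k \<in> {1..f p}" using bij_betwE[OF f, rule_format, of q] by auto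
  qed
  moreover have "inj_on f {q. q < n \<and> f q \<le> f p}"
    using f by (auto simp: bij_betw_def inj_on_def)
  ultimately show ?thesis unfolding rank_def by (metis card_atLeastAtMost card_image diff_Suc_1)
qed

text \<open>
  The column (or row) of an index, given the column (or row) dividers.
\<close>

definition strip :: "nat list \<Rightarrow> nat \<Rightarrow> nat" where
  "strip ds k = (LEAST i. k \<le> ds ! Suc i)"

lemma dividers_mono:
  assumes "dividers n t ds" "i \<le> i'" "i' \<le> t"
  shows "ds ! i \<le> ds ! i'" "ds ! i' \<le> n"
  using assms sorted_nth_mono[of ds i i'] sorted_nth_mono[of ds i' t] by (auto simp: dividers_def)

lemma strip:
  assumes ds: "dividers n t ds" and k: "k \<in> {1..n}"
  shows "strip ds k < t" "ds ! strip ds k < k" "k \<le> ds ! Suc (strip ds k)"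
proof -
  have "t > 0" using ds k by (cases t) (auto simp: dividers_def)
  then have ex: "k \<le> ds ! Suc (t - 1)" using ds k by (auto simp: dividers_def)
  show "k \<le> ds ! Suc (strip ds k)"
    unfolding strip_def by (rule LeastI[of "\<lambda>i. k \<le> ds ! Suc i", OF ex])
  have "strip ds k \<le> t - 1"
    unfolding strip_def by (rule Least_le[of "\<lambda>i. k \<le> ds ! Suc i", OF ex])
  then show "strip ds k < t" using \<open>t > 0\<close> by simp
  show "ds ! strip ds k < k"
  proof (cases "strip ds k")
    case 0
    then show ?thesis using ds k by (simp add: dividers_def)
  next
    case (Suc i)
    then have "\<not> k \<le> ds ! Suc i"
      using not_less_Least[of i "\<lambda>i. k \<le> ds ! Suc i"] by (simp add: strip_def)
    then show ?thesis using Suc by simp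
  qed
qed

lemma strip_less_iff:
  assumes ds: "dividers n t ds" and k: "k \<in> {1..n}" and i: "i \<le> t"
  shows "strip ds k < i \<longleftrightarrow> k \<le> ds ! i"
proof
  assume "strip ds k < i"
  then have "ds ! Suc (strip ds k) \<le> ds ! i" using dividers_mono(1)[OF ds] i by simp
  then show "k \<le> ds ! i" using strip(3)[OF ds k] by simp
next
  assume le: "k \<le> ds ! i"
  show "strip ds k < i"
  proof (rule ccontr)
    assume "\<not> strip ds k < i"
    then have "ds ! i \<le> ds ! strip ds k"
      using dividers_mono(1)[OF ds] strip(1)[OF ds k] by simp
    then show False using strip(2)[OF ds k] le by simp
  qed
qed

lemma strip_eq_iff:
  assumes ds: "dividers n t ds" and k: "k \<in> {1..n}" and i: "i < t"
  shows "strip ds k = i \<longleftrightarrow> ds ! i < k \<and> k \<le> ds ! Suc i"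
  using strip_less_iff[OF ds k, of i] strip_less_iff[OF ds k, of "Suc i"] i by auto

lemma strip_mono:
  assumes ds: "dividers n t ds" and k: "k \<in> {1..n}" "k' \<in> {1..n}" "k \<le> k'"
  shows "strip ds k \<le> strip ds k'"
  using strip_less_iff[OF ds k(1), of "Suc (strip ds k')"] strip[OF ds k(2)] k(3) by auto

lemma dividers_eqI:
  assumes ds: "dividers n t ds" and ds': "dividers n t ds'"
    and eq: "\<And>k. k \<in> {1..n} \<Longrightarrow> strip ds k = strip ds' k"
  shows "ds = ds'"
proof (rule nth_equalityI)
  show "length ds = length ds'" using ds ds' by (simp add: dividers_def)
  have below: "a \<le> b" if "\<And>k. k \<in> {1..n} \<Longrightarrow> k \<le> a \<Longrightarrow> k \<le> b" "a \<le> n" for a b :: nat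
    using that(1)[of a] that(2) by (cases "a = 0") auto
  fix i assume "i < length ds"
  then have i: "i \<le> t" using ds by (simp add: dividers_def)
  have iff: "k \<le> ds ! i \<longleftrightarrow> k \<le> ds' ! i" if "k \<in> {1..n}" for k
    using strip_less_iff[OF ds that i] strip_less_iff[OF ds' that i] eq[OF that] by simp
  have le: "ds ! i \<le> n" "ds' ! i \<le> n" using dividers_mono(2) ds ds' i by blast+
  have "ds ! i \<le> ds' ! i" by (rule below[OF _ le(1)]) (use iff in blast)
  moreover have "ds' ! i \<le> ds ! i" by (rule below[OF _ le(2)]) (use iff in blast)
  ultimately show "ds ! i = ds' ! i" by (rule antisym)
qed

text \<open>
  The inverse of \<open>strip\<close>: dividers correspond to weakly monotone maps from indices to
  columns.
\<close>

definition divide :: "nat \<Rightarrow> nat \<Rightarrow> (nat \<Rightarrow> nat) \<Rightarrow> nat list" where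
  "divide n t f = map (\<lambda>i. card {k \<in> {1..n}. f k < i}) [0..<Suc t]"

lemma divide:
  assumes less: "\<And>k. k \<in> {1..n} \<Longrightarrow> f k < t"
    and mono: "\<And>k k'. k \<in> {1..n} \<Longrightarrow> k' \<in> {1..n} \<Longrightarrow> k < k' \<Longrightarrow> f k \<le> f k'"
  shows "dividers n t (divide n t f)" "\<And>k. k \<in> {1..n} \<Longrightarrow> strip (divide n t f) k = f k"
proof -
  have nth: "divide n t f ! i = card {k \<in> {1..n}. f k < i}" if "i \<le> t" for i
    using that unfolding divide_def by (subst nth_map) (auto simp del: upt_Suc)
  have all: "{k \<in> {1..n}. f k < t} = {1..n}" using less by auto
  have "sorted (divide n t f)"
    unfolding divide_def sorted_map
    by (rule sorted_wrt_mono_rel[OF _ sorted_upt[of 0 "Suc t"]]) (auto intro!: card_mono)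
  then show ds: "dividers n t (divide n t f)"
    using nth[of 0] nth[of t] all by (auto simp: dividers_def divide_def simp del: upt_Suc)
  fix k assume k: "k \<in> {1..n}"
  have "{k' \<in> {1..n}. f k' < f k} \<subseteq> {1..<k}"
  proof
    fix k' assume "k' \<in> {k' \<in> {1..n}. f k' < f k}"
    then have "k' \<in> {1..n}" "f k' < f k" by auto
    then have "\<not> k < k'" "k' \<noteq> k" using mono[OF k, of k'] by auto
    then show "k' \<in> {1..<k}" using \<open>k' \<in> {1..n}\<close> by auto
  qed
  then have "card {k' \<in> {1..n}. f k' < f k} \<le> card {1..<k}" by (intro card_mono) auto
  then have "divide n t f ! f k < k" using nth[of "f k"] less[OF k] k by auto
  moreover have "{1..k} \<subseteq> {k' \<in> {1..n}. f k' < Suc (f k)}"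
  proof
    fix k' assume k': "k' \<in> {1..k}"
    then have "k' \<in> {1..n}" using k by auto
    then have "f k' \<le> f k" using mono[OF _ k, of k'] k' by (cases "k' = k") auto
    then show "k' \<in> {k' \<in> {1..n}. f k' < Suc (f k)}" using \<open>k' \<in> {1..n}\<close> by auto
  qed
  then have "card {1..k} \<le> card {k' \<in> {1..n}. f k' < Suc (f k)}" by (intro card_mono) auto
  then have "k \<le> divide n t f ! Suc (f k)" using nth[of "Suc (f k)"] less[OF k] by simp
  ultimately show "strip (divide n t f) k = f k" using strip_eq_iff[OF ds k less[OF k]] by simp
qed

lemma permutes_in: "\<sigma> permutes {1..n} \<Longrightarrow> k \<in> {1..n} \<Longrightarrow> \<sigma> k \<in> {1..n}"
  using permutes_in_image[of \<sigma> "{1..n}" k] by blast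

text \<open>
  The word order is taken to be the left-to-right order in the main column, hence the sign of
  that column.
\<close>

locale cross_matrix = cross r c j0 i0 sx sy
  for r c j0 i0 :: nat and sx sy :: "nat \<Rightarrow> bool" +
  fixes M :: gridding_matrix
  assumes rows: "dim_row M = Suc r" and cols: "dim_col M = Suc c"
    and entry: "j \<le> r \<Longrightarrow> i \<le> c \<Longrightarrow>
      M $$ (j, i) = (if (j, i) \<in> Z then if rising (j, i) then Increasing else Decreasing else Blank)"
    and sx_corner: "sx i0"
begin

definition cell_of :: "(nat \<Rightarrow> nat) \<Rightarrow> nat list \<Rightarrow> nat list \<Rightarrow> nat \<Rightarrow> nat \<times> nat" where
  "cell_of \<sigma> cs rs k = (strip rs (\<sigma> k), strip cs k)"

text \<open>
  A gridding is an assignment of cells to points, and its validity is a condition on pairs of points.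
\<close>

lemma is_gridding_iff:
  assumes \<sigma>: "\<sigma> permutes {1..n}" and cs: "dividers n (Suc c) cs" and rs: "dividers n (Suc r) rs"
  shows "is_gridding n M \<sigma> cs rs \<longleftrightarrow>
    (\<forall>k \<in> {1..n}. cell_of \<sigma> cs rs k \<in> Z) \<and>
    (\<forall>k \<in> {1..n}. \<forall>k' \<in> {1..n}. k < k' \<longrightarrow> cell_of \<sigma> cs rs k = cell_of \<sigma> cs rs k' \<longrightarrow>
       (\<sigma> k < \<sigma> k' \<longleftrightarrow> rising (cell_of \<sigma> cs rs k)))"
proof -
  let ?cell = "cell_of \<sigma> cs rs"
  have bounds: "fst (?cell k) \<le> r" "snd (?cell k) \<le> c" if "k \<in> {1..n}" for k
    using strip(1)[OF cs that] strip(1)[OF rs permutes_in[OF \<sigma> that]] by (auto simp: cell_of_def)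
  have indices: "cell_indices \<sigma> cs rs j i = {k \<in> {1..n}. ?cell k = (j, i)}" if ji: "j \<le> r" "i \<le> c" for j i
  proof -
    have "k \<in> {1..n}" if "k \<in> cell_indices \<sigma> cs rs j i" for k
      using that dividers_mono(2)[OF cs, of "Suc i" "Suc i"] ji by (auto simp: cell_indices_def)
    moreover have "k \<in> cell_indices \<sigma> cs rs j i \<longleftrightarrow> ?cell k = (j, i)" if "k \<in> {1..n}" for k
      using strip_eq_iff[OF cs that, of i] strip_eq_iff[OF rs permutes_in[OF \<sigma> that], of j] ji
      by (auto simp: cell_indices_def cell_of_def)
    ultimately show ?thesis by blast
  qed
  have ne: "\<sigma> k \<noteq> \<sigma> k'" if "k < k'" for k k'
    using permutes_inj[OF \<sigma>] that by (auto dest: injD)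
  have fits: "fits_cell (M $$ (j, i)) \<sigma> (cell_indices \<sigma> cs rs j i) \<longleftrightarrow>
      (\<forall>k \<in> {1..n}. ?cell k = (j, i) \<longrightarrow> (j, i) \<in> Z) \<and>
      (\<forall>k \<in> {1..n}. \<forall>k' \<in> {1..n}. k < k' \<longrightarrow> ?cell k = (j, i) \<longrightarrow> ?cell k' = (j, i) \<longrightarrow>
        (\<sigma> k < \<sigma> k' \<longleftrightarrow> rising (j, i)))" if ji: "j \<le> r" "i \<le> c" for j i
  proof (cases "(j, i) \<in> Z")
    case False
    then show ?thesis using entry[OF ji] indices[OF ji] by auto
  next
    case True
    show ?thesis
    proof (cases "rising (j, i)")
      case r: True
      then show ?thesis using entry[OF ji] indices[OF ji] True by (auto simp: monotone_on_def)
    next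
      case r: False
      have "strict_antimono_on K \<sigma> \<longleftrightarrow> (\<forall>k \<in> K. \<forall>k' \<in> K. k < k' \<longrightarrow> \<not> \<sigma> k < \<sigma> k')" for K
      proof -
        have "\<sigma> k > \<sigma> k' \<longleftrightarrow> \<not> \<sigma> k < \<sigma> k'" if "k < k'" for k k'
          using ne[OF that] by (simp add: not_less order.order_iff_strict)
        then show ?thesis unfolding monotone_on_def by blast
      qed
      then have "fits_cell (M $$ (j, i)) \<sigma> (cell_indices \<sigma> cs rs j i) \<longleftrightarrow>
          (\<forall>k \<in> cell_indices \<sigma> cs rs j i. \<forall>k' \<in> cell_indices \<sigma> cs rs j i. k < k' \<longrightarrow> \<not> \<sigma> k < \<sigma> k')"
        using entry[OF ji] True r by simp
      then show ?thesis unfolding indices[OF ji] using True r by blast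
    qed
  qed
  have "is_gridding n M \<sigma> cs rs \<longleftrightarrow>
      (\<forall>i \<le> c. \<forall>j \<le> r. fits_cell (M $$ (j, i)) \<sigma> (cell_indices \<sigma> cs rs j i))"
    using cs rs by (simp add: is_gridding_def rows cols less_Suc_eq_le)
  also have "\<dots> \<longleftrightarrow> (\<forall>k \<in> {1..n}. ?cell k \<in> Z) \<and>
    (\<forall>k \<in> {1..n}. \<forall>k' \<in> {1..n}. k < k' \<longrightarrow> ?cell k = ?cell k' \<longrightarrow> (\<sigma> k < \<sigma> k' \<longleftrightarrow> rising (?cell k)))"
    (is "?L \<longleftrightarrow> ?R1 \<and> ?R2")
  proof
    assume L: ?L
    have "?cell k \<in> Z" if "k \<in> {1..n}" for k
      using L[rule_format, OF bounds(2)[OF that] bounds(1)[OF that]] fits[OF bounds(1,2)[OF that]] that by auto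
    moreover have "\<sigma> k < \<sigma> k' \<longleftrightarrow> rising (?cell k)"
      if k: "k \<in> {1..n}" "k' \<in> {1..n}" "k < k'" "?cell k = ?cell k'" for k k'
      using L[rule_format, OF bounds(2)[OF k(1)] bounds(1)[OF k(1)]] fits[OF bounds(1,2)[OF k(1)]] k by auto
    ultimately show "?R1 \<and> ?R2" by blast
  next
    assume R: "?R1 \<and> ?R2"
    show ?L
    proof (intro allI impI)
      fix i j assume "i \<le> c" "j \<le> r"
      then show "fits_cell (M $$ (j, i)) \<sigma> (cell_indices \<sigma> cs rs j i)"
        unfolding fits[OF \<open>j \<le> r\<close> \<open>i \<le> c\<close>] using R by (metis (no_types, lifting))
    qed
  qed
  finally show ?thesis .
qed

text \<open>
  Sorting positions by this key sorts them lexicographically, first by column (or row) and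
  then by position or reversed position, according to the sign.
\<close>

definition lex_key :: "(nat \<times> nat \<Rightarrow> nat) \<Rightarrow> (nat \<Rightarrow> bool) \<Rightarrow> (nat \<times> nat) list \<Rightarrow> nat \<Rightarrow> nat" where
  "lex_key f s w p = f (w ! p) * length w + (if s (f (w ! p)) then p else length w - Suc p)"

text \<open>
  Horizontal and vertical coordinates of the point at a position of the word.
\<close>

definition X :: "(nat \<times> nat) list \<Rightarrow> nat \<Rightarrow> nat" where
  "X w = rank (lex_key snd sx w) (length w)"

definition Y :: "(nat \<times> nat) list \<Rightarrow> nat \<Rightarrow> nat" where
  "Y w = rank (lex_key fst sy w) (length w)"

lemma lex_less:
  fixes a b s t n :: nat
  assumes "a < b" "s < n"
  shows "a * n + s < b * n + t"
proof -
  have "a * n + s < Suc a * n" using assms(2) by simp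
  also have "\<dots> \<le> b * n" using assms(1) by (intro mult_le_mono1) simp
  finally show ?thesis by simp
qed

lemma lex_key_less:
  assumes "p < q" "q < length w"
  shows "if f (w ! p) < f (w ! q) \<or> f (w ! p) = f (w ! q) \<and> s (f (w ! p))
    then lex_key f s w p < lex_key f s w q else lex_key f s w q < lex_key f s w p"
proof -
  consider "f (w ! p) < f (w ! q)" | "f (w ! q) < f (w ! p)" | "f (w ! p) = f (w ! q)"
    by linarith
  then show ?thesis
  proof cases
    case 1
    then have "lex_key f s w p < lex_key f s w q"
      unfolding lex_key_def using assms by (intro lex_less) auto
    then show ?thesis using 1 by simp
  next
    case 2
    then have "lex_key f s w q < lex_key f s w p"
      unfolding lex_key_def using assms by (intro lex_less) auto
    then show ?thesis using 2 by simp
  next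
    case 3
    then show ?thesis using assms by (auto simp: lex_key_def)
  qed
qed

lemma inj_lex_key: "inj_on (lex_key f s w) {..<length w}"
  using lex_key_less[of _ _ w f s] by (intro linorder_inj_onI) (fastforce split: if_splits)+

lemmas x_key_less = lex_key_less[where f = snd and s = sx, folded x_less_def]
  and y_key_less = lex_key_less[where f = fst and s = sy, folded y_less_def]

lemma bij_X: "bij_betw (X w) {..<length w} {1..length w}"
  unfolding X_def using inj_lex_key by (rule bij_betw_rank)

lemma bij_Y: "bij_betw (Y w) {..<length w} {1..length w}"
  unfolding Y_def using inj_lex_key by (rule bij_betw_rank)

lemma X_surj: "k \<in> {1..length w} \<Longrightarrow> \<exists>p < length w. k = X w p"
  using bij_betw_imp_surj_on[OF bij_X, of w] by (metis imageE lessThan_iff)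

lemma Y_surj: "k \<in> {1..length w} \<Longrightarrow> \<exists>p < length w. k = Y w p"
  using bij_betw_imp_surj_on[OF bij_Y, of w] by (metis imageE lessThan_iff)

lemma X_less:
  assumes "p < q" "q < length w"
  shows "X w p < X w q \<longleftrightarrow> x_less (w ! p) (w ! q)" "X w q < X w p \<longleftrightarrow> \<not> x_less (w ! p) (w ! q)"
  using x_key_less[OF assms] assms rank_less_iff[of p "length w" q] rank_less_iff[of q "length w" p]
  by (auto simp: X_def split: if_splits)

lemma Y_less:
  assumes "p < q" "q < length w"
  shows "Y w p < Y w q \<longleftrightarrow> y_less (w ! p) (w ! q)" "Y w q < Y w p \<longleftrightarrow> \<not> y_less (w ! p) (w ! q)"
  using y_key_less[OF assms] assms rank_less_iff[of p "length w" q] rank_less_iff[of q "length w" p]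
  by (auto simp: Y_def split: if_splits)

definition perm_of :: "(nat \<times> nat) list \<Rightarrow> nat \<Rightarrow> nat" where
  "perm_of w k = (if k \<in> {1..length w} then Y w (inv_into {..<length w} (X w) k) else k)"

lemma perm_of_X: "p < length w \<Longrightarrow> perm_of w (X w p) = Y w p"
  using bij_betwE[OF bij_X] bij_betw_inv_into_left[OF bij_X]
  by (auto simp: perm_of_def)

lemma perm_of_permutes: "perm_of w permutes {1..length w}"
proof (rule bij_imp_permutes)
  have "bij_betw (Y w \<circ> inv_into {..<length w} (X w)) {1..length w} {1..length w}"
    using bij_betw_inv_into[OF bij_X] bij_Y by (rule bij_betw_trans)
  then show "bij_betw (perm_of w) {1..length w} {1..length w}"
    by (rule bij_betw_cong[THEN iffD1, rotated]) (simp add: perm_of_def)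
qed (simp only: perm_of_def if_False)

definition griddings :: "nat \<Rightarrow> (nat \<Rightarrow> nat) \<Rightarrow> (nat list \<times> nat list) set" where
  "griddings n \<sigma> = {(cs, rs). is_gridding n M \<sigma> cs rs}"

lemma griddings_dividers:
  "(cs, rs) \<in> griddings n \<sigma> \<Longrightarrow> dividers n (Suc c) cs \<and> dividers n (Suc r) rs"
  by (simp add: griddings_def is_gridding_def rows cols)

definition relabel :: "(nat \<times> nat) list \<Rightarrow> nat list \<times> nat list \<Rightarrow> ((nat \<times> nat) \<times> (nat \<times> nat)) list" where
  "relabel w = (\<lambda>(cs, rs). map (\<lambda>p. (w ! p, (strip rs (Y w p), strip cs (X w p)))) [0..<length w])"

lemma inj_on_relabel: "inj_on (relabel w) (griddings (length w) (perm_of w))"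
proof (rule inj_onI)
  let ?n = "length w"
  fix g g' assume g: "g \<in> griddings ?n (perm_of w)" "g' \<in> griddings ?n (perm_of w)"
    and eq: "relabel w g = relabel w g'"
  obtain cs rs cs' rs' where gg: "g = (cs, rs)" "g' = (cs', rs')" by (cases g, cases g')
  have d: "dividers ?n (Suc c) cs" "dividers ?n (Suc r) rs" "dividers ?n (Suc c) cs'" "dividers ?n (Suc r) rs'"
    using g griddings_dividers unfolding gg by blast+
  have lab: "strip rs (Y w p) = strip rs' (Y w p)" "strip cs (X w p) = strip cs' (X w p)" if "p < ?n" for p
    using arg_cong[OF eq, of "\<lambda>z. z ! p"] that unfolding gg relabel_def by simp_all
  have "cs = cs'"
  proof (rule dividers_eqI[OF d(1,3)])
    fix k assume "k \<in> {1..?n}"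
    then obtain p where "p < ?n" "k = X w p" using X_surj by blast
    then show "strip cs k = strip cs' k" using lab by simp
  qed
  moreover have "rs = rs'"
  proof (rule dividers_eqI[OF d(2,4)])
    fix k assume "k \<in> {1..?n}"
    then obtain p where "p < ?n" "k = Y w p" using Y_surj by blast
    then show "strip rs k = strip rs' k" using lab by simp
  qed
  ultimately show "g = g'" by (simp add: gg)
qed

lemma relabel_in_relabelings:
  assumes g: "(cs, rs) \<in> griddings (length w) (perm_of w)"
  shows "relabel w (cs, rs) \<in> relabelings w"
proof -
  let ?n = "length w" and ?cell = "cell_of (perm_of w) cs rs"
  have d: "dividers ?n (Suc c) cs" "dividers ?n (Suc r) rs" using griddings_dividers[OF g] by auto
  have "is_gridding ?n M (perm_of w) cs rs" using g by (simp add: griddings_def)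
  then have Z: "\<And>k. k \<in> {1..?n} \<Longrightarrow> ?cell k \<in> Z"
    and mono: "\<And>k k'. k \<in> {1..?n} \<Longrightarrow> k' \<in> {1..?n} \<Longrightarrow> k < k' \<Longrightarrow> ?cell k = ?cell k' \<Longrightarrow>
       perm_of w k < perm_of w k' \<longleftrightarrow> rising (?cell k)"
    unfolding is_gridding_iff[OF perm_of_permutes d] by blast+
  have lab: "(strip rs (Y w p), strip cs (X w p)) = ?cell (X w p)" if "p < ?n" for p
    using that by (simp add: cell_of_def perm_of_X)
  have XY: "X w p \<in> {1..?n}" "Y w p \<in> {1..?n}" if "p < ?n" for p
    using that bij_betwE[OF bij_X] bij_betwE[OF bij_Y] by auto
  have "compat (w ! p, (strip rs (Y w p), strip cs (X w p))) (w ! q, (strip rs (Y w q), strip cs (X w q)))"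
    if pq: "p < q" "q < ?n" for p q
  proof -
    have p: "p < ?n" using pq by simp
    note less = X_less[OF pq] Y_less[OF pq]
    have "if x_less (w ! p) (w ! q) then strip cs (X w p) \<le> strip cs (X w q) else strip cs (X w q) \<le> strip cs (X w p)"
      using less strip_mono[OF d(1)] XY[OF p] XY[OF pq(2)] by (auto simp: less_imp_le)
    moreover have "if y_less (w ! p) (w ! q) then strip rs (Y w p) \<le> strip rs (Y w q) else strip rs (Y w q) \<le> strip rs (Y w p)"
      using less strip_mono[OF d(2)] XY[OF p] XY[OF pq(2)] by (auto simp: less_imp_le)
    moreover have "(x_less (w ! p) (w ! q) = y_less (w ! p) (w ! q)) = rising (?cell (X w p))"
      if eq: "?cell (X w p) = ?cell (X w q)"
    proof (cases "x_less (w ! p) (w ! q)")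
      case True
      then show ?thesis
        using mono[OF XY(1)[OF p] XY(1)[OF pq(2)] _ eq] less perm_of_X p pq by simp
    next
      case False
      then show ?thesis
        using mono[OF XY(1)[OF pq(2)] XY(1)[OF p] _ eq[symmetric]] less perm_of_X p pq eq by simp
    qed
    ultimately show ?thesis
      unfolding compat.simps lab[OF p, symmetric] lab[OF pq(2), symmetric] by simp
  qed
  then have "sorted_wrt compat (relabel w (cs, rs))"
    by (simp add: sorted_wrt_iff_nth_less relabel_def)
  moreover have "map fst (relabel w (cs, rs)) = w" by (simp add: relabel_def o_def map_nth)
  moreover have "snd ` set (relabel w (cs, rs)) \<subseteq> Z"
    using Z XY lab by (auto simp: relabel_def)
  ultimately show ?thesis by (simp add: relabelings_def)
qed

lemma relabeling_gridding:
  assumes z: "z \<in> relabelings w"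
  obtains cs rs where "(cs, rs) \<in> griddings (length w) (perm_of w)" "relabel w (cs, rs) = z"
proof -
  let ?n = "length w"
  have zw: "map fst z = w" "snd ` set z \<subseteq> Z" "sorted_wrt compat z" using z by (auto simp: relabelings_def)
  have len: "length z = ?n" using arg_cong[OF zw(1), of length] by simp
  define l where "l p = snd (z ! p)" for p
  have zp: "z ! p = (w ! p, l p)" if "p < ?n" for p
    using that zw(1) len unfolding l_def by (metis nth_map prod.collapse)
  have lZ: "l p \<in> Z" if "p < ?n" for p using that zw(2) len by (auto simp: l_def image_subset_iff)
  have comp: "compat (w ! p, l p) (w ! q, l q)" if "p < q" "q < ?n" for p q
    using sorted_wrt_nth_less[OF zw(3), of p q] that len zp by simp
  have XX: "snd (l p) \<le> snd (l q)" if "p < ?n" "q < ?n" "X w p < X w q" for p q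
  proof (cases "p < q")
    case True
    then show ?thesis using comp[of p q] X_less[of p q w] that by (simp add: compat.simps)
  next
    case False
    then have "q < p" using that by (cases "p = q") auto
    then show ?thesis using comp[of q p] X_less[of q p w] that by (simp add: compat.simps)
  qed
  have YY: "fst (l p) \<le> fst (l q)" if "p < ?n" "q < ?n" "Y w p < Y w q" for p q
  proof (cases "p < q")
    case True
    then show ?thesis using comp[of p q] Y_less[of p q w] that by (simp add: compat.simps)
  next
    case False
    then have "q < p" using that by (cases "p = q") auto
    then show ?thesis using comp[of q p] Y_less[of q p w] that by (simp add: compat.simps)
  qed
  have turn: "Y w p < Y w q \<longleftrightarrow> rising (l p)" if "p < ?n" "q < ?n" "X w p < X w q" "l p = l q" for p q
  proof (cases "p < q")
    case True
    then show ?thesis using comp[of p q] X_less[of p q w] Y_less[of p q w] that by (auto simp: compat.simps)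
  next
    case False
    then have "q < p" using that by (cases "p = q") auto
    then show ?thesis using comp[of q p] X_less[of q p w] Y_less[of q p w] that by (auto simp: compat.simps)
  qed
  let ?ix = "inv_into {..<?n} (X w)" and ?iy = "inv_into {..<?n} (Y w)"
  have ix: "?ix k < ?n" "X w (?ix k) = k" and iy: "?iy k < ?n" "Y w (?iy k) = k" if "k \<in> {1..?n}" for k
    using that bij_X[of w] bij_Y[of w] inv_into_into[of k _ "{..<?n}"]
    by (auto simp: bij_betw_def f_inv_into_f)
  have iX: "?ix (X w p) = p" and iY: "?iy (Y w p) = p" if "p < ?n" for p
    using that bij_betw_inv_into_left[OF bij_X] bij_betw_inv_into_left[OF bij_Y] by auto
  define cs where "cs = divide ?n (Suc c) (\<lambda>k. snd (l (?ix k)))"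
  define rs where "rs = divide ?n (Suc r) (\<lambda>k. fst (l (?iy k)))"
  have c: "dividers ?n (Suc c) cs" "\<And>k. k \<in> {1..?n} \<Longrightarrow> strip cs k = snd (l (?ix k))"
    unfolding cs_def
    by (rule divide; use lZ ix XX in \<open>force simp: Z_def less_Suc_eq_le\<close>)+
  have r: "dividers ?n (Suc r) rs" "\<And>k. k \<in> {1..?n} \<Longrightarrow> strip rs k = fst (l (?iy k))"
    unfolding rs_def
    by (rule divide; use lZ iy YY in \<open>force simp: Z_def less_Suc_eq_le\<close>)+
  have XY: "X w p \<in> {1..?n}" "Y w p \<in> {1..?n}" if "p < ?n" for p
    using that bij_betwE[OF bij_X] bij_betwE[OF bij_Y] by auto
  have lab: "(strip rs (Y w p), strip cs (X w p)) = l p" if "p < ?n" for p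
    using c(2)[OF XY(1)] r(2)[OF XY(2)] iX iY that by simp
  have cell: "cell_of (perm_of w) cs rs (X w p) = l p" if "p < ?n" for p
    using lab[OF that] that by (simp add: cell_of_def perm_of_X)
  have "is_gridding ?n M (perm_of w) cs rs"
    unfolding is_gridding_iff[OF perm_of_permutes c(1) r(1)]
  proof (intro conjI ballI impI)
    fix k assume "k \<in> {1..?n}"
    then show "cell_of (perm_of w) cs rs k \<in> Z" using cell[of "?ix k"] ix lZ by simp
  next
    fix k k' assume k: "k \<in> {1..?n}" "k' \<in> {1..?n}" "k < k'"
      and eq: "cell_of (perm_of w) cs rs k = cell_of (perm_of w) cs rs k'"
    have "l (?ix k) = l (?ix k')" using eq cell[of "?ix k"] cell[of "?ix k'"] ix k by simp
    then show "perm_of w k < perm_of w k' \<longleftrightarrow> rising (cell_of (perm_of w) cs rs k)"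
      using turn[of "?ix k" "?ix k'"] cell[of "?ix k"] perm_of_X[of "?ix k" w] perm_of_X[of "?ix k'" w] ix k
      by simp
  qed
  moreover have "relabel w (cs, rs) = z"
    using len zp lab by (intro nth_equalityI) (auto simp: relabel_def)
  ultimately show thesis by (intro that) (auto simp: griddings_def)
qed

text \<open>
  The pairwise conditions on the two sides are translated by \<open>X_less\<close> and \<open>Y_less\<close>.
\<close>

lemma bij_relabel: "bij_betw (relabel w) (griddings (length w) (perm_of w)) (relabelings w)"
  unfolding bij_betw_def
proof
  show "relabel w ` griddings (length w) (perm_of w) = relabelings w"
  proof (intro equalityI subsetI)
    fix z assume "z \<in> relabel w ` griddings (length w) (perm_of w)"
    then obtain g where "g \<in> griddings (length w) (perm_of w)" "z = relabel w g" by blast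
    then show "z \<in> relabelings w" using relabel_in_relabelings by (cases g) simp
  next
    fix z assume "z \<in> relabelings w"
    then obtain cs rs where "(cs, rs) \<in> griddings (length w) (perm_of w)" "relabel w (cs, rs) = z"
      by (rule relabeling_gridding)
    then show "z \<in> relabel w ` griddings (length w) (perm_of w)" by (metis imageI)
  qed
qed (rule inj_on_relabel)

lemma card_griddings: "card (griddings (length w) (perm_of w)) = card (relabelings w)"
  using bij_relabel by (rule bij_betw_same_card)

end

section \<open>Gridded permutations as normal words\<close>

lemma (in commuting_words) normal_between:
  assumes w: "normal w" and pq: "p < q" "q < length w" and "w ! p \<in> V" "w ! q \<in> H"
  obtains s where "p < s" "s < q" "w ! s = k"
proof -
  define s where "s = (LEAST s. p < s \<and> w ! s \<notin> V)"
  have q: "p < q \<and> w ! q \<notin> V" using assms H_V by auto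
  have s: "p < s \<and> w ! s \<notin> V" unfolding s_def by (rule LeastI[of _ q]) (rule q)
  have s_q: "s \<le> q" unfolding s_def by (rule Least_le) (rule q)
  obtain t where t: "s = Suc t" using s by (cases s) auto
  have "w ! t \<in> V"
  proof (cases "t = p")
    case False
    then show ?thesis using not_less_Least[of t "\<lambda>s. p < s \<and> w ! s \<notin> V"] s t by (auto simp: s_def)
  qed (use assms in simp)
  then have "w ! s \<notin> H"
    using w s_q pq(2) t successively_nth[of _ w t] unfolding normal_def by fastforce
  moreover have "w ! s \<in> letters" using w s_q pq(2) by (auto simp: normal_def)
  ultimately have "w ! s = k" using s by (auto simp: letters_def)
  then show thesis using s s_q that[of s] \<open>w ! s \<notin> H\<close> assms(5) by (cases "s = q") auto
qed

lemma bij_less_imp_id: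
  fixes h :: "nat \<Rightarrow> nat"
  assumes bij: "bij_betw h {..<n} {..<n}" and mono: "\<And>p q. p < q \<Longrightarrow> q < n \<Longrightarrow> h p < h q" and p: "p < n"
  shows "h p = p"
proof (rule strict_mono_on_atMost_id[of "n - 1" h])
  show "h j < h j'" if "j < j'" "j' \<le> n - 1" for j j' using mono that p by simp
  show "h j \<le> n - 1" if "j \<le> n - 1" for j
  proof -
    have "h j \<in> {..<n}" using bij_betwE[OF bij] that p by simp
    then show ?thesis by simp
  qed
  show "p \<le> n - 1" using p by simp
qed

text \<open>
  If a letter of \<open>V\<close> precedes a letter of \<open>H\<close> in a normal word, then there is a \<open>k\<close> between them. Since \<open>h\<close> preserves the order of
  either letter relative to \<open>k\<close>, it preserves their order, too.
\<close>

lemma (in commuting_words) normal_word_unique: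
  assumes w: "normal w" and w': "normal w'" and len: "length w = n" "length w' = n"
    and h: "bij_betw h {..<n} {..<n}" and eq: "\<And>p. p < n \<Longrightarrow> w' ! h p = w ! p"
    and mono: "\<And>p q. p < q \<Longrightarrow> q < n \<Longrightarrow>
      {w ! p, w ! q} \<subseteq> insert k V \<or> {w ! p, w ! q} \<subseteq> insert k H \<Longrightarrow> h p < h q"
  shows "w = w'"
proof -
  have h_less: "h p < n" if "p < n" for p using bij_betwE[OF h] that by auto
  have letter: "w ! p \<in> insert k (H \<union> V)" if "p < n" for p
  proof -
    have "w ! p \<in> set w" using that len by simp
    then show ?thesis using w unfolding normal_def letters_def by blast
  qed
  have h_inj: "h p \<noteq> h q" if "p < q" "q < n" for p q
    using h that by (auto simp: bij_betw_def inj_on_def)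
  have mono': "p < q" if "p < n" "q < n" "h p < h q"
      "{w ! p, w ! q} \<subseteq> insert k V \<or> {w ! p, w ! q} \<subseteq> insert k H" for p q
    using mono[of q p] that by (cases p q rule: linorder_cases) (auto simp: insert_commute)
  have "h p < h q" if pq: "p < q" "q < n" for p q
  proof (rule ccontr)
    assume "\<not> h p < h q"
    then have less: "h q < h p" using h_inj[OF pq] by simp
    have p: "p < n" using pq by simp
    from mono[OF pq] less have "\<not> {w ! p, w ! q} \<subseteq> insert k V" "\<not> {w ! p, w ! q} \<subseteq> insert k H" by auto
    then consider "w ! p \<in> H" "w ! q \<in> V" | "w ! p \<in> V" "w ! q \<in> H"
      using letter[OF p] letter[OF pq(2)] by auto
    then show False
    proof cases
      case 1
      then obtain s' where s': "h q < s'" "s' < h p" "w' ! s' = k"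
        using normal_between[OF w' less] eq[OF p] eq[OF pq(2)] h_less[OF p] len by auto
      then have "s' \<in> h ` {..<n}" using h h_less[OF p] by (auto simp: bij_betw_def)
      then obtain s where s: "s < n" "h s = s'" by auto
      then have "w ! s = k" using eq[OF s(1)] s'(3) by simp
      then have "q < s" "s < p" using mono'[of q s] mono'[of s p] s s' 1 p pq by auto
      then show False using pq by simp
    next
      case 2
      then obtain s where s: "p < s" "s < q" "w ! s = k"
        using normal_between[OF w pq(1)] pq(2) len by auto
      then have "h p < h s" "h s < h q" using mono[of p s] mono[of s q] 2 pq by auto
      then show False using less by simp
    qed
  qed
  then have "h p = p" if "p < n" for p using bij_less_imp_id[OF h _ that] by blast
  then show ?thesis using eq len by (intro nth_equalityI) auto
qed

lemma enumerate_by_key: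
  fixes key :: "nat \<Rightarrow> nat"
  assumes "inj_on key {1..n}"
  obtains e where "bij_betw e {..<n} {1..n}" "\<And>p q. p < q \<Longrightarrow> q < n \<Longrightarrow> key (e p) < key (e q)"
proof -
  define xs where "xs = sort_key key [1..<Suc n]"
  have set: "set xs = {1..n}" by (auto simp: xs_def)
  have dist: "distinct xs" by (simp add: xs_def)
  have len: "length xs = n" by (simp add: xs_def)
  have "sorted_wrt (<) (map key xs)"
    unfolding strict_sorted_iff using assms set dist by (simp add: distinct_map xs_def)
  then have "key (xs ! p) < key (xs ! q)" if "p < q" "q < n" for p q
    using that len by (auto simp: sorted_wrt_iff_nth_less)
  moreover have "bij_betw ((!) xs) {..<n} {1..n}" using bij_betw_nth[OF dist] len set by simp
  ultimately show thesis by (rule that[rotated])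
qed

context cross_matrix
begin

text \<open>
  The gridding is the one in which every point keeps the cell that is its letter.
\<close>

definition gridded_of :: "(nat \<times> nat) list \<Rightarrow> (nat \<Rightarrow> nat) \<times> nat list \<times> nat list" where
  "gridded_of w = (perm_of w, inv_into (griddings (length w) (perm_of w)) (relabel w) (map (\<lambda>a. (a, a)) w))"

lemma Words_Z: "w \<in> Words n \<Longrightarrow> length w = n \<and> set w \<subseteq> Z \<and> normal w"
  by (auto simp: Words_def normal_def letters_eq)

lemma gridded_of:
  assumes "set w \<subseteq> Z"
  obtains cs rs where "gridded_of w = (perm_of w, cs, rs)" "(cs, rs) \<in> griddings (length w) (perm_of w)"
    "\<And>p. p < length w \<Longrightarrow> strip rs (Y w p) = fst (w ! p) \<and> strip cs (X w p) = snd (w ! p)"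
proof -
  obtain cs rs where g: "inv_into (griddings (length w) (perm_of w)) (relabel w) (map (\<lambda>a. (a, a)) w) = (cs, rs)"
    by fastforce
  have id: "map (\<lambda>a. (a, a)) w \<in> relabel w ` griddings (length w) (perm_of w)"
    using bij_relabel[of w] identity_relabeling[OF assms] by (simp add: bij_betw_def)
  have "(cs, rs) \<in> griddings (length w) (perm_of w)" using inv_into_into[OF id] g by simp
  moreover have rel: "relabel w (cs, rs) = map (\<lambda>a. (a, a)) w" using f_inv_into_f[OF id] g by simp
  have "strip rs (Y w p) = fst (w ! p) \<and> strip cs (X w p) = snd (w ! p)" if "p < length w" for p
    using arg_cong[OF rel, of "\<lambda>z. snd (z ! p)"] that by (auto simp: relabel_def prod_eq_iff)
  moreover have "gridded_of w = (perm_of w, cs, rs)" using g by (simp add: gridded_of_def)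
  ultimately show thesis using that by blast
qed

text \<open>
  Two words of the same gridded permutation differ by a bijection of positions that preserves the
  horizontal order in the main column and the vertical order in the main row.
\<close>

lemma inj_on_gridded_of: "inj_on gridded_of (Words n)"
proof (rule inj_onI)
  fix w w' assume "w \<in> Words n" "w' \<in> Words n" and eq: "gridded_of w = gridded_of w'"
  then have w: "length w = n" "set w \<subseteq> Z" "normal w" and w': "length w' = n" "set w' \<subseteq> Z" "normal w'"
    using Words_Z by auto
  obtain cs rs where g: "gridded_of w = (perm_of w, cs, rs)"
    "\<And>p. p < n \<Longrightarrow> strip rs (Y w p) = fst (w ! p) \<and> strip cs (X w p) = snd (w ! p)"
    using gridded_of[OF w(2)] w(1) by metis
  obtain cs' rs' where g': "gridded_of w' = (perm_of w', cs', rs')"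
    "\<And>p. p < n \<Longrightarrow> strip rs' (Y w' p) = fst (w' ! p) \<and> strip cs' (X w' p) = snd (w' ! p)"
    using gridded_of[OF w'(2)] w'(1) by metis
  have same: "perm_of w = perm_of w'" "cs = cs'" "rs = rs'" using eq g(1) g'(1) by auto
  define h where "h = inv_into {..<n} (X w') \<circ> X w"
  have bX: "bij_betw (X w) {..<n} {1..n}" "bij_betw (X w') {..<n} {1..n}"
    using bij_X[of w] bij_X[of w'] w w' by auto
  have h: "bij_betw h {..<n} {..<n}"
    unfolding h_def using bX(1) bij_betw_inv_into[OF bX(2)] by (rule bij_betw_trans)
  have h_less: "h p < n" if "p < n" for p using bij_betwE[OF h] that by auto
  have Xh: "X w' (h p) = X w p" if "p < n" for p
    using bij_betw_inv_into_right[OF bX(2)] bij_betwE[OF bX(1)] that by (simp add: h_def)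
  have Yh: "Y w' (h p) = Y w p" if "p < n" for p
    using Xh[OF that] perm_of_X[of p w] perm_of_X[of "h p" w'] same(1) that h_less[OF that] w w' by simp
  have letter: "w' ! h p = w ! p" if "p < n" for p
    using g(2)[OF that] g'(2)[OF h_less[OF that]] Xh[OF that] Yh[OF that] same by (simp add: prod_eq_iff)
  show "w = w'"
  proof (rule normal_word_unique[OF w(3) w'(3) w(1) w'(1) h letter])
    fix p q assume pq: "p < q" "q < n"
      and line: "{w ! p, w ! q} \<subseteq> insert (j0, i0) col_cells \<or> {w ! p, w ! q} \<subseteq> insert (j0, i0) row_cells"
    have p: "p < n" using pq by simp
    have ne: "h p \<noteq> h q" using h pq by (auto simp: bij_betw_def inj_on_def)
    show "h p < h q"
    proof (rule ccontr)
      assume "\<not> h p < h q"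
      then have less: "h q < h p" using ne by simp
      note x = X_less[OF pq(1), of w] X_less[OF less, of w'] 
      note y = Y_less[OF pq(1), of w] Y_less[OF less, of w']
      from line show False
      proof
        assume "{w ! p, w ! q} \<subseteq> insert (j0, i0) col_cells"
        then have "snd (w ! p) = i0" "snd (w ! q) = i0" by (auto simp: col_cells_def)
        then show False
          using x pq p w w' h_less letter Xh sx_corner by (auto simp: x_less_def)
      next
        assume "{w ! p, w ! q} \<subseteq> insert (j0, i0) row_cells"
        then have "fst (w ! p) = j0" "fst (w ! q) = j0" by (auto simp: row_cells_def)
        then show False
          using y pq p w w' h_less letter Yh by (auto simp: y_less_def)
      qed
    qed
  qed
qed

lemma Gridded_eq: "Gridded n M = {(\<sigma>, g). \<sigma> permutes {1..n} \<and> g \<in> griddings n \<sigma>}"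
  by (auto simp: Gridded_def griddings_def)

lemma gridded_of_in_Gridded:
  assumes "w \<in> Words n"
  shows "gridded_of w \<in> Gridded n M"
  using assms Words_Z[of w n] gridded_of[of w] perm_of_permutes[of w] unfolding Gridded_eq
  by (metis (mono_tags, lifting) case_prodI mem_Collect_eq)

text \<open>
  The points are sorted by a key whose leading part \<open>T\<close> is the number of corner points
  before the given point, in the horizontal order of the main column or the vertical order of the main row.
  Among the points with the same \<open>T\<close>, those of the row come first, then those of the column, and
  the corner point comes last; this makes the word normal.
\<close>

lemma Gridded_has_word:
  assumes "(\<sigma>, cs, rs) \<in> Gridded n M"
  obtains w where "w \<in> Words n" "gridded_of w = (\<sigma>, cs, rs)"
proof -
  let ?cell = "cell_of \<sigma> cs rs" and ?N = "{1..n}"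
  have \<sigma>: "\<sigma> permutes ?N" and g: "(cs, rs) \<in> griddings n \<sigma>" using assms by (auto simp: Gridded_eq)
  then have d: "dividers n (Suc c) cs" "dividers n (Suc r) rs" using griddings_dividers by blast+
  have "is_gridding n M \<sigma> cs rs" using g by (simp add: griddings_def)
  then have Z: "\<And>k. k \<in> ?N \<Longrightarrow> ?cell k \<in> Z"
    and turn: "\<And>k k'. k \<in> ?N \<Longrightarrow> k' \<in> ?N \<Longrightarrow> k < k' \<Longrightarrow> ?cell k = ?cell k' \<Longrightarrow>
       \<sigma> k < \<sigma> k' \<longleftrightarrow> rising (?cell k)"
    unfolding is_gridding_iff[OF \<sigma> d] by blast+
  have \<sigma>_in: "\<sigma> k \<in> ?N" if "k \<in> ?N" for k using permutes_in[OF \<sigma> that] .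
  have \<sigma>_ne: "\<sigma> k \<noteq> \<sigma> k'" if "k \<noteq> k'" for k k' using permutes_inj[OF \<sigma>] that by (auto dest: injD)
  \<comment> \<open>The vertical coordinate, reversed if the main row has negative sign, so that it agrees with the
    horizontal order on the corner points.\<close>
  define val where "val k = (if sy j0 then \<sigma> k else n - \<sigma> k)" for k
  have val_less: "val k < val k' \<longleftrightarrow> (\<sigma> k < \<sigma> k' \<longleftrightarrow> sy j0)" if "k \<in> ?N" "k' \<in> ?N" "k \<noteq> k'" for k k'
    using \<sigma>_in[OF that(1)] \<sigma>_in[OF that(2)] \<sigma>_ne[OF that(3)] by (auto simp: val_def)
  define C where "C = {k \<in> ?N. ?cell k = (j0, i0)}"
  have finC: "finite C" by (simp add: C_def)
  have C_less: "val s < val s' \<longleftrightarrow> s < s'" if "s \<in> C" "s' \<in> C" for s s'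
  proof -
    have "val s < val s'" if "s \<in> C" "s' \<in> C" "s < s'" for s s'
      using turn[of s s'] val_less[of s s'] that sx_corner by (auto simp: C_def rising_def)
    from this[of s s'] this[of s' s] that show ?thesis
      by (cases s s' rule: linorder_cases) auto
  qed
  define T where "T k = card {s \<in> C. if snd (?cell k) = i0 then s < k else val s < val k}" for k
  have T_col: "T k = card {s \<in> C. s < k}" if "snd (?cell k) = i0" for k using that by (simp add: T_def)
  have T_row: "T k = card {s \<in> C. val s < val k}" if "fst (?cell k) = j0" "k \<in> ?N" for k
  proof (cases "snd (?cell k) = i0")
    case True
    then have "k \<in> C" using that by (simp add: C_def prod_eq_iff)
    then have "{s \<in> C. s < k} = {s \<in> C. val s < val k}" using C_less by auto
    then show ?thesis using T_col[OF True] by simp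
  qed (simp add: T_def)
  \<comment> \<open>Row points, then column points, then the corner point itself.\<close>
  define ty where "ty k = (if snd (?cell k) \<noteq> i0 then 0 else if fst (?cell k) \<noteq> j0 then 1 else 2::nat)" for k
  define th where "th k = (if snd (?cell k) = i0 then k else val k)" for k
  define key where "key k = (3 * T k + ty k) * Suc n + th k" for k
  have th_le: "th k < Suc n" if "k \<in> ?N" for k using \<sigma>_in[OF that] that by (auto simp: th_def val_def)
  have ty_le: "ty k \<le> 2" for k by (simp add: ty_def)
  have key1: "key k < key k'" if "3 * T k + ty k < 3 * T k' + ty k'" "k \<in> ?N" for k k'
    unfolding key_def using lex_less[OF that(1) th_le[OF that(2)]] .
  have key_col: "key k < key k'"
    if k: "k \<in> ?N" "k' \<in> ?N" "snd (?cell k) = i0" "snd (?cell k') = i0" "k < k'" for k k'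
  proof -
    have sub: "{s \<in> C. s < k} \<subseteq> {s \<in> C. s < k'}" using k by auto
    show ?thesis
    proof (cases "k \<in> C")
      case True
      then have "{s \<in> C. s < k} \<subset> {s \<in> C. s < k'}" using k by auto
      then have "T k < T k'" unfolding T_col[OF k(3)] T_col[OF k(4)] using finC by (intro psubset_card_mono) auto
      then show ?thesis using ty_le[of k] by (intro key1 k) simp
    next
      case False
      have "T k \<le> T k'" unfolding T_col[OF k(3)] T_col[OF k(4)] using sub finC by (intro card_mono) auto
      moreover have "ty k = 1" "ty k' \<ge> 1" using False k by (auto simp: ty_def C_def prod_eq_iff)
      ultimately consider "3 * T k + ty k < 3 * T k' + ty k'" | "3 * T k + ty k = 3 * T k' + ty k'"
        by linarith
      then show ?thesis
      proof cases
        case 2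
        then show ?thesis using k by (simp add: key_def th_def)
      qed (intro key1 k)
    qed
  qed
  have key_row: "key k < key k'"
    if k: "k \<in> ?N" "k' \<in> ?N" "fst (?cell k) = j0" "fst (?cell k') = j0" "val k < val k'" for k k'
  proof -
    note T = T_row[OF k(3,1)] T_row[OF k(4,2)]
    have sub: "{s \<in> C. val s < val k} \<subseteq> {s \<in> C. val s < val k'}" using k by auto
    show ?thesis
    proof (cases "k \<in> C")
      case True
      then have "{s \<in> C. val s < val k} \<subset> {s \<in> C. val s < val k'}" using k by auto
      then have "T k < T k'" unfolding T using finC by (intro psubset_card_mono) auto
      then show ?thesis using ty_le[of k] by (intro key1 k) simp
    next
      case False
      have "T k \<le> T k'" unfolding T using sub finC by (intro card_mono) auto
      moreover have ty: "ty k = 0" "snd (?cell k) \<noteq> i0" using False k by (auto simp: ty_def C_def prod_eq_iff)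
      ultimately consider "3 * T k + ty k < 3 * T k' + ty k'" | "3 * T k + ty k = 3 * T k' + ty k'" "ty k' = 0"
        using ty_le[of k'] by linarith
      then show ?thesis
      proof cases
        case 2
        then have "snd (?cell k') \<noteq> i0" by (auto simp: ty_def split: if_splits)
        then show ?thesis using k ty 2(1) by (simp add: key_def th_def)
      qed (intro key1 k)
    qed
  qed
  have line: "snd (?cell k) = i0 \<or> fst (?cell k) = j0" if "k \<in> ?N" for k
    using Z[OF that] by (auto simp: Z_def)
  have key_ne: "key k \<noteq> key k'" if k: "k \<in> ?N" "k' \<in> ?N" "k < k'" for k k'
  proof -
    have "snd (?cell k) = i0 \<and> snd (?cell k') = i0 \<or> fst (?cell k) = j0 \<and> fst (?cell k') = j0
        \<or> ty k \<noteq> ty k'"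
      using line[OF k(1)] line[OF k(2)]
      by (cases "snd (?cell k) = i0"; cases "snd (?cell k') = i0") (auto simp: ty_def)
    then consider "snd (?cell k) = i0" "snd (?cell k') = i0" | "fst (?cell k) = j0" "fst (?cell k') = j0"
      | "ty k \<noteq> ty k'" by blast
    then show ?thesis
    proof cases
      case 1
      then show ?thesis using key_col[OF k(1,2) _ _ k(3)] by simp
    next
      case 2
      have "val k < val k' \<or> val k' < val k"
        using val_less[of k k'] val_less[of k' k] k \<sigma>_ne[of k k'] by auto
      then show ?thesis using key_row[of k k'] key_row[of k' k] k 2 by auto
    next
      case 3
      then have "3 * T k + ty k \<noteq> 3 * T k' + ty k'" using ty_le[of k] ty_le[of k'] by presburger
      then show ?thesis using key1[of k k'] key1[of k' k] k by (metis linorder_neqE_nat nat_neq_iff)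
    qed
  qed
  have "inj_on key ?N" using key_ne by (intro linorder_inj_onI) auto
  then obtain e where e: "bij_betw e {..<n} ?N" "\<And>p q. p < q \<Longrightarrow> q < n \<Longrightarrow> key (e p) < key (e q)"
    using enumerate_by_key by blast
  have e_in: "e p \<in> ?N" if "p < n" for p using bij_betwE[OF e(1)] that by auto
  have e_surj: "\<exists>p < n. k = e p" if "k \<in> ?N" for k
    using bij_betw_imp_surj_on[OF e(1)] that by (metis imageE lessThan_iff)
  have e_ne: "e p \<noteq> e q" if "p \<noteq> q" "p < n" "q < n" for p q
    using e(1) that by (auto simp: bij_betw_def inj_on_def)
  have e_less: "key (e p) < key (e q) \<longleftrightarrow> p < q" if "p < n" "q < n" for p q
    using e(2)[of p q] e(2)[of q p] that by (cases p q rule: linorder_cases) auto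
  define w where "w = map (\<lambda>p. ?cell (e p)) [0..<n]"
  have len: "length w = n" by (simp add: w_def)
  have wp: "w ! p = ?cell (e p)" if "p < n" for p using that by (simp add: w_def)
  have w_Z: "set w \<subseteq> Z" using Z e_in by (auto simp: w_def)
  have "normal w"
    unfolding normal_def letters_eq successively_conv_nth
  proof (intro conjI w_Z allI impI)
    fix p assume p: "Suc p < length w"
    show "\<not> (w ! p \<in> col_cells \<and> w ! Suc p \<in> row_cells)"
    proof
      assume vh: "w ! p \<in> col_cells \<and> w ! Suc p \<in> row_cells"
      let ?k = "e p" and ?k' = "e (Suc p)"
      have pn: "p < n" "Suc p < n" using p len by auto
      have kN: "?k \<in> ?N" "?k' \<in> ?N" using e_in pn by auto
      have k: "snd (?cell ?k) = i0" "fst (?cell ?k) \<noteq> j0" and k': "fst (?cell ?k') = j0" "snd (?cell ?k') \<noteq> i0"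
        using vh wp pn by (auto simp: col_cells_def row_cells_def)
      have "key ?k < key ?k'" using e(2)[of p "Suc p"] pn by simp
      then have "3 * T ?k + ty ?k \<le> 3 * T ?k' + ty ?k'"
        using key1[of ?k' ?k] kN by (metis linorder_not_less order.asym)
      then have "T ?k < T ?k'" using k k' by (simp add: ty_def)
      \<comment> \<open>A column point directly before a row point would have fewer corner points before it than
        the row point, and one of the additional ones would lie between the two.\<close>
      then have less: "card {s \<in> C. s < ?k} < card {s \<in> C. val s < val ?k'}"
        using T_col[OF k(1)] T_row[OF k'(1) kN(2)] by simp
      have "\<not> {s \<in> C. val s < val ?k'} \<subseteq> {s \<in> C. s < ?k}"
      proof
        assume "{s \<in> C. val s < val ?k'} \<subseteq> {s \<in> C. s < ?k}"
        then have "card {s \<in> C. val s < val ?k'} \<le> card {s \<in> C. s < ?k}"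
          using finC by (intro card_mono) auto
        then show False using less by simp
      qed
      then obtain s where s: "s \<in> C" "val s < val ?k'" "\<not> s < ?k" by auto
      have sN: "s \<in> ?N" "?cell s = (j0, i0)" using s(1) by (auto simp: C_def)
      have "fst (?cell s) = j0" using sN(2) by simp
      then have "s \<noteq> ?k" using k(2) by metis
      then have "key ?k < key s" using key_col[of ?k s] kN sN k s(3) by auto
      moreover have "key s < key ?k'" using key_row[of s ?k'] kN sN k' s(2) by auto
      moreover obtain t where "t < n" "s = e t" using e_surj[OF sN(1)] by blast
      ultimately have "p < t" "t < Suc p" using e_less pn by auto
      then show False by simp
    qed
  qed
  then have w_Words: "w \<in> Words n" using len by (simp add: Words_def)
  have same_val: "val (e p) < val (e q)" if "p < q" "q < n" "fst (w ! p) = j0" "fst (w ! q) = j0" for p q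
  proof -
    have N: "e p \<in> ?N" "e q \<in> ?N" using e_in that by auto
    have "e p \<noteq> e q" using e(2)[OF that(1,2)] by auto
    then have "val (e p) \<noteq> val (e q)"
      using val_less[of "e p" "e q"] val_less[of "e q" "e p"] N \<sigma>_ne[of "e p" "e q"] by auto
    moreover have "\<not> val (e q) < val (e p)"
      using key_row[of "e q" "e p"] e(2)[OF that(1,2)] N that wp by auto
    ultimately show ?thesis by simp
  qed
  have same_pos: "e p < e q" if "p < q" "q < n" "snd (w ! p) = i0" "snd (w ! q) = i0" for p q
  proof -
    have N: "e p \<in> ?N" "e q \<in> ?N" using e_in that by auto
    have "e p \<noteq> e q" using e(2)[OF that(1,2)] by auto
    moreover have "\<not> e q < e p"
      using key_col[of "e q" "e p"] e(2)[OF that(1,2)] N that wp by auto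
    ultimately show ?thesis by simp
  qed
  have xs: "x_less (w ! p) (w ! q) \<longleftrightarrow> e p < e q" if pq: "p < q" "q < n" for p q
  proof -
    have N: "e p \<in> ?N" "e q \<in> ?N" "p < n" using e_in pq by auto
    have ne: "e p \<noteq> e q" using e(2)[OF pq] by auto
    have mono: "snd (?cell k) \<le> snd (?cell k')" if "k \<in> ?N" "k' \<in> ?N" "k < k'" for k k'
      using strip_mono[OF d(1)] that by (simp add: cell_of_def)
    consider "snd (w ! p) < snd (w ! q)" | "snd (w ! q) < snd (w ! p)"
      | "snd (w ! p) = i0" "snd (w ! q) = i0" | "w ! p = w ! q" "snd (w ! p) \<noteq> i0" "fst (w ! p) = j0"
      using line[OF N(1)] line[OF N(2)] wp N(3) pq(2) by (cases "w ! p"; cases "w ! q") fastforce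
    then show ?thesis
    proof cases
      case 1
      then have "\<not> e q < e p" using mono[of "e q" "e p"] N wp pq by auto
      then show ?thesis using 1 ne by (simp add: x_less_def)
    next
      case 2
      then have "\<not> e p < e q" using mono[of "e p" "e q"] N wp pq by auto
      then show ?thesis using 2 by (simp add: x_less_def)
    next
      case 3
      then show ?thesis using same_pos[OF pq] sx_corner by (simp add: x_less_def)
    next
      case 4
      then have "\<sigma> (e p) < \<sigma> (e q) \<longleftrightarrow> sy j0"
        using same_val[OF pq] val_less[OF N(1,2) ne] by simp
      moreover have "e p < e q \<Longrightarrow> \<sigma> (e p) < \<sigma> (e q) \<longleftrightarrow> rising (w ! p)"
        "e q < e p \<Longrightarrow> \<sigma> (e q) < \<sigma> (e p) \<longleftrightarrow> rising (w ! p)"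
        using turn[of "e p" "e q"] turn[of "e q" "e p"] N wp pq 4 by auto
      moreover have "e p < e q \<or> e q < e p" using ne by auto
      ultimately show ?thesis using \<sigma>_ne[OF ne] 4 by (auto simp: x_less_def rising_def)
    qed
  qed
  have ys: "y_less (w ! p) (w ! q) \<longleftrightarrow> \<sigma> (e p) < \<sigma> (e q)" if pq: "p < q" "q < n" for p q
  proof -
    have N: "e p \<in> ?N" "e q \<in> ?N" "p < n" using e_in pq by auto
    have ne: "e p \<noteq> e q" using e(2)[OF pq] by auto
    have mono: "fst (?cell k) \<le> fst (?cell k')" if "k \<in> ?N" "k' \<in> ?N" "\<sigma> k < \<sigma> k'" for k k'
      using strip_mono[OF d(2)] that \<sigma>_in by (simp add: cell_of_def)
    consider "fst (w ! p) < fst (w ! q)" | "fst (w ! q) < fst (w ! p)"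
      | "fst (w ! p) = j0" "fst (w ! q) = j0" | "w ! p = w ! q" "fst (w ! p) \<noteq> j0" "snd (w ! p) = i0"
      using line[OF N(1)] line[OF N(2)] wp N(3) pq(2) by (cases "w ! p"; cases "w ! q") fastforce
    then show ?thesis
    proof cases
      case 1
      then have "\<not> \<sigma> (e q) < \<sigma> (e p)" using mono[of "e q" "e p"] N wp pq by auto
      then show ?thesis using 1 \<sigma>_ne[OF ne] by (simp add: y_less_def)
    next
      case 2
      then have "\<not> \<sigma> (e p) < \<sigma> (e q)" using mono[of "e p" "e q"] N wp pq by auto
      then show ?thesis using 2 by (simp add: y_less_def)
    next
      case 3
      then show ?thesis using same_val[OF pq] val_less[OF N(1,2) ne] by (simp add: y_less_def)
    next
      case 4
      then have "e p < e q" using same_pos[OF pq] by simp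
      then have "\<sigma> (e p) < \<sigma> (e q) \<longleftrightarrow> rising (w ! p)"
        using turn[of "e p" "e q"] N wp pq 4 by auto
      then show ?thesis using 4 sx_corner by (auto simp: y_less_def rising_def)
    qed
  qed
  have Xw: "X w p = e p" if p: "p < n" for p
  proof -
    have "lex_key snd sx w q \<le> lex_key snd sx w p \<longleftrightarrow> e q \<le> e p" if q: "q < n" for q
      using x_key_less[of p q w] x_key_less[of q p w] xs[of p q] xs[of q p] e_ne[of q p] p q len
      by (cases p q rule: linorder_cases) (auto split: if_splits)
    then have "X w p = rank e n p" unfolding X_def rank_def len by (metis (lifting))
    then show ?thesis using rank_bij[OF e(1) p] by simp
  qed
  have \<sigma>e: "bij_betw (\<lambda>p. \<sigma> (e p)) {..<n} ?N"
    using bij_betw_trans[OF e(1) permutes_imp_bij[OF \<sigma>]] by (simp add: o_def)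
  have Yw: "Y w p = \<sigma> (e p)" if p: "p < n" for p
  proof -
    have "lex_key fst sy w q \<le> lex_key fst sy w p \<longleftrightarrow> \<sigma> (e q) \<le> \<sigma> (e p)" if q: "q < n" for q
      using y_key_less[of p q w] y_key_less[of q p w] ys[of p q] ys[of q p] \<sigma>_ne[OF e_ne[of q p]] p q len
      by (cases p q rule: linorder_cases) (auto split: if_splits)
    then have "Y w p = rank (\<lambda>p. \<sigma> (e p)) n p" unfolding Y_def rank_def len by (metis (lifting))
    then show ?thesis using rank_bij[OF \<sigma>e p] by simp
  qed
  have "perm_of w = \<sigma>"
  proof
    fix k
    show "perm_of w k = \<sigma> k"
    proof (cases "k \<in> ?N")
      case True
      then obtain p where "p < n" "k = e p" using e_surj by blast
      then show ?thesis using perm_of_X[of p w] Xw Yw len by simp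
    next
      case False
      have "\<sigma> k = k" using permutes_not_in[OF \<sigma> False] .
      moreover have "perm_of w k = k" unfolding perm_of_def len using False by (rule if_not_P)
      ultimately show ?thesis by simp
    qed
  qed
  moreover obtain cs' rs' where g': "gridded_of w = (perm_of w, cs', rs')"
    "(cs', rs') \<in> griddings n (perm_of w)"
    "\<And>p. p < n \<Longrightarrow> strip rs' (Y w p) = fst (w ! p) \<and> strip cs' (X w p) = snd (w ! p)"
    using gridded_of[OF w_Z] len by metis
  have d': "dividers n (Suc c) cs'" "dividers n (Suc r) rs'" using griddings_dividers[OF g'(2)] by auto
  have "cs' = cs"
  proof (rule dividers_eqI[OF d'(1) d(1)])
    fix k assume "k \<in> ?N"
    then obtain p where "p < n" "k = e p" using e_surj by blast
    then show "strip cs' k = strip cs k" using g'(3)[of p] Xw wp by (simp add: cell_of_def)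
  qed
  moreover have "rs' = rs"
  proof (rule dividers_eqI[OF d'(2) d(2)])
    fix k assume "k \<in> ?N"
    then obtain p where "p < n" "k = \<sigma> (e p)"
      using bij_betw_imp_surj_on[OF \<sigma>e] by (metis imageE lessThan_iff)
    then show "strip rs' k = strip rs k" using g'(3)[of p] Yw wp by (simp add: cell_of_def)
  qed
  ultimately show thesis using g'(1) w_Words that by simp
qed

theorem bij_gridded_of: "bij_betw gridded_of (Words n) (Gridded n M)"
  unfolding bij_betw_def
proof (intro conjI equalityI subsetI inj_on_gridded_of)
  fix x assume "x \<in> gridded_of ` Words n"
  then show "x \<in> Gridded n M" using gridded_of_in_Gridded by auto
next
  fix x assume x: "x \<in> Gridded n M"
  obtain \<sigma> cs rs where "x = (\<sigma>, cs, rs)" by (cases x)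
  then show "x \<in> gridded_of ` Words n" using Gridded_has_word x by (metis imageI)
qed

corollary card_Gridded: "card (Gridded n M) = W n"
  using bij_betw_same_card[OF bij_gridded_of] by (simp add: W_def)

text \<open>
  Each permutation is counted once for each of its griddings, with the reciprocal of their number as weight.
\<close>

theorem card_Grid: "real (card (Grid n M)) = (\<Sum>w \<in> Words n. 1 / real (card (relabelings w)))"
proof -
  have fin: "finite (Grid n M)"
    by (rule finite_subset[OF _ finite_permutations[of "{1..n}"]]) (auto simp: Grid_def)
  have Sigma: "Gridded n M = Sigma (Grid n M) (griddings n)"
    by (auto simp: Gridded_def Grid_def griddings_def)
  have fin_g: "finite (griddings n \<sigma>)" "griddings n \<sigma> \<noteq> {}" if "\<sigma> \<in> Grid n M" for \<sigma>
  proof -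
    have "griddings n \<sigma> \<subseteq> snd ` Gridded n M" using that by (force simp: Sigma)
    then show "finite (griddings n \<sigma>)" using finite_Gridded finite_subset by blast
    show "griddings n \<sigma> \<noteq> {}" using that by (auto simp: Grid_def griddings_def)
  qed
  have "real (card (Grid n M)) = (\<Sum>\<sigma> \<in> Grid n M. \<Sum>g \<in> griddings n \<sigma>. 1 / real (card (griddings n \<sigma>)))"
    using fin_g by (simp add: card_gt_0_iff)
  also have "\<dots> = (\<Sum>(\<sigma>, g) \<in> Gridded n M. 1 / real (card (griddings n \<sigma>)))"
    unfolding Sigma using fin fin_g by (subst sum.Sigma) auto
  also have "\<dots> = (\<Sum>w \<in> Words n. case gridded_of w of (\<sigma>, g) \<Rightarrow> 1 / real (card (griddings n \<sigma>)))"
    by (rule sum.reindex_bij_betw[OF bij_gridded_of, symmetric])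
  also have "\<dots> = (\<Sum>w \<in> Words n. 1 / real (card (relabelings w)))"
  proof (rule sum.cong)
    fix w assume "w \<in> Words n"
    then show "(case gridded_of w of (\<sigma>, g) \<Rightarrow> 1 / real (card (griddings n \<sigma>))) = 1 / real (card (relabelings w))"
      using card_griddings[of w] Words_Z by (auto simp: gridded_of_def)
  qed simp
  finally show ?thesis .
qed

end

section \<open>The asymptotic count\<close>

text \<open>
  The rotation \<open>i \<mapsto> (i + b - a) mod (m + 1)\<close> of \<open>{0..m}\<close>, which moves \<open>a\<close> to
  \<open>b\<close>. It is a translation near \<open>a\<close> as long as \<open>a\<close> and \<open>b\<close> are at corresponding ends of the interval, or
  both inside.
\<close>

definition rotate_index :: "nat \<Rightarrow> nat \<Rightarrow> nat \<Rightarrow> nat \<Rightarrow> nat" where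
  "rotate_index m a b i =
     (if i + b < a then i + b + Suc m - a else if i + b - a \<le> m then i + b - a else i + b - a - Suc m)"

lemma bij_rotate_index:
  assumes "a \<le> m" "b \<le> m"
  shows "bij_betw (rotate_index m a b) {..m} {..m}"
proof -
  have "inj_on (rotate_index m a b) {..m}"
  proof (rule inj_onI)
    fix i i' assume "i \<in> {..m}" "i' \<in> {..m}" "rotate_index m a b i = rotate_index m a b i'"
    then show "i = i'" using assms unfolding rotate_index_def by (simp split: if_splits)
  qed
  moreover have "rotate_index m a b ` {..m} \<subseteq> {..m}"
    using assms by (auto simp: rotate_index_def)
  ultimately show ?thesis by (simp add: bij_betw_def endo_inj_surj)
qed

lemma rotate_index_shift:
  assumes "a \<le> m" "b \<le> m" "a = 0 \<longleftrightarrow> b = 0" "a = m \<longleftrightarrow> b = m" and "i \<le> m" "adjacent_or_equal a i"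
  shows "rotate_index m a b i + a = i + b"
  using assms unfolding rotate_index_def adjacent_or_equal_def by (simp split: if_splits) linarith

lemma rotate_index_near:
  assumes ab: "a \<le> m" "b \<le> m" "a = 0 \<longleftrightarrow> b = 0" "a = m \<longleftrightarrow> b = m" and i: "i \<le> m"
  shows "adjacent_or_equal b (rotate_index m a b i) \<longleftrightarrow> adjacent_or_equal a i"
proof
  assume "adjacent_or_equal a i"
  then show "adjacent_or_equal b (rotate_index m a b i)"
    using rotate_index_shift[OF ab i] by (simp add: adjacent_or_equal_def)
next
  let ?i = "rotate_index m a b i"
  assume near: "adjacent_or_equal b ?i"
  have le: "?i \<le> m" using bij_betwE[OF bij_rotate_index[OF ab(1,2)]] i by simp
  define i' where "i' = ?i + a - b"
  have sub: "b \<le> ?i + a" using near ab by (auto simp: adjacent_or_equal_def)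
  have i': "i' \<le> m" "adjacent_or_equal a i'"
    using near ab le sub unfolding i'_def adjacent_or_equal_def by linarith+
  have "rotate_index m a b i' = ?i"
    using rotate_index_shift[OF ab i'] sub by (simp add: i'_def)
  then have "i' = i"
    using bij_betw_imp_inj_on[OF bij_rotate_index[OF ab(1,2)]] i i'(1) by (meson atMost_iff inj_onD)
  then show "adjacent_or_equal a i" using i'(2) by simp
qed

context cross_matrix
begin

lemma nonblank_eq_Z: "nonblank_cells M = Z"
proof -
  have "M $$ (j, i) \<noteq> Blank \<longleftrightarrow> (j, i) \<in> Z" if "j \<le> r" "i \<le> c" for j i
    using entry[OF that] by simp
  then show ?thesis
    using rows cols by (auto simp: nonblank_cells_def less_Suc_eq_le) (auto simp: Z_def)
qed

lemma corner_eq: "corner M = (j0, i0)"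
  using corner_eqI(2)[OF r_pos c_pos j0_le i0_le] nonblank_eq_Z by (simp add: Z_def)

lemma noncorner_peaks_eq: "noncorner_peaks M = far_peaks"
proof -
  have "M $$ a = Increasing \<longleftrightarrow> rising a" "M $$ a = Decreasing \<longleftrightarrow> \<not> rising a" if "a \<in> Z" for a
    using that entry by (cases a; force simp: Z_def)+
  then show ?thesis
    unfolding noncorner_peaks_def peaks_def far_peaks_def corner_eq nonblank_eq_Z by blast
qed

definition class_weight :: "(nat \<times> nat) list \<Rightarrow> real" where
  "class_weight w = 1 / real (card (relabelings w))"

lemma card_relabelings_pos: "normal w \<Longrightarrow> 0 < card (relabelings w)"
  using identity_relabeling finite_relabelings by (auto simp: card_gt_0_iff normal_def letters_eq)

lemma class_weight_pos: "normal w \<Longrightarrow> 0 < class_weight w"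
  using card_relabelings_pos by (simp add: class_weight_def)

lemma class_weight_le: "normal w \<Longrightarrow> \<bar>class_weight w\<bar> \<le> 1"
  using card_relabelings_pos[of w] by (simp add: class_weight_def)

lemma density_class_weight: "density class_weight n = real (card (Grid n M)) / real (card (Gridded n M))"
  by (simp add: density_def card_Grid card_Gridded class_weight_def)

theorem Grid_ratio_limit:
  obtains x where "x > 0" "(\<lambda>n. real (card (Grid n M)) / real (card (Gridded n M))) \<longlonglongrightarrow> x"
proof -
  have loc: "head_tail_local class_weight"
    using card_relabelings_middle by (simp add: head_tail_local_def class_weight_def)
  then obtain x where x: "density class_weight \<longlonglongrightarrow> x"
    using density_convergent[OF loc class_weight_le] by (auto simp: convergent_def)
  then have "x > 0" using loc class_weight_pos by (rule density_limit_pos)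
  with x show thesis using that by (simp add: density_class_weight[abs_def])
qed

end

context aligned_crosses
begin

lemma card_Z_eq: "card A'.Z = card A.Z"
  using bij_betw_same_card[OF bij_\<Phi>] by simp

lemma fixing_image:
  assumes u: "set u \<subseteq> A.Z" "sublist A.lock u"
  shows "A'.fixing (map \<Phi> u)"
proof -
  have l: "distinct (map \<Phi> A.alphabet)" "set (map \<Phi> A.alphabet) = A'.Z"
    using bij_\<Phi> A.distinct_alphabet A.set_alphabet by (auto simp: distinct_map bij_betw_def)
  obtain x y where "u = x @ A.lock @ y" using u(2) by (auto simp: sublist_def)
  then have "map \<Phi> u = map \<Phi> x @ concat (replicate (Suc (card A'.Z ^ card A'.Z)) (map \<Phi> A.alphabet))
      @ (\<Phi> (j0, i0) # map \<Phi> y)"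
    by (simp add: A.lock_def card_Z_eq map_concat)
  then have "sublist (concat (replicate (Suc (card A'.Z ^ card A'.Z)) (map \<Phi> A.alphabet))) (map \<Phi> u)"
    unfolding sublist_def by blast
  then show ?thesis
    unfolding A'.fixing_def using A'.repetition_fixes[OF l] u(1) \<Phi>_in_Z by auto
qed

lemma weights_agree:
  assumes w: "A.normal w" "A.locked w"
  shows "2 ^ card A.far_peaks / real (card (A.relabelings w))
    = 2 ^ card A'.far_peaks / real (card (A'.relabelings (map \<Phi> w)))"
proof -
  obtain u v where uv: "w = u @ v" "sublist A.lock u" "sublist A.lock v"
    using w(2) by (auto simp: A.locked_def)
  have Z: "set u \<subseteq> A.Z" "set v \<subseteq> A.Z" using w(1) uv(1) by (auto simp: A.normal_def A.letters_eq)
  have "card (A.relabelings w) = 2 ^ card A.far_peaks * card (A.local_relabelings w)"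
    unfolding uv(1) using Z uv by (intro A.card_relabelings_far_peaks A.fixing_if_lock)
  moreover have "card (A'.relabelings (map \<Phi> w)) = 2 ^ card A'.far_peaks * card (A'.local_relabelings (map \<Phi> w))"
    unfolding uv(1) map_append using Z uv by (intro A'.card_relabelings_far_peaks fixing_image)
  moreover have "card (A'.local_relabelings (map \<Phi> w)) = card (A.local_relabelings w)"
    using Z uv(1) by (intro card_local_relabelings_image) auto
  ultimately show ?thesis by simp
qed

lemma \<Phi>_row_cells: "a \<in> A.Z \<Longrightarrow> \<Phi> a \<in> A'.row_cells \<longleftrightarrow> a \<in> A.row_cells"
  and \<Phi>_col_cells: "a \<in> A.Z \<Longrightarrow> \<Phi> a \<in> A'.col_cells \<longleftrightarrow> a \<in> A.col_cells"
proof -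
  assume a: "a \<in> A.Z"
  obtain j i where ji: "a = (j, i)" by (cases a)
  then have le: "j \<le> r" "i \<le> c" using a by (auto simp: A.Z_def)
  have "\<rho> j = j0' \<longleftrightarrow> j = j0" "\<gamma> i = i0' \<longleftrightarrow> i = i0"
    using corner_image row_eq_iff[OF le(1) A.j0_le] col_eq_iff[OF le(2) A.i0_le] by auto
  then show "\<Phi> a \<in> A'.row_cells \<longleftrightarrow> a \<in> A.row_cells" "\<Phi> a \<in> A'.col_cells \<longleftrightarrow> a \<in> A.col_cells"
    using le row_le col_le by (auto simp: ji \<Phi>_def A.row_cells_def A'.row_cells_def
        A.col_cells_def A'.col_cells_def)
qed

lemma normal_image: "set w \<subseteq> A.Z \<Longrightarrow> A'.normal (map \<Phi> w) \<longleftrightarrow> A.normal w"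
proof -
  assume w: "set w \<subseteq> A.Z"
  have Z: "w ! i \<in> A.Z" if "i < length w" for i using that w nth_mem by blast
  have e: "\<Phi> (w ! i) \<in> A'.col_cells \<longleftrightarrow> w ! i \<in> A.col_cells"
    "\<Phi> (w ! Suc i) \<in> A'.row_cells \<longleftrightarrow> w ! Suc i \<in> A.row_cells" if "Suc i < length w" for i
    using that Z \<Phi>_col_cells \<Phi>_row_cells by simp_all
  have "\<Phi> ` set w \<subseteq> A'.Z" using w \<Phi>_in_Z by auto
  then show ?thesis
    unfolding A.normal_def A'.normal_def A.letters_eq A'.letters_eq successively_map successively_conv_nth
    using w by (simp add: e)
qed

lemma bij_Words: "bij_betw (map \<Phi>) (A.Words n) (A'.Words n)"
  unfolding bij_betw_def
proof (intro conjI equalityI subsetI)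
  have "A.Words n \<subseteq> lists A.Z" by (auto simp: A.Words_def A.normal_def A.letters_eq)
  moreover have "inj_on (map \<Phi>) (lists A.Z)"
    using bij_\<Phi> by (intro inj_on_map_lists) (simp add: bij_betw_def)
  ultimately show "inj_on (map \<Phi>) (A.Words n)" by (rule inj_on_subset[rotated])
next
  fix y assume "y \<in> map \<Phi> ` A.Words n"
  then show "y \<in> A'.Words n"
    using normal_image by (auto simp: A.Words_def A'.Words_def A.normal_def A.letters_eq)
next
  fix y assume y: "y \<in> A'.Words n"
  then have "y \<in> lists (\<Phi> ` A.Z)"
    using bij_\<Phi> by (auto simp: A'.Words_def A'.normal_def A'.letters_eq bij_betw_def)
  then obtain z where z: "y = map \<Phi> z" "z \<in> lists A.Z" unfolding lists_image by (rule imageE)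
  then have "z \<in> A.Words n" using y normal_image[of z] by (auto simp: A.Words_def A'.Words_def)
  then show "y \<in> map \<Phi> ` A.Words n" using z by blast
qed

lemma density_image: "A'.density f n = A.density (\<lambda>w. f (map \<Phi> w)) n"
  using sum.reindex_bij_betw[OF bij_Words, of f n] bij_betw_same_card[OF bij_Words, of n]
  by (simp add: A.density_def A'.density_def A.W_def A'.W_def)

end

text \<open>
  By \<open>weights_agree\<close>, the averages of \<open>2 ^ p / N w\<close> for the two matrices differ only on the
  rare words that are not locked.
\<close>

lemma Grid_ratio_limits_agree:
  assumes al: "aligned_crosses r c j0 i0 j0' i0' sx sy sx' sy' \<rho> \<gamma>"
    and M: "cross_matrix r c j0 i0 sx sy M" and M': "cross_matrix r c j0' i0' sx' sy' M'"
    and x: "(\<lambda>n. real (card (Grid n M)) / real (card (Gridded n M))) \<longlonglongrightarrow> x"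
    and x': "(\<lambda>n. real (card (Grid n M')) / real (card (Gridded n M'))) \<longlonglongrightarrow> x'"
  shows "2 ^ card (noncorner_peaks M) * x = 2 ^ card (noncorner_peaks M') * x'"
proof -
  interpret aligned_crosses r c j0 i0 j0' i0' sx sy sx' sy' \<rho> \<gamma> by (rule al)
  interpret M: cross_matrix r c j0 i0 sx sy M by (rule M)
  interpret M': cross_matrix r c j0' i0' sx' sy' M' by (rule M')
  let ?p = "card (noncorner_peaks M)" and ?p' = "card (noncorner_peaks M')"
  let ?f = "\<lambda>w. 2 ^ ?p * M.class_weight w" and ?f' = "\<lambda>w. 2 ^ ?p' * M'.class_weight w"
  have scale: "A.density (\<lambda>w. a * f w) = (\<lambda>n. a * A.density f n)"
    "A'.density (\<lambda>w. a * f w) = (\<lambda>n. a * A'.density f n)" for a f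
    by (auto simp: A.density_def A'.density_def sum_distrib_left[symmetric])
  have lim: "A.density ?f \<longlonglongrightarrow> 2 ^ ?p * x"
    unfolding scale M.density_class_weight by (intro tendsto_intros x)
  have "A'.density ?f' \<longlonglongrightarrow> 2 ^ ?p' * x'"
    unfolding scale M'.density_class_weight by (intro tendsto_intros x')
  then have lim': "A.density (\<lambda>w. ?f' (map \<Phi> w)) \<longlonglongrightarrow> 2 ^ ?p' * x'"
    unfolding density_image[abs_def] .
  have bound: "\<bar>?f w\<bar> \<le> 2 ^ ?p + 2 ^ ?p'" if "A.normal w" for w
    using M.class_weight_le[OF that] by (simp add: abs_mult) (smt (verit) mult_left_le zero_le_power)
  have bound': "\<bar>?f' (map \<Phi> w)\<bar> \<le> 2 ^ ?p + 2 ^ ?p'" if "A.normal w" for w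
  proof -
    have "A'.normal (map \<Phi> w)" using that normal_image by (simp add: A.normal_def A.letters_eq)
    from M'.class_weight_le[OF this] show ?thesis
      by (simp add: abs_mult) (smt (verit) mult_left_le zero_le_power)
  qed
  have "A.density (\<lambda>w. ?f' (map \<Phi> w)) \<longlonglongrightarrow> 2 ^ ?p * x"
  proof (rule A.density_limit_eq[OF lim bound bound'])
    fix w assume "A.normal w" "A.locked w"
    from weights_agree[OF this] show "?f w = ?f' (map \<Phi> w)"
      by (simp add: M.class_weight_def M'.class_weight_def M.noncorner_peaks_eq M'.noncorner_peaks_eq)
  qed
  then show ?thesis using lim' LIMSEQ_unique by blast
qed

text \<open>
  These signs realise the orientations of all nonblank cells: row signs are read off from the main
  column, whose sign is positive, and column signs from the main row.
\<close>

definition row_sign :: "gridding_matrix \<Rightarrow> nat \<Rightarrow> nat \<Rightarrow> bool" where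
  "row_sign M i0 j \<longleftrightarrow> M $$ (j, i0) = Increasing"

definition col_sign :: "gridding_matrix \<Rightarrow> nat \<Rightarrow> nat \<Rightarrow> nat \<Rightarrow> bool" where
  "col_sign M j0 i0 i \<longleftrightarrow> i = i0 \<or> (M $$ (j0, i) = Increasing) = row_sign M i0 j0"

lemma connected_one_corner_cross_matrix:
  assumes "connected_one_corner r c M"
  obtains j0 i0 where "cross_matrix r c j0 i0 (col_sign M j0 i0) (row_sign M i0) M"
proof -
  from assms obtain j0 i0 where pos: "1 \<le> r" "1 \<le> c" and dim: "dim_row M = r + 1" "dim_col M = c + 1"
    and corner: "is_corner M (j0, i0)"
    and nb: "nonblank_cells M = {(j, i). j \<le> r \<and> i \<le> c \<and> (j = j0 \<or> i = i0)}"
    unfolding connected_one_corner_def by blast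
  have le: "j0 \<le> r" "i0 \<le> c" using corner by (auto simp: is_corner_def nb)
  interpret cross r c j0 i0 "col_sign M j0 i0" "row_sign M i0"
    using pos le by unfold_locales
  have "M $$ (j, i) = (if (j, i) \<in> Z then if rising (j, i) then Increasing else Decreasing else Blank)"
    if ji: "j \<le> r" "i \<le> c" for j i
  proof -
    have "M $$ (j, i) \<noteq> Blank \<longleftrightarrow> (j, i) \<in> Z"
    proof -
      have "M $$ (j, i) \<noteq> Blank \<longleftrightarrow> (j, i) \<in> nonblank_cells M"
        using ji dim by (simp add: nonblank_cells_def)
      then show ?thesis using ji by (simp add: nb Z_def)
    qed
    moreover have "rising (j, i) \<longleftrightarrow> M $$ (j, i) = Increasing" if "(j, i) \<in> Z"
      using that by (auto simp: rising_def Z_def row_sign_def col_sign_def)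
    ultimately show ?thesis by (cases "M $$ (j, i)") auto
  qed
  then have "cross_matrix r c j0 i0 (col_sign M j0 i0) (row_sign M i0) M"
    using dim by unfold_locales (auto simp: col_sign_def)
  then show thesis by (rule that)
qed

text \<open>
  The blank entries of a corner type record whether the corner lies in the first or last row or column,
  as is needed for the rotations to be translations near the corner.
\<close>

lemma same_corner_type_aligned:
  assumes M: "cross_matrix r c j0 i0 (col_sign M j0 i0) (row_sign M i0) M"
    and M': "cross_matrix r c j0' i0' (col_sign M' j0' i0') (row_sign M' i0') M'"
    and type: "corner_type M' = corner_type M"
  shows "aligned_crosses r c j0 i0 j0' i0' (col_sign M j0 i0) (row_sign M i0)
    (col_sign M' j0' i0') (row_sign M' i0') (rotate_index r j0 j0') (rotate_index c i0 i0')"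
proof -
  interpret M: cross_matrix r c j0 i0 "col_sign M j0 i0" "row_sign M i0" M by (rule M)
  interpret M': cross_matrix r c j0' i0' "col_sign M' j0' i0'" "row_sign M' i0'" M' by (rule M')
  have nonblank: "M $$ (j, i0) \<noteq> Blank" "M $$ (j0, i) \<noteq> Blank"
    "M' $$ (j, i0') \<noteq> Blank" "M' $$ (j0', i) \<noteq> Blank" if "j \<le> r" "i \<le> c" for j i
    using that M.entry[of j i0] M.entry[of j0 i] M'.entry[of j i0'] M'.entry[of j0' i]
      M.row_in_Z M.col_in_Z M'.row_in_Z M'.col_in_Z M.j0_le M.i0_le M'.j0_le M'.i0_le by auto
  have ct: "M' $$ (j0', i0') = M $$ (j0, i0)"
    "(if i0' = 0 then Blank else M' $$ (j0', i0' - 1)) = (if i0 = 0 then Blank else M $$ (j0, i0 - 1))"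
    "(if i0' < c then M' $$ (j0', i0' + 1) else Blank) = (if i0 < c then M $$ (j0, i0 + 1) else Blank)"
    "(if j0' = 0 then Blank else M' $$ (j0' - 1, i0')) = (if j0 = 0 then Blank else M $$ (j0 - 1, i0))"
    "(if j0' < r then M' $$ (j0' + 1, i0') else Blank) = (if j0 < r then M $$ (j0 + 1, i0) else Blank)"
    using type by (simp_all add: corner_type_def M.corner_eq M'.corner_eq M.rows M'.rows M.cols M'.cols)
  note le = M.j0_le M'.j0_le M.i0_le M'.i0_le
  have ends: "j0 = 0 \<longleftrightarrow> j0' = 0" "j0 = r \<longleftrightarrow> j0' = r" "i0 = 0 \<longleftrightarrow> i0' = 0" "i0 = c \<longleftrightarrow> i0' = c"
  proof -
    have "j0 - 1 \<le> r" "i0 - 1 \<le> c" "j0' - 1 \<le> r" "i0' - 1 \<le> c" using le by linarith+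
    then have "M $$ (j0 - 1, i0) \<noteq> Blank" "M $$ (j0, i0 - 1) \<noteq> Blank"
      "M' $$ (j0' - 1, i0') \<noteq> Blank" "M' $$ (j0', i0' - 1) \<noteq> Blank" using nonblank by blast+
    then show "j0 = 0 \<longleftrightarrow> j0' = 0" "i0 = 0 \<longleftrightarrow> i0' = 0"
      using ct(2,4) by (metis (full_types))+
    have "j0 < r \<Longrightarrow> M $$ (j0 + 1, i0) \<noteq> Blank" "i0 < c \<Longrightarrow> M $$ (j0, i0 + 1) \<noteq> Blank"
      "j0' < r \<Longrightarrow> M' $$ (j0' + 1, i0') \<noteq> Blank" "i0' < c \<Longrightarrow> M' $$ (j0', i0' + 1) \<noteq> Blank"
      using nonblank[of "j0 + 1" "i0 + 1"] nonblank[of "j0' + 1" "i0' + 1"] nonblank(1)[of "j0 + 1" 0]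
        nonblank(2)[of 0 "i0 + 1"] nonblank(3)[of "j0' + 1" 0] nonblank(4)[of 0 "i0' + 1"] by auto
    then have "j0 < r \<longleftrightarrow> j0' < r" "i0 < c \<longleftrightarrow> i0' < c"
      using ct(3,5) by (metis (full_types))+
    then show "j0 = r \<longleftrightarrow> j0' = r" "i0 = c \<longleftrightarrow> i0' = c" using le by auto
  qed
  have shift_j: "rotate_index r j0 j0' j + j0 = j + j0'" if "j \<le> r" "adjacent_or_equal j0 j" for j
    using rotate_index_shift[OF le(1,2) ends(1,2) that] .
  have shift_i: "rotate_index c i0 i0' i + i0 = i + i0'" if "i \<le> c" "adjacent_or_equal i0 i" for i
    using rotate_index_shift[OF le(3,4) ends(3,4) that] .
  have cells_j: "M' $$ (rotate_index r j0 j0' j, i0') = M $$ (j, i0)" if j: "j \<le> r" "adjacent_or_equal j0 j" for j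
  proof -
    consider "j = j0" | "Suc j = j0" | "j = Suc j0" using j(2) unfolding adjacent_or_equal_def by linarith
    then show ?thesis
    proof cases
      case 1
      then have "rotate_index r j0 j0' j = j0'" using shift_j[OF j] by simp
      then show ?thesis using ct(1) 1 by simp
    next
      case 2
      then have "j0' \<noteq> 0" "j0 \<noteq> 0" using ends by auto
      moreover from this have "rotate_index r j0 j0' j = j0' - 1" "j = j0 - 1" using shift_j[OF j] 2 by auto
      ultimately show ?thesis using ct(4) by simp
    next
      case 3
      then have "rotate_index r j0 j0' j = Suc j0'" using shift_j[OF j] by simp
      moreover have "j0 < r" "j0' < r" using 3 j(1) ends(2) le by auto
      ultimately show ?thesis using ct(5) 3 by simp
    qed
  qed
  have cells_i: "M' $$ (j0', rotate_index c i0 i0' i) = M $$ (j0, i)" if i: "i \<le> c" "adjacent_or_equal i0 i" for i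
  proof -
    consider "i = i0" | "Suc i = i0" | "i = Suc i0" using i(2) unfolding adjacent_or_equal_def by linarith
    then show ?thesis
    proof cases
      case 1
      then have "rotate_index c i0 i0' i = i0'" using shift_i[OF i] by simp
      then show ?thesis using ct(1) 1 by simp
    next
      case 2
      then have "i0' \<noteq> 0" "i0 \<noteq> 0" using ends by auto
      moreover from this have "rotate_index c i0 i0' i = i0' - 1" "i = i0 - 1" using shift_i[OF i] 2 by auto
      ultimately show ?thesis using ct(2) by simp
    next
      case 3
      then have "rotate_index c i0 i0' i = Suc i0'" using shift_i[OF i] by simp
      moreover have "i0 < c" "i0' < c" using 3 i(1) ends(4) le by auto
      ultimately show ?thesis using ct(3) 3 by simp
    qed
  qed
  show ?thesis
  proof unfold_locales
    show "bij_betw (rotate_index r j0 j0') {..r} {..r}" "bij_betw (rotate_index c i0 i0') {..c} {..c}"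
      using le by (simp_all add: bij_rotate_index)
  next
    fix j assume j: "j \<le> r"
    show "adjacent_or_equal j0' (rotate_index r j0 j0' j) = adjacent_or_equal j0 j"
      using rotate_index_near[OF le(1,2) ends(1,2) j] .
    assume near: "adjacent_or_equal j0 j"
    show "rotate_index r j0 j0' j + j0 = j + j0'" using shift_j[OF j near] .
    show "row_sign M' i0' (rotate_index r j0 j0' j) = row_sign M i0 j"
      using cells_j[OF j near] by (simp add: row_sign_def)
  next
    fix i assume i: "i \<le> c"
    show "adjacent_or_equal i0' (rotate_index c i0 i0' i) = adjacent_or_equal i0 i"
      using rotate_index_near[OF le(3,4) ends(3,4) i] .
    assume near: "adjacent_or_equal i0 i"
    show shift: "rotate_index c i0 i0' i + i0 = i + i0'" using shift_i[OF i near] .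
    have "rotate_index c i0 i0' i = i0' \<longleftrightarrow> i = i0" using shift by linarith
    then show "col_sign M' j0' i0' (rotate_index c i0 i0' i) = col_sign M j0 i0 i"
      using cells_i[OF i near] ct(1) by (simp add: col_sign_def row_sign_def)
  qed
qed

theorem theorem4p6:
  fixes M :: gridding_matrix and r c p :: nat and q \<theta> g :: real
  assumes M: "connected_one_corner r c M"
    and p: "p = card (noncorner_peaks M)"
    and q: "q = sqrt ((real r + real c + 1)\<^sup>2 - 4 * real c * real r)"
    and \<theta>: "\<theta> = (real r + real c + q + 1) / (2 * q)"
    and g: "g = (real r + real c + q + 1) / 2"
  shows "\<exists>\<kappa>::real. is_correction_factor (corner_type M) r c \<kappa> \<and>
    (\<lambda>n. real (card (Grid n M)) / ((1 / 2) ^ p * \<kappa> * \<theta> * g ^ n)) \<longlonglongrightarrow> 1"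
proof -
  obtain j0 i0 where cm: "cross_matrix r c j0 i0 (col_sign M j0 i0) (row_sign M i0) M"
    using connected_one_corner_cross_matrix[OF M] .
  interpret cross_matrix r c j0 i0 "col_sign M j0 i0" "row_sign M i0" M by (rule cm)
  obtain x where x: "x > 0" "(\<lambda>n. real (card (Grid n M)) / real (card (Gridded n M))) \<longlonglongrightarrow> x"
    using Grid_ratio_limit .
  \<comment> \<open>The limit for any matrix of this corner type without non-corner peaks.\<close>
  define \<kappa> where "\<kappa> = 2 ^ p * x"
  have "is_correction_factor (corner_type M) r c \<kappa>"
    unfolding is_correction_factor_def
  proof (intro allI impI, elim conjE)
    fix M' assume M': "connected_one_corner r c M'" and type: "corner_type M' = corner_type M"
      and no_peaks: "noncorner_peaks M' = {}"
    obtain j0' i0' where cm': "cross_matrix r c j0' i0' (col_sign M' j0' i0') (row_sign M' i0') M'"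
      using connected_one_corner_cross_matrix[OF M'] .
    obtain x' where x': "(\<lambda>n. real (card (Grid n M')) / real (card (Gridded n M'))) \<longlonglongrightarrow> x'"
      using cross_matrix.Grid_ratio_limit[OF cm'] by blast
    have "2 ^ card (noncorner_peaks M) * x = 2 ^ card (noncorner_peaks M') * x'"
      by (rule Grid_ratio_limits_agree[OF same_corner_type_aligned[OF cm cm' type] cm cm' x(2) x'])
    then have "x' = \<kappa>" by (simp add: \<kappa>_def p no_peaks)
    then show "(\<lambda>n. real (card (Grid n M')) / real (card (Gridded n M'))) \<longlonglongrightarrow> \<kappa>" using x' by simp
  qed
  moreover have "(\<lambda>n. real (card (Grid n M)) / ((1 / 2) ^ p * \<kappa> * \<theta> * g ^ n)) \<longlonglongrightarrow> 1"
  proof -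
    have gap: "q = root_gap" by (simp add: q root_gap_def card_row_cells card_col_cells)
    have growth: "g = growth" by (simp add: g growth_def gap card_row_cells card_col_cells)
    have \<theta>_eq: "\<theta> = growth / root_gap" using root_gap_pos by (simp add: \<theta> growth_def gap card_row_cells card_col_cells)
    have pos: "\<theta> > 0" "g > 0" using growth_bounds root_gap_pos by (simp_all add: \<theta>_eq growth)
    have "(\<lambda>n. (real (card (Grid n M)) / real (card (Gridded n M))) * (real (W n) / growth ^ n) / (x * \<theta>))
        \<longlonglongrightarrow> x * (growth / root_gap) / (x * \<theta>)"
      using x(1) pos by (intro tendsto_intros x(2) W_asymp) auto
    moreover have "x * (growth / root_gap) / (x * \<theta>) = 1" using x(1) growth_bounds(1) root_gap_pos by (simp add: \<theta>_eq)
    moreover have "(real (card (Grid n M)) / real (card (Gridded n M))) * (real (W n) / growth ^ n) / (x * \<theta>)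
        = real (card (Grid n M)) / ((1 / 2) ^ p * \<kappa> * \<theta> * g ^ n)" for n
    proof -
      have "(1 / 2) ^ p * \<kappa> = x" by (simp add: \<kappa>_def power_divide)
      then show ?thesis using W_pos[of n] by (simp add: card_Gridded growth mult_ac)
    qed
    ultimately show ?thesis by simp
  qed
  ultimately show ?thesis by blast
qed

end
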